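(* Let $0<q<p<\infty$ and let $\mu$ be a positive Borel measure on $\mathbb{D}$. Then the following conditions are equivalent: (i) the identity (embedding) operator $I_d:H^p\to L^q(\mu)$ is compact; (ii) $I_d:H^p\to L^q(\mu)$ is bounded; (iii) the function $$B_\mu(\zeta)=\int_{\Gamma(\zeta)}\frac{d\mu(z)}{1-|z|},\qquad \zeta\in\mathbb{T},$$ belongs to $L^{\frac{p}{p-q}}(\mathbb{T},m)$.
   Context: $\mathbb{D}$ is the open unit disc of $\mathbb{C}$, $\mathbb{T}$ the unit circle, and $m$ arclength measure on $\mathbb{T}$. $H^p$ is the standard Hardy space of analytic functions on $\mathbb{D}$, and $I_d(f)=f$. An operator $H^p\to L^q(\mu)$ is compact if it maps $H^p$ into $L^q(\mu)$ and the image of every norm-bounded sequence has a subsequence converging in $L^q(\mu)$ (the spaces are only quasi-normed when the exponent is less than $1$). For $\zeta\in\mathbb{T}$, $\Gamma(\zeta)=\{z\in\mathbb{D}:|\arg\zeta-\arg z|<\frac12(1-|z|)\}$ (a lens-type region with vertex at $\zeta$). *)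

theory Defs
  imports "HOL-Analysis.Analysis"
begin

abbreviation unit_disc :: "complex set" where
  "unit_disc \<equiv> ball 0 1"

abbreviation unit_circle :: "complex set" where
  "unit_circle \<equiv> sphere 0 1"

text \<open>Unnormalised: the total mass is \<open>2 * pi\<close>.\<close>
definition arclength :: "complex measure" where
  "arclength = distr (restrict_space lborel {0..<2 * pi}) (restrict_space borel unit_circle) cis"

definition hardy_mean :: "real \<Rightarrow> (complex \<Rightarrow> complex) \<Rightarrow> real \<Rightarrow> real" where
  "hardy_mean p f r =
     (1 / (2 * pi) * integral {0..2 * pi} (\<lambda>t. norm (f (of_real r * cis t)) powr p)) powr (1 / p)"

definition hardy_space :: "real \<Rightarrow> (complex \<Rightarrow> complex) set" where
  "hardy_space p = {f. f holomorphic_on unit_disc \<and> bdd_above (hardy_mean p f ` {0<..<1})}"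

definition hardy_norm :: "real \<Rightarrow> (complex \<Rightarrow> complex) \<Rightarrow> real" where
  "hardy_norm p f = (SUP r\<in>{0<..<1}. hardy_mean p f r)"

definition Lp_space :: "real \<Rightarrow> 'a measure \<Rightarrow> ('a \<Rightarrow> 'b::real_normed_vector) set" where
  "Lp_space q M = {f \<in> borel_measurable M. integrable M (\<lambda>x. norm (f x) powr q)}"

definition Lp_norm :: "real \<Rightarrow> 'a measure \<Rightarrow> ('a \<Rightarrow> 'b::real_normed_vector) \<Rightarrow> real" where
  "Lp_norm q M f = (\<integral>x. norm (f x) powr q \<partial>M) powr (1 / q)"

text \<open>Membership in \<open>L\<^sup>s\<close> of a function with values in \<open>[0, \<infinity>]\<close>. Finiteness almost
  everywhere has to be demanded separately because \<open>enn2real\<close> maps \<open>\<infinity>\<close> to \<open>0\<close>.\<close>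
definition Lp_space_ennreal :: "real \<Rightarrow> 'a measure \<Rightarrow> ('a \<Rightarrow> ennreal) set" where
  "Lp_space_ennreal s M =
     {f \<in> borel_measurable M. (AE x in M. f x < \<infinity>) \<and> (\<lambda>x. enn2real (f x)) \<in> Lp_space s M}"

definition bounded_hardy_Lp ::
    "real \<Rightarrow> real \<Rightarrow> complex measure \<Rightarrow> ((complex \<Rightarrow> complex) \<Rightarrow> (complex \<Rightarrow> complex)) \<Rightarrow> bool" where
  "bounded_hardy_Lp p q \<mu> T \<longleftrightarrow>
     (\<forall>f\<in>hardy_space p. T f \<in> Lp_space q \<mu>) \<and>
     (\<exists>C. \<forall>f\<in>hardy_space p. Lp_norm q \<mu> (T f) \<le> C * hardy_norm p f)"

definition compact_hardy_Lp ::
    "real \<Rightarrow> real \<Rightarrow> complex measure \<Rightarrow> ((complex \<Rightarrow> complex) \<Rightarrow> (complex \<Rightarrow> complex)) \<Rightarrow> bool" where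
  "compact_hardy_Lp p q \<mu> T \<longleftrightarrow>
     (\<forall>f\<in>hardy_space p. T f \<in> Lp_space q \<mu>) \<and>
     (\<forall>F. (\<forall>n::nat. F n \<in> hardy_space p) \<and> bdd_above (range (\<lambda>n. hardy_norm p (F n))) \<longrightarrow>
        (\<exists>r g. strict_mono r \<and> g \<in> Lp_space q \<mu> \<and>
           (\<lambda>n. Lp_norm q \<mu> (\<lambda>z. T (F (r n)) z - g z)) \<longlonglongrightarrow> 0))"

text \<open>Arguments are compared modulo \<open>2 * pi\<close>: \<open>is_Arg\<close> ranges over all determinations of the
  argument. Every real number is an argument of \<open>0\<close>, so \<open>0\<close> lies in every region.\<close>
definition lens_region :: "complex \<Rightarrow> complex set" where
  "lens_region \<zeta> = {z \<in> unit_disc. \<exists>s t. is_Arg \<zeta> s \<and> is_Arg z t \<and> \<bar>s - t\<bar> < (1 - norm z) / 2}"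

definition B_fun :: "complex measure \<Rightarrow> complex \<Rightarrow> ennreal" where
  "B_fun \<mu> \<zeta> = (\<integral>\<^sup>+z\<in>lens_region \<zeta>. ennreal (1 / (1 - norm z)) \<partial>\<mu>)"

end

theory Submission
  imports Defs "HOL-Complex_Analysis.Complex_Analysis"
begin

text \<open>Write \<open>t = p / q > 1\<close>, with conjugate exponent \<open>s = p / (p - q)\<close>. Averaging over the points
  \<open>\<zeta>\<close> with \<open>z\<close> in \<open>\<Gamma>(\<zeta>)\<close>, a set of measure about \<open>1 - \<bar>z\<bar>\<close>, bounds the integral of
  \<open>\<bar>f\<bar> powr q\<close> against \<open>\<mu>\<close> by that of \<open>(N f) powr q * B\<close> over the circle, where \<open>N f\<close> is the nontangential
  maximal function; since \<open>N\<close> is bounded on \<open>H\<^sup>p\<close>, Hoelder's inequality shows that \<open>B \<in> L\<^sup>s\<close> suffices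
  for boundedness. Applied to the restriction of \<open>\<mu>\<close> to a thin annulus at the boundary the same estimate has a small
  constant, and together with Montel's theorem this gives compactness.

  Conversely, let \<open>h \<ge> 1\<close> on the circle and let \<open>H\<close> be its Herglotz integral. As \<open>Re H > 0\<close>, the function
  \<open>H powr (1 / q)\<close> is holomorphic; by M. Riesz's theorem its \<open>p\<close>-th power mean is at most a multiple of the integral
  of \<open>h powr t\<close>, while \<open>\<bar>H\<bar>\<close> is at least the Poisson integral of \<open>h\<close>, which dominates the averages
  of \<open>h\<close> over the arcs of those \<open>\<zeta>\<close> with \<open>z\<close> in \<open>\<Gamma>(\<zeta>)\<close>. Boundedness of the embedding
  therefore bounds the integral of \<open>h * B\<close> by the \<open>L\<^sup>t\<close> norm of \<open>h\<close>, and duality gives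
  \<open>B \<in> L\<^sup>s\<close>.\<close>

section \<open>The Poisson kernel\<close>

text \<open>Since \<open>p\<close> may be at most 1, the maximal inequality cannot be applied to the
  modulus of \<open>f\<close>. It is applied in L2 to \<open>norm f powr (p / 2)\<close>, which is
  subharmonic, so a dyadic L2 inequality suffices. Boundary values are avoided: estimates are made
  for dilates, which are holomorphic across the circle, and Fatou's lemma lets the radius tend to 1.

  The measure is an arbitrary Borel measure, whereas the exchange of integrals calls for
  sigma-finiteness. Each condition supplies it in its own way: under (ii) the constant function 1
  makes \<open>\<mu>\<close> finite; under (iii) the disc is covered by countably many regions whose
  vertex has finite \<open>B\<close>.

  M. Riesz's theorem is proved for exponents in (1, 2], where \<open>Re (w powr \<tau>)\<close> is
  negative near the imaginary axis and so controls \<open>norm w powr \<tau>\<close> there. Larger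
  \<open>t\<close> are reduced to exponent 2 by feeding a power of \<open>h\<close> into the
  Herglotz integral and returning to \<open>h\<close> with Jensen's inequality. In the duality step
  the test function is a power of a truncation of \<open>B\<close>, bounded below by 1 so that it is
  an admissible \<open>h\<close>.\<close>

definition circle_exp :: "real \<Rightarrow> complex" where
  "circle_exp x = cis (2 * pi * x)"

text \<open>With the circle parametrised by the unit interval the kernel has mass 1 and no factor
  \<open>1 / (2 * pi)\<close> occurs.\<close>

definition poisson :: "complex \<Rightarrow> real \<Rightarrow> real" where
  "poisson z x = (1 - (norm z)\<^sup>2) / (norm (circle_exp x - z))\<^sup>2"

lemma norm_circle_exp [simp]: "norm (circle_exp x) = 1"
  by (simp add: circle_exp_def)

lemma circle_exp_neq_0 [simp]: "circle_exp x \<noteq> 0"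
  by (metis norm_circle_exp norm_zero zero_neq_one)

lemma circle_exp_neq: "norm z < 1 \<Longrightarrow> circle_exp x \<noteq> z"
  by auto

lemma continuous_on_circle_exp [continuous_intros]:
  "continuous_on A f \<Longrightarrow> continuous_on A (\<lambda>x. circle_exp (f x))"
  unfolding circle_exp_def by (intro continuous_intros)

lemma measurable_circle_exp [measurable]: "circle_exp \<in> borel_measurable borel"
  by (intro borel_measurable_continuous_onI continuous_on_circle_exp continuous_on_id)

lemma circle_exp_periodic: "circle_exp (x + 1) = circle_exp x"
  by (simp add: circle_exp_def ring_distribs flip: cis_mult)

lemma poisson_pos: "norm z < 1 \<Longrightarrow> 0 < poisson z x"
  unfolding poisson_def using circle_exp_neq[of z x]
  by (intro divide_pos_pos) (auto simp: power_less_one_iff abs_square_less_1)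

lemma continuous_on_poisson:
  "norm z < 1 \<Longrightarrow> continuous_on A f \<Longrightarrow> continuous_on A (\<lambda>x. poisson z (f x))"
  unfolding poisson_def using circle_exp_neq[of z] by (intro continuous_intros) auto

lemma borel_measurable_poisson [measurable (raw)]:
  assumes [measurable]: "f \<in> borel_measurable M" "g \<in> borel_measurable M"
  shows "(\<lambda>x. poisson (f x) (g x)) \<in> borel_measurable M"
  unfolding poisson_def by measurable

lemma poisson_le:
  assumes "norm z < 1"
  shows "poisson z x \<le> 2 / (1 - norm z)"
proof -
  have "1 - norm z \<le> norm (circle_exp x - z)"
    using norm_triangle_ineq2[of "circle_exp x" z] by simp
  then have "(1 - norm z)\<^sup>2 \<le> (norm (circle_exp x - z))\<^sup>2"
    using assms by (intro power_mono) auto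
  then have "poisson z x \<le> (1 - (norm z)\<^sup>2) / (1 - norm z)\<^sup>2"
    unfolding poisson_def using assms circle_exp_neq[OF assms, of x]
    by (intro divide_left_mono mult_pos_pos) (auto simp: abs_square_le_1)
  also have "\<dots> = (1 + norm z) / (1 - norm z)"
    using assms by (simp add: divide_simps power2_eq_square) (simp add: algebra_simps)
  also have "\<dots> \<le> 2 / (1 - norm z)"
    using assms by (intro divide_right_mono) auto
  finally show ?thesis .
qed

text \<open>The squared distances on both sides are
  \<open>1 + \<rho>^2 - 2 * \<rho> * cos (2 * pi * (x - y))\<close>. Symmetry lets the kernel be
  integrated over the point of the disc instead of the boundary variable.\<close>

lemma poisson_sym:
  "poisson (of_real \<rho> * circle_exp y) x = poisson (of_real \<rho> * circle_exp x) y"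
proof -
  have *: "norm (circle_exp x - of_real \<rho> * circle_exp y)
      = norm (circle_exp y - of_real \<rho> * circle_exp x)" for x y
  proof -
    have "(norm (circle_exp x - of_real \<rho> * circle_exp y))\<^sup>2
        = (norm (circle_exp y - of_real \<rho> * circle_exp x))\<^sup>2"
    proof -
      have "(a - \<rho> * c)\<^sup>2 + (b - \<rho> * d)\<^sup>2 = (c - \<rho> * a)\<^sup>2 + (d - \<rho> * b)\<^sup>2"
        if "a\<^sup>2 + b\<^sup>2 = 1" "c\<^sup>2 + d\<^sup>2 = 1" for a b c d :: real
        using that by algebra
      then show ?thesis
        unfolding cmod_power2 by (simp add: circle_exp_def)
    qed
    then show ?thesis by (simp add: power2_eq_iff_nonneg)
  qed
  show ?thesis unfolding poisson_def by (subst *) (simp add: norm_mult)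
qed

text \<open>Cauchy's formula for \<open>G w * (1 - \<bar>z\<bar>\<^sup>2) / (1 - cnj z * w)\<close> at \<open>w = z\<close>.\<close>

lemma has_integral_poisson:
  assumes cont: "continuous_on (cball 0 1) G" and hol: "G holomorphic_on ball 0 1" and z: "norm z < 1"
  shows "((\<lambda>x. of_real (poisson z x) * G (circle_exp x)) has_integral G z) {0..1}"
proof -
  have nz: "cnj z * w \<noteq> 1" if "norm w \<le> 1" for w
  proof
    assume "cnj z * w = 1"
    then have "norm (cnj z * w) = 1" by simp
    moreover have "norm z * norm w \<le> norm z * 1" using that by (intro mult_left_mono) auto
    ultimately show False using z by (simp add: norm_mult)
  qed
  define F where "F w = G w * (1 - z * cnj z) / (1 - cnj z * w)" for w
  have "((\<lambda>w. F w / (w - z)) has_contour_integral (2 * of_real pi * \<i> * F z)) (circlepath 0 1)"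
  proof (rule Cauchy_integral_circlepath)
    show "continuous_on (cball 0 1) F"
      unfolding F_def by (intro continuous_intros cont) (auto simp: nz)
    show "F holomorphic_on ball 0 1"
      unfolding F_def by (intro holomorphic_intros hol) (auto simp: nz)
  qed (use z in auto)
  moreover have Fz: "F z = G z" using nz[of z] z by (simp add: F_def mult.commute)
  ultimately have 1: "((\<lambda>x. F (circlepath 0 1 x) / (circlepath 0 1 x - z) *
      vector_derivative (circlepath 0 1) (at x within {0..1})) has_integral 2 * of_real pi * \<i> * G z) {0..1}"
    unfolding has_contour_integral_def by simp
  have 2: "F (circlepath 0 1 x) / (circlepath 0 1 x - z) *
      vector_derivative (circlepath 0 1) (at x within {0..1}) =
      2 * of_real pi * \<i> * (of_real (poisson z x) * G (circle_exp x))" if "x \<in> {0..1}" for x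
  proof -
    define w where "w = circle_exp x"
    have w: "norm w = 1" "w \<noteq> 0" "w \<noteq> z"
      using z by (auto simp: w_def)
    have cw: "cnj w = 1 / w"
      using w(1) complex_norm_square[of w] w(2) by (simp add: field_simps)
    have cp: "circlepath 0 1 x = w"
      by (simp add: circlepath w_def circle_exp_def cis_conv_exp mult_ac)
    have vd: "vector_derivative (circlepath 0 1) (at x within {0..1}) = 2 * of_real pi * \<i> * w"
      using that vector_derivative_circlepath01[of x 0 1]
      by (simp add: w_def circle_exp_def cis_conv_exp mult_ac)
    have nw: "(norm (w - z))\<^sup>2 \<noteq> 0" using w by simp
    \<comment> \<open>On the circle \<open>cnj w = 1 / w\<close>, which makes the squared distance a
      rational function of \<open>w\<close>; the factor \<open>w\<close> left over matches the
      derivative of the path.\<close>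
    have "of_real (poisson z x) = (1 - z * cnj z) / ((w - z) * cnj (w - z))"
      unfolding poisson_def w_def[symmetric] using complex_norm_square[of z] complex_norm_square[of "w - z"]
      by (simp only: of_real_divide of_real_diff of_real_1 of_real_power)
    also have "\<dots> = (1 - z * cnj z) * w / ((w - z) * (1 - cnj z * w))"
    proof -
      have "cnj (w - z) = (1 - cnj z * w) / w" using w(2) by (simp add: cw field_simps)
      then show ?thesis by (simp add: mult_ac)
    qed
    finally show ?thesis
      unfolding cp vd by (simp add: F_def w_def[symmetric] mult_ac)
  qed
  have "((\<lambda>x. 2 * of_real pi * \<i> * (of_real (poisson z x) * G (circle_exp x)))
      has_integral 2 * of_real pi * \<i> * G z) {0..1}"
    by (rule has_integral_eq[OF _ 1]) (rule 2)
  from has_integral_mult_right[OF this, of "1 / (2 * of_real pi * \<i>)"] show ?thesis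
    by simp
qed

lemma has_integral_poisson_1:
  assumes "norm z < 1"
  shows "(poisson z has_integral 1) {0..1}"
  using has_integral_linear[OF has_integral_poisson[OF _ _ assms, of "\<lambda>_. 1"] bounded_linear_Re]
  by (simp add: o_def)

lemma has_integral_mean_value:
  assumes "continuous_on (cball 0 1) G" "G holomorphic_on ball 0 1"
  shows "((\<lambda>x. G (circle_exp x)) has_integral G 0) {0..1}"
  using has_integral_poisson[OF assms, of 0] by (simp add: poisson_def)

definition poisson_int :: "(real \<Rightarrow> real) \<Rightarrow> complex \<Rightarrow> real" where
  "poisson_int u z = integral {0..1} (\<lambda>x. poisson z x * u x)"

lemma poisson_int_integrable:
  assumes "norm z < 1" "continuous_on {0..1} u"
  shows "(\<lambda>x. poisson z x * u x) integrable_on {0..1}"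
  by (intro integrable_continuous_real continuous_intros continuous_on_poisson assms)

lemma poisson_int_mono:
  assumes "norm z < 1" "continuous_on {0..1} u" "continuous_on {0..1} v"
    and "\<And>x. x \<in> {0..1} \<Longrightarrow> u x \<le> v x"
  shows "poisson_int u z \<le> poisson_int v z"
  unfolding poisson_int_def
  by (intro integral_le poisson_int_integrable assms mult_left_mono less_imp_le[OF poisson_pos])

lemma poisson_int_const: "norm z < 1 \<Longrightarrow> poisson_int (\<lambda>_. c) z = c"
  unfolding poisson_int_def using has_integral_mult_left[OF has_integral_poisson_1, of z c]
  by (simp only: mult_1_left integral_unique)

lemma poisson_int_add:
  assumes "norm z < 1" "continuous_on {0..1} u" "continuous_on {0..1} v"
  shows "poisson_int (\<lambda>x. u x + v x) z = poisson_int u z + poisson_int v z"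
  unfolding poisson_int_def using poisson_int_integrable[OF assms(1)] assms(2,3)
  by (simp add: ring_distribs integral_add)

section \<open>Subharmonicity of powers of the modulus\<close>

lemma continuous_on_powr_nonneg [continuous_intros]:
  fixes f :: "'a::topological_space \<Rightarrow> real"
  assumes "continuous_on A f" and "\<And>x. x \<in> A \<Longrightarrow> 0 \<le> f x" "0 < a"
  shows "continuous_on A (\<lambda>x. f x powr a)"
  using assms by (auto intro!: continuous_on_powr')

text \<open>For a zero-free function the power \<open>g powr a\<close> is holomorphic; dilating by \<open>\<rho> < 1\<close> takes
  care of zeros on the boundary.\<close>

lemma norm_powr_le_poisson_int_zero_free:
  assumes hol: "g holomorphic_on ball 0 R" and R: "1 < R" and a: "0 < a" and z: "norm z < 1"
    and nz: "\<And>w. norm w < 1 \<Longrightarrow> g w \<noteq> 0"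
  shows "norm (g z) powr a \<le> poisson_int (\<lambda>x. norm (g (circle_exp x)) powr a) z"
proof -
  have contg: "continuous_on (ball 0 R) g" using hol by (rule holomorphic_on_imp_continuous_on)
  define U where "U = (\<lambda>w. norm (g w) powr a)"
  have contU: "continuous_on (ball 0 R) U"
    unfolding U_def using a by (intro continuous_intros contg) auto
  have step: "U (of_real \<rho> * z) \<le> poisson_int (\<lambda>x. U (of_real \<rho> * circle_exp x)) z"
    if \<rho>: "0 < \<rho>" "\<rho> < 1" for \<rho>
  proof -
    have "g holomorphic_on ball 0 1" by (rule holomorphic_on_subset[OF hol]) (use R in auto)
    then obtain L where L: "L holomorphic_on ball 0 1" "\<And>w. w \<in> ball 0 1 \<Longrightarrow> g w = exp (L w)"
      using contractible_imp_holomorphic_log[of g "ball 0 1"] nz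
        convex_imp_contractible[OF convex_ball, of "0::complex" 1] by (metis mem_ball_0)
    define G where "G w = exp (of_real a * L (of_real \<rho> * w))" for w
    have sub: "of_real \<rho> * w \<in> ball 0 1" if "norm w \<le> 1" for w :: complex
      using le_less_trans[OF mult_left_mono[OF that, of \<rho>], of 1] \<rho> by (simp add: norm_mult)
    have nG: "norm (G w) = U (of_real \<rho> * w)" if "norm w \<le> 1" for w
      unfolding G_def U_def L(2)[OF sub[OF that]] by (simp add: powr_def)
    have "((\<lambda>x. of_real (poisson z x) * G (circle_exp x)) has_integral G z) {0..1}"
    proof (rule has_integral_poisson[OF _ _ z])
      show "continuous_on (cball 0 1) G" unfolding G_def
        by (intro continuous_intros continuous_on_compose2[OF holomorphic_on_imp_continuous_on[OF L(1)]])
           (use sub in auto)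
      show "G holomorphic_on ball 0 1" unfolding G_def
        by (intro holomorphic_intros holomorphic_on_compose_gen[OF _ L(1), unfolded o_def]) (use sub in auto)
    qed
    note G = this
    have "norm (G z) \<le> integral {0..1} (\<lambda>x. poisson z x * U (of_real \<rho> * circle_exp x))"
      unfolding integral_unique[OF G, symmetric]
    proof (rule integral_norm_bound_integral)
      show "(\<lambda>x. of_real (poisson z x) * G (circle_exp x)) integrable_on {0..1}" using G by blast
      show "(\<lambda>x. poisson z x * U (of_real \<rho> * circle_exp x)) integrable_on {0..1}"
        by (intro poisson_int_integrable z continuous_on_compose2[OF contU] continuous_intros)
           (use \<rho> R in \<open>auto simp: norm_mult\<close>)
      show "norm (of_real (poisson z x) * G (circle_exp x)) \<le> poisson z x * U (of_real \<rho> * circle_exp x)" for x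
        using nG[of "circle_exp x"] poisson_pos[OF z, of x] by (simp add: norm_mult)
    qed
    then show ?thesis using nG[of z] z by (simp add: poisson_int_def)
  qed
  have "U z \<le> poisson_int (\<lambda>x. U (circle_exp x)) z + e" if "0 < e" for e
  proof -
    have "uniformly_continuous_on (cball 0 1) U"
      by (intro compact_uniformly_continuous continuous_on_subset[OF contU]) (use R in auto)
    then obtain d where d: "0 < d" "\<And>w w'. w \<in> cball 0 1 \<Longrightarrow> w' \<in> cball 0 1 \<Longrightarrow> dist w' w < d \<Longrightarrow> dist (U w') (U w) < e / 2"
      unfolding uniformly_continuous_on_def using \<open>0 < e\<close> half_gt_zero by metis
    define \<rho> where "\<rho> = max (1/2) (1 - d / 2)"
    have \<rho>: "0 < \<rho>" "\<rho> < 1" "1 - \<rho> < d" using d(1) by (auto simp: \<rho>_def)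
    have near: "\<bar>U (of_real \<rho> * w) - U w\<bar> < e / 2" if "norm w \<le> 1" for w :: complex
    proof -
      have "norm (of_real \<rho> * w - w) = (1 - \<rho>) * norm w"
      proof -
        have "of_real \<rho> * w - w = of_real (\<rho> - 1) * w" by (simp add: algebra_simps)
        then show ?thesis using \<rho> by (simp only: norm_mult norm_of_real) simp
      qed
      also have "\<dots> < d" using le_less_trans[OF mult_left_mono[OF that, of "1 - \<rho>"], of d] \<rho> by simp
      finally have "dist (of_real \<rho> * w) w < d" by (simp add: dist_norm)
      moreover have "norm (of_real \<rho> * w) \<le> 1"
        using that \<rho> mult_mono[of \<rho> 1 "norm w" 1] by (simp add: norm_mult)
      ultimately show ?thesis using d(2)[of w "of_real \<rho> * w"] that by (simp add: dist_real_def)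
    qed
    have c1: "continuous_on {0..1} (\<lambda>x. U (of_real \<rho> * circle_exp x))"
      by (intro continuous_on_compose2[OF contU] continuous_intros)
         (use \<rho> R in \<open>auto simp: norm_mult\<close>)
    have c2: "continuous_on {0..1} (\<lambda>x. U (circle_exp x))"
      by (intro continuous_on_compose2[OF contU] continuous_intros) (use R in auto)
    have le: "U (of_real \<rho> * circle_exp x) \<le> U (circle_exp x) + e / 2" for x
      using near[of "circle_exp x", OF eq_refl[OF norm_circle_exp]] by linarith
    have "U z \<le> U (of_real \<rho> * z) + e / 2" using near[of z] z by linarith
    also have "\<dots> \<le> poisson_int (\<lambda>x. U (of_real \<rho> * circle_exp x)) z + e / 2"
      using step[OF \<rho>(1,2)] by simp
    also have "\<dots> \<le> poisson_int (\<lambda>x. U (circle_exp x) + e / 2) z + e / 2"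
      by (intro add_right_mono poisson_int_mono z c1 continuous_on_add c2 continuous_on_const le)
    also have "\<dots> = poisson_int (\<lambda>x. U (circle_exp x)) z + e"
      using z by (simp add: poisson_int_add c2 poisson_int_const)
    finally show ?thesis .
  qed
  then show ?thesis unfolding U_def by (rule field_le_epsilon)
qed

text \<open>Each zero \<open>a\<close> in the disc is removed by the factor \<open>(1 - cnj a * w) / (w - a)\<close>, which has modulus
  \<open>1\<close> on the circle and at least \<open>1\<close> inside.\<close>

lemma blaschke_norm:
  assumes "norm w = 1"
  shows "norm (1 - cnj a * w) = norm (w - a)"
proof -
  have "(norm (1 - cnj a * w))\<^sup>2 = (norm (w - a))\<^sup>2"
    using assms unfolding cmod_power2 by (simp add: cmod_def) algebra
  then show ?thesis by (simp add: power2_eq_iff_nonneg)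
qed

lemma blaschke_le:
  assumes "norm w < 1" "norm a < 1"
  shows "norm (w - a) \<le> norm (1 - cnj a * w)" 
proof -
  have "(norm (1 - cnj a * w))\<^sup>2 - (norm (w - a))\<^sup>2 = (1 - (norm w)\<^sup>2) * (1 - (norm a)\<^sup>2)"
    unfolding cmod_power2 by (simp, algebra)
  moreover have "0 \<le> (1 - (norm w)\<^sup>2) * (1 - (norm a)\<^sup>2)"
    using assms by (intro mult_nonneg_nonneg) (auto simp: abs_square_le_1)
  ultimately have "(norm (w - a))\<^sup>2 \<le> (norm (1 - cnj a * w))\<^sup>2" by linarith
  then show ?thesis by (rule power2_le_imp_le) simp
qed

text \<open>The local factor at \<open>a\<close> and the quotient of \<open>f\<close> by the power
  of \<open>w - a\<close> agree near \<open>a\<close>, so together they define a holomorphic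
  function on all of \<open>S\<close>.\<close>

lemma divide_out_zero:
  assumes hol: "f holomorphic_on S" and S: "open S" "connected S" and a: "a \<in> S"
    and nz: "\<exists>w\<in>S. f w \<noteq> 0"
  obtains g n where "g holomorphic_on S" "g a \<noteq> 0" "\<And>w. w \<in> S \<Longrightarrow> f w = g w * (w - a) ^ n"
proof -
  from zorder_exist_zero[OF hol S a nz] obtain n :: nat and r h where
    r: "0 < r" "cball a r \<subseteq> S" and h: "h holomorphic_on cball a r"
    and fh: "\<And>w. w \<in> cball a r \<Longrightarrow> f w = h w * (w - a) ^ n" "\<And>w. w \<in> cball a r \<Longrightarrow> h w \<noteq> 0"
    by metis
  define g where "g w = (if w \<in> ball a r then h w else f w / (w - a) ^ n)" for w
  show ?thesis
  proof
    have "g holomorphic_on ball a r \<union> (S - {a})"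
      unfolding g_def
    proof (rule holomorphic_on_If_Un)
      show "h holomorphic_on ball a r" using h by (rule holomorphic_on_subset) auto
      show "(\<lambda>w. f w / (w - a) ^ n) holomorphic_on S - {a}"
        by (intro holomorphic_intros holomorphic_on_subset[OF hol]) auto
    qed (use S fh in \<open>auto simp: field_simps intro: open_Diff\<close>)
    then show "g holomorphic_on S" by (rule holomorphic_on_subset) (use r in auto)
    show "g a \<noteq> 0" using fh(2)[of a] r by (simp add: g_def)
    show "f w = g w * (w - a) ^ n" if "w \<in> S" for w
      using fh(1)[of w] r by (auto simp: g_def)
  qed
qed

text \<open>Induction on the number of distinct zeros in the open disc: replacing a zero with its
  full multiplicity by the reflected factors leaves the modulus on the circle unchanged and does not
  decrease it inside, so the bound for the new function gives the one for \<open>f\<close>.\<close>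

lemma norm_powr_le_poisson_int:
  assumes hol: "f holomorphic_on ball 0 R" and R: "1 < R" and a: "0 < a" and z: "norm z < 1"
  shows "norm (f z) powr a \<le> poisson_int (\<lambda>x. norm (f (circle_exp x)) powr a) z"
proof (cases "\<exists>w\<in>ball 0 R. f w \<noteq> 0")
  case False
  then have "f z = 0" "\<And>x. f (circle_exp x) = 0" using R z by auto
  then show ?thesis by (simp add: poisson_int_def)
next
  case True
  \<comment> \<open>The larger disc of holomorphy makes the closed unit disc a compact subset, so
    zeros cannot accumulate at the circle.\<close>
  have fin: "finite {w \<in> ball 0 1. f w = 0}"
  proof (cases "f constant_on ball 0 R")
    case const: True
    have "\<And>w. w \<in> ball 0 1 \<Longrightarrow> f w \<noteq> 0"
      using True const R unfolding constant_on_def by (metis ball_subset_ball_iff dist_self subset_eq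
          add.right_neutral diff_zero less_eq_real_def mem_ball_0 dual_order.strict_trans)
    then have "{w \<in> ball 0 1. f w = 0} = {}" by auto
    then show ?thesis by (metis finite.emptyI)
  next
    case False
    have "finite {w \<in> cball 0 1. f w = 0}"
      by (rule holomorphic_compact_finite_zeros[OF hol _ _ _ _ False]) (use R in auto)
    then show ?thesis by (rule finite_subset[rotated]) auto
  qed
  show ?thesis using hol True fin
  proof (induction "card {w \<in> ball 0 1. f w = 0}" arbitrary: f rule: less_induct)
    case (less f)
    show ?case
    proof (cases "\<exists>b\<in>ball 0 1. f b = 0")
      case False
      then show ?thesis
        by (intro norm_powr_le_poisson_int_zero_free[OF less.prems(1) R a z]) auto
    next
      case True
      then obtain b where b: "norm b < 1" "f b = 0" by auto
      obtain g n where g: "g holomorphic_on ball 0 R" "g b \<noteq> 0"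
        "\<And>w. w \<in> ball 0 R \<Longrightarrow> f w = g w * (w - b) ^ n"
        using divide_out_zero[OF less.prems(1) open_ball _ _ less.prems(2), of b] R b by auto
      define h where "h w = g w * (1 - cnj b * w) ^ n" for w
      have nz: "1 - cnj b * w \<noteq> 0" if "norm w < 1" for w
        using blaschke_le[OF that b(1)] that b norm_mult[of "cnj b" w] mult_strict_mono[of "norm b" 1 "norm w" 1] by auto
      have n: "n \<noteq> 0" using g(2) g(3)[of b] b R by (metis diff_self less_trans mem_ball_0 mult_1_right power_0 )
      have zeros: "{w \<in> ball 0 1. h w = 0} = {w \<in> ball 0 1. f w = 0} - {b}"
        using g(2,3) nz R n by (auto simp: h_def)
      have "norm (h z) powr a \<le> poisson_int (\<lambda>x. norm (h (circle_exp x)) powr a) z"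
      proof (rule less.hyps)
        show "card {w \<in> ball 0 1. h w = 0} < card {w \<in> ball 0 1. f w = 0}"
          unfolding zeros using b less.prems(3) by (intro card_Diff1_less) auto
        show "h holomorphic_on ball 0 R" unfolding h_def by (intro holomorphic_intros g)
        have "h b \<noteq> 0" using g(2) nz[of b] b by (simp add: h_def)
        then show "\<exists>w\<in>ball 0 R. h w \<noteq> 0" using b R by force
        show "finite {w \<in> ball 0 1. h w = 0}" unfolding zeros using less.prems(3) by simp
      qed
      moreover have "norm (f z) \<le> norm (h z)"
        using z R g(3)[of z] blaschke_le[OF z b(1)]
        by (auto simp: h_def norm_mult norm_power intro!: mult_left_mono power_mono)
      moreover have "norm (f (circle_exp x)) = norm (h (circle_exp x))" for x
        using R g(3)[of "circle_exp x"] blaschke_norm[of "circle_exp x" b]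
        by (simp add: h_def norm_mult norm_power)
      ultimately show ?thesis using a by (smt (verit) norm_ge_zero powr_mono2 poisson_int_def integral_cong)
    qed
  qed
qed

section \<open>The nontangential maximal function\<close>

definition avg :: "(real \<Rightarrow> real) \<Rightarrow> real \<Rightarrow> real \<Rightarrow> real" where
  "avg u a l = integral {a..a + l} u / l"

text \<open>The martingale maximal function of depth \<open>n\<close>, unfolded along the dyadic
  tree. The accumulator \<open>A\<close> is the running maximum, the state on which the induction
  for Doob's inequality depends.\<close>

primrec dyadic_max :: "(real \<Rightarrow> real) \<Rightarrow> nat \<Rightarrow> real \<Rightarrow> real \<Rightarrow> real \<Rightarrow> real \<Rightarrow> real" where
  "dyadic_max u 0 a l A x = max A (avg u a l)"
| "dyadic_max u (Suc n) a l A x =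
     (if x < a + l / 2 then dyadic_max u n a (l / 2) (max A (avg u a l)) x
      else dyadic_max u n (a + l / 2) (l / 2) (max A (avg u a l)) x)"

lemma dyadic_max_ge: "A \<le> dyadic_max u n a l A x"
  by (induction n arbitrary: a l A) (simp, metis (no_types) dyadic_max.simps(2) max.bounded_iff)

lemma dyadic_max_mono: "dyadic_max u n a l A x \<le> dyadic_max u (Suc n) a l A x"
proof (induction n arbitrary: a l A)
  case (Suc n)
  show ?case
    unfolding dyadic_max.simps(2)[of u "Suc n"] dyadic_max.simps(2)[of u n a l A]
    using Suc by (simp del: dyadic_max.simps)
qed (auto simp: max_def)

lemma avg_le_bound:
  assumes "continuous_on UNIV u" "\<And>x. u x \<le> K" "0 < l"
  shows "avg u a l \<le> K"
proof -
  have "integral {a..a + l} u \<le> integral {a..a + l} (\<lambda>_. K)"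
    using assms by (intro integral_le integrable_continuous_real) (auto intro: continuous_on_subset)
  then show ?thesis using assms(3) by (simp add: avg_def divide_simps mult_ac)
qed

lemma dyadic_max_le_bound:
  assumes "continuous_on UNIV u" "\<And>x. u x \<le> K" "0 < l" "A \<le> K"
  shows "dyadic_max u n a l A x \<le> K"
  using assms(3,4)
proof (induction n arbitrary: a l A)
  case (Suc n)
  then have "max A (avg u a l) \<le> K" "0 < l / 2" by (auto intro: avg_le_bound assms(1,2))
  then show ?case using Suc.IH by simp
qed (auto intro!: avg_le_bound assms(1,2))

lemma borel_measurable_dyadic_max [measurable]: "dyadic_max u n a l A \<in> borel_measurable borel"
proof (induction n arbitrary: a l A)
  case (Suc n)
  note Suc [measurable]
  show ?case by (subst dyadic_max.simps(2)[abs_def]) measurable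
qed (simp add: dyadic_max.simps(1)[abs_def])

text \<open>A cell of generation \<open>k\<close> containing \<open>x\<close> lies on the path from
  the root to \<open>x\<close>. In the right half the index drops by half the number of
  cells.\<close>

lemma avg_le_dyadic_max:
  assumes "k \<le> n" "0 < l" "a \<le> x" "x < a + l" "a + real j * (l / 2 ^ k) \<le> x" "x < a + real (Suc j) * (l / 2 ^ k)"
  shows "avg u (a + real j * (l / 2 ^ k)) (l / 2 ^ k) \<le> dyadic_max u n a l A x"
  using assms
proof (induction k arbitrary: n l a j A)
  case 0
  have "a + real j * l \<le> x" using "0.prems"(5) by simp
  then have "real j * l < 1 * l" using "0.prems"(4) by linarith
  then have "j = 0" using \<open>0 < l\<close> by (simp only: mult_less_cancel_right) auto
  then show ?case using dyadic_max_ge[of "max A (avg u a l)" u]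
    by (cases n) (auto simp: max.bounded_iff intro: order_trans[OF max.cobounded2 dyadic_max_ge])
next
  case (Suc k)
  then obtain n' where n: "n = Suc n'" "k \<le> n'" by (metis Suc_le_D Suc_le_mono)
  show ?case
  proof (cases "x < a + l / 2")
    case True
    have "avg u (a + real j * ((l / 2) / 2 ^ k)) ((l / 2) / 2 ^ k)
        \<le> dyadic_max u n' a (l / 2) (max A (avg u a l)) x"
      by (rule Suc.IH) (use Suc.prems n True in \<open>simp_all add: field_simps\<close>)
    then show ?thesis using True n by simp
  next
    case False
    have "real (2 ^ k) * (l / 2 ^ Suc k) < real (Suc j) * (l / 2 ^ Suc k)"
    proof -
      have "real (2 ^ k) * (l / 2 ^ Suc k) = l / 2" by simp
      then show ?thesis using False Suc.prems(6) by linarith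
    qed
    then have "real (2 ^ k) < real (Suc j)"
      using \<open>0 < l\<close> by (simp only: mult_less_cancel_right) auto
    then have "2 ^ k \<le> j" by (simp only: of_nat_less_iff)
    then obtain i where j: "j = i + 2 ^ k" by (metis add.commute le_Suc_ex)
    have eq: "a + real j * (l / 2 ^ Suc k) = (a + l / 2) + real i * ((l / 2) / 2 ^ k)"
      by (simp add: j ring_distribs add_divide_distrib)
    have eq': "a + real (Suc j) * (l / 2 ^ Suc k) = (a + l / 2) + real (Suc i) * ((l / 2) / 2 ^ k)"
      by (simp add: j ring_distribs add_divide_distrib)
    have "avg u ((a + l / 2) + real i * ((l / 2) / 2 ^ k)) ((l / 2) / 2 ^ k)
        \<le> dyadic_max u n' (a + l / 2) (l / 2) (max A (avg u a l)) x"
      by (rule Suc.IH, unfold eq[symmetric] eq'[symmetric]) (use Suc.prems n False in auto)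
    then show ?thesis unfolding eq n(1) using False by simp
  qed
qed

lemma avg_square_le:
  assumes u: "continuous_on UNIV u" and l: "0 < l"
  shows "l * (avg u a l)\<^sup>2 \<le> integral {a..a + l} (\<lambda>x. (u x)\<^sup>2)"
proof -
  define c where "c = avg u a l"
  have c: "integral {a..a + l} u = c * l" using l by (simp add: c_def avg_def)
  have cont: "continuous_on {a..a + l} u" using u by (rule continuous_on_subset) simp
  have "0 \<le> integral {a..a + l} (\<lambda>x. (u x - c)\<^sup>2)"
    by (intro integral_nonneg integrable_continuous_real continuous_intros cont) auto
  also have "\<dots> = integral {a..a + l} (\<lambda>x. (u x)\<^sup>2 - (2 * c * u x - c\<^sup>2))"
    by (simp add: power2_diff algebra_simps)
  also have "\<dots> = integral {a..a + l} (\<lambda>x. (u x)\<^sup>2) - (integral {a..a + l} (\<lambda>x. 2 * c * u x) - integral {a..a + l} (\<lambda>x. c\<^sup>2))"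
    by (subst Henstock_Kurzweil_Integration.integral_diff; (subst Henstock_Kurzweil_Integration.integral_diff)?)
       (auto intro!: integrable_continuous_real continuous_intros cont)
  also have "\<dots> = integral {a..a + l} (\<lambda>x. (u x)\<^sup>2) - l * c\<^sup>2"
    using l c by (simp add: power2_eq_square algebra_simps)
  finally show ?thesis unfolding c_def by simp
qed

text \<open>Doob's inequality for the dyadic martingale, by induction with the Bellman function
  \<open>2 * m\<^sup>2 - 4 * m * x\<close> of the running maximum \<open>m\<close> and the current average \<open>x\<close>.\<close>

lemma dyadic_max_square_integral:
  assumes u: "continuous_on UNIV u" and l: "0 < l"
  shows "\<exists>I. ((\<lambda>x. (dyadic_max u n a l A x)\<^sup>2) has_integral I) {a..a + l} \<and>
    I \<le> 4 * integral {a..a + l} (\<lambda>x. (u x)\<^sup>2)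
         + l * (2 * (max A (avg u a l))\<^sup>2 - 4 * max A (avg u a l) * avg u a l)"
  using l
proof (induction n arbitrary: a l A)
  case 0
  define m x where "m = max A (avg u a l)" and "x = avg u a l"
  have "((\<lambda>_. m\<^sup>2) has_integral l * m\<^sup>2) {a..a + l}"
    using has_integral_const_real[of "m\<^sup>2" a "a + l"] 0 by simp
  moreover have "l * m\<^sup>2 \<le> 4 * integral {a..a + l} (\<lambda>x. (u x)\<^sup>2) + l * (2 * m\<^sup>2 - 4 * m * x)"
  proof -
    \<comment> \<open>Doob's constant 4 is fixed here: with Jensen's inequality for the average
      \<open>x\<close>, the claim at a leaf is \<open>(m - 2 * x)^2 \<ge> 0\<close>.\<close>
    have "0 \<le> l * (m - 2 * x)\<^sup>2" using 0 by simp
    also have "\<dots> = 4 * (l * x\<^sup>2) + l * (2 * m\<^sup>2 - 4 * m * x) - l * m\<^sup>2"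
      by (simp add: power2_eq_square algebra_simps)
    finally show ?thesis using avg_square_le[OF u \<open>0 < l\<close>, of a] by (simp add: x_def)
  qed
  ultimately show ?case unfolding m_def x_def by auto
next
  case (Suc n)
  define m where "m = max A (avg u a l)"
  define h where "h = l / 2"
  have h: "0 < h" "a + l = (a + h) + h" "l = 2 * h" using Suc.prems by (auto simp: h_def)
  define x1 x2 where "x1 = avg u a h" and "x2 = avg u (a + h) h"
  have int: "v integrable_on {s..t}" if "continuous_on UNIV v" for v :: "real \<Rightarrow> real" and s t
    using that by (intro integrable_continuous_real) (auto intro: continuous_on_subset)
  have split: "integral {a..a + h} v + integral {a + h..a + l} v = integral {a..a + l} v"
    if "continuous_on UNIV v" for v :: "real \<Rightarrow> real"
    by (rule Henstock_Kurzweil_Integration.integral_combine) (use h in \<open>auto intro!: int that\<close>)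
  have x: "avg u a l = (x1 + x2) / 2"
    using split[OF u] h by (simp add: x1_def x2_def avg_def add.assoc flip: add_divide_distrib)
  obtain I1 where I1: "((\<lambda>x. (dyadic_max u n a h m x)\<^sup>2) has_integral I1) {a..a + h}"
    "I1 \<le> 4 * integral {a..a + h} (\<lambda>x. (u x)\<^sup>2) + h * (2 * (max m x1)\<^sup>2 - 4 * max m x1 * x1)"
    using Suc.IH[OF h(1), of a m] unfolding x1_def by blast
  obtain I2 where I2: "((\<lambda>x. (dyadic_max u n (a + h) h m x)\<^sup>2) has_integral I2) {a + h..a + l}"
    "I2 \<le> 4 * integral {a + h..a + l} (\<lambda>x. (u x)\<^sup>2) + h * (2 * (max m x2)\<^sup>2 - 4 * max m x2 * x2)"
    using Suc.IH[OF h(1), of "a + h" m] unfolding x2_def h(2) by blast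
  have "((\<lambda>x. (dyadic_max u (Suc n) a l A x)\<^sup>2) has_integral (I1 + I2)) {a..a + l}"
  proof (rule has_integral_combine[of a "a + h"])
    show "((\<lambda>x. (dyadic_max u (Suc n) a l A x)\<^sup>2) has_integral I1) {a..a + h}"
      by (rule has_integral_spike_finite[OF _ _ I1(1), of "{a + h}"]) (auto simp: m_def h_def)
    show "((\<lambda>x. (dyadic_max u (Suc n) a l A x)\<^sup>2) has_integral I2) {a + h..a + l}"
      by (rule has_integral_eq[OF _ I2(1)]) (auto simp: m_def h_def)
  qed (use h in auto)
  moreover have "I1 + I2 \<le> 4 * integral {a..a + l} (\<lambda>x. (u x)\<^sup>2) + l * (2 * m\<^sup>2 - 4 * m * avg u a l)"
  proof -
    \<comment> \<open>Raising the running maximum from \<open>m\<close> to \<open>y > m\<close>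
      lowers the Bellman function by \<open>2 * (m - y)^2\<close>; as it is affine in the average,
      the two halves then add up exactly.\<close>
    have bellman: "2 * (max m y)\<^sup>2 - 4 * max m y * y \<le> 2 * m\<^sup>2 - 4 * m * y" for y
    proof (cases "y \<le> m")
      case False
      have "0 \<le> 2 * (m - y)\<^sup>2" by simp
      then show ?thesis using False by (simp add: power2_eq_square algebra_simps)
    qed simp
    have "I1 + I2 \<le> 4 * (integral {a..a + h} (\<lambda>x. (u x)\<^sup>2) + integral {a + h..a + l} (\<lambda>x. (u x)\<^sup>2))
        + h * (2 * (max m x1)\<^sup>2 - 4 * max m x1 * x1) + h * (2 * (max m x2)\<^sup>2 - 4 * max m x2 * x2)"
      using I1(2) I2(2) by simp
    also have "\<dots> \<le> 4 * (integral {a..a + h} (\<lambda>x. (u x)\<^sup>2) + integral {a + h..a + l} (\<lambda>x. (u x)\<^sup>2))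
        + h * (2 * m\<^sup>2 - 4 * m * x1) + h * (2 * m\<^sup>2 - 4 * m * x2)"
      using h bellman[of x1] bellman[of x2] by (intro add_mono mult_left_mono) auto
    also have "\<dots> = 4 * integral {a..a + l} (\<lambda>x. (u x)\<^sup>2) + l * (2 * m\<^sup>2 - 4 * m * avg u a l)"
      unfolding x by (subst split) (auto intro!: continuous_intros u simp: h(3) algebra_simps)
    finally show ?thesis .
  qed
  ultimately show ?case unfolding m_def by blast
qed

lemma dyadic_max_nn_integral:
  assumes u: "continuous_on UNIV u" "\<And>x. 0 \<le> u x" and l: "0 < l"
  shows "(\<integral>\<^sup>+x\<in>{a..a + l}. ennreal ((dyadic_max u n a l 0 x)\<^sup>2) \<partial>lborel)
    \<le> ennreal (4 * integral {a..a + l} (\<lambda>x. (u x)\<^sup>2))"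
proof -
  obtain I where I: "((\<lambda>x. (dyadic_max u n a l 0 x)\<^sup>2) has_integral I) {a..a + l}"
    "I \<le> 4 * integral {a..a + l} (\<lambda>x. (u x)\<^sup>2) + l * (2 * (max 0 (avg u a l))\<^sup>2 - 4 * max 0 (avg u a l) * avg u a l)"
    using dyadic_max_square_integral[OF u(1) l] by blast
  have "0 \<le> avg u a l"
    unfolding avg_def using l by (auto intro!: divide_nonneg_pos integral_nonneg integrable_continuous_real
        continuous_on_subset[OF u(1)] u(2))
  then have "2 * (max 0 (avg u a l))\<^sup>2 - 4 * max 0 (avg u a l) * avg u a l \<le> 0"
    by (simp add: power2_eq_square)
  then have "l * (2 * (max 0 (avg u a l))\<^sup>2 - 4 * max 0 (avg u a l) * avg u a l) \<le> 0"
    using l by (simp only: mult_le_0_iff) auto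
  then have "I \<le> 4 * integral {a..a + l} (\<lambda>x. (u x)\<^sup>2)" using I(2) by linarith
  then show ?thesis by (subst nn_integral_has_integral_lebesgue'[OF _ I(1)]) (auto intro: ennreal_leI)
qed

lemma nn_integral_tendsto_le:
  fixes f :: "nat \<Rightarrow> 'a \<Rightarrow> ennreal"
  assumes "\<And>n. f n \<in> borel_measurable M" "\<And>x. x \<in> space M \<Longrightarrow> (\<lambda>n. f n x) \<longlonglongrightarrow> g x"
    and "\<And>n. integral\<^sup>N M (f n) \<le> c"
  shows "integral\<^sup>N M g \<le> c"
proof -
  have "integral\<^sup>N M g = (\<integral>\<^sup>+x. liminf (\<lambda>n. f n x) \<partial>M)"
    by (intro nn_integral_cong) (metis assms(2) lim_imp_Liminf trivial_limit_sequentially)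
  also have "\<dots> \<le> liminf (\<lambda>n. integral\<^sup>N M (f n))" by (rule nn_integral_liminf[OF assms(1)])
  also have "\<dots> \<le> c"
    by (rule order_trans[OF Liminf_le_Limsup Limsup_bounded]) (use assms(3) in auto)
  finally show ?thesis .
qed

section \<open>Periodic functions and two shifted dyadic grids\<close>

lemma integral_periodic_int:
  fixes u :: "real \<Rightarrow> real"
  assumes per: "\<And>x. u (x + 1) = u x"
  shows "integral {a + of_int k..b + of_int k} u = integral {a..b} u"
proof -
  have 1: "u (x + real n) = u x" for x n
  proof (induction n)
    case (Suc n)
    then show ?case using per[of "x + real n"] by (simp add: add_ac)
  qed simp
  have 2: "u (of_int k + x) = u x" for x
    using 1[of x "nat k"] 1[of "x + of_int k" "nat (-k)"] by (cases "k \<ge> 0") (auto simp: add_ac)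
  show ?thesis
    unfolding integral_shift_Icc_real[symmetric] o_def 2 ..
qed

lemma integral_periodic:
  fixes u :: "real \<Rightarrow> real"
  assumes per: "\<And>x. u (x + 1) = u x" and cont: "continuous_on UNIV u"
  shows "integral {a..a + 1} u = integral {0..1} u"
proof -
  define n where "n = \<lceil>a\<rceil>"
  have n: "a \<le> of_int n" "of_int n \<le> a + 1" unfolding n_def by linarith+
  have int: "u integrable_on {s..t}" for s t
    using cont by (intro integrable_continuous_real) (auto intro: continuous_on_subset)
  have "integral {a..a + 1} u = integral {a..of_int n} u + integral {of_int n..a + 1} u"
    using n by (simp add: Henstock_Kurzweil_Integration.integral_combine int)
  also have "integral {of_int n..a + 1} u = integral {of_int n - 1..a} u"
    using integral_periodic_int[of u "of_int n - 1" 1 a, OF per] by simp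
  also have "integral {a..of_int n} u + integral {of_int n - 1..a} u = integral {of_int n - 1..of_int n} u"
    using n Henstock_Kurzweil_Integration.integral_combine[of "of_int n - 1" a "of_int n" u, OF _ _ int] by simp
  also have "\<dots> = integral {0..1} u"
    using integral_periodic_int[of u 0 "n - 1" 1, OF per] by simp
  finally show ?thesis .
qed

lemma integral_periodic_4:
  fixes u :: "real \<Rightarrow> real"
  assumes per: "\<And>x. u (x + 1) = u x" and cont: "continuous_on UNIV u"
  shows "integral {a..a + 4} u = 4 * integral {0..1} u"
proof -
  have int: "u integrable_on {s..t}" for s t
    using cont by (intro integrable_continuous_real) (auto intro: continuous_on_subset)
  have "integral {a..a + 4} u = integral {a..a + 1} u + integral {a + 1..a + 2} u
      + integral {a + 2..a + 3} u + integral {a + 3..a + 4} u"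
    by (simp add: Henstock_Kurzweil_Integration.integral_combine int)
  then show ?thesis
    using integral_periodic[OF assms, of a] integral_periodic[OF assms, of "a + 1"]
      integral_periodic[OF assms, of "a + 2"] integral_periodic[OF assms, of "a + 3"]
    by (simp add: add.assoc)
qed

text \<open>The two grids are offset by \<open>4 / 3\<close>, and \<open>2 ^ k / 3\<close> has distance \<open>1 / 3\<close> from the integers: no
  interval of length at most a third of the mesh meets both sets of grid points.\<close>

definition grid_max :: "(real \<Rightarrow> real) \<Rightarrow> nat \<Rightarrow> real \<Rightarrow> real" where
  "grid_max u n x = max (dyadic_max u n (-1) 4 0 x) (dyadic_max u n (-7/3) 4 0 x)"

definition maximal_fun :: "(real \<Rightarrow> real) \<Rightarrow> real \<Rightarrow> real" where
  "maximal_fun u x = (SUP n. grid_max u n x)"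

text \<open>If neither grid had a cell containing the interval, each would have a point strictly
  inside it, and the two points would be closer than a third of the mesh. Their difference in units
  of a third of the mesh is the integer \<open>2 ^ k + 3 * (i1 - i2)\<close>, which must then
  vanish, although 3 does not divide a power of 2.\<close>

lemma dyadic_grid_offset:
  fixes c d :: real
  assumes cd: "c < d" "3 * (d - c) \<le> 4 / 2 ^ k" and c: "-1 \<le> c"
  shows "\<exists>b\<in>{-1, -7/3}. \<exists>j::nat. b + real j * (4 / 2 ^ k) \<le> c \<and> d \<le> b + real (Suc j) * (4 / 2 ^ k)"
proof (rule ccontr)
  assume no: "\<not> ?thesis"
  define s :: real where "s = 4 / 2 ^ k"
  have s: "0 < s" by (simp add: s_def)
  have ex: "\<exists>i::int. c < b + of_int i * s \<and> b + of_int i * s < d" if b: "b \<in> {-1, -7/3}" for b :: real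
  proof -
    define j where "j = \<lfloor>(c - b) / s\<rfloor>"
    have j: "of_int j \<le> (c - b) / s" "(c - b) / s < of_int j + 1" unfolding j_def by linarith+
    have j': "of_int j * s \<le> c - b" "c - b < (of_int j + 1) * s"
      using j s by (simp_all add: pos_le_divide_eq pos_divide_less_eq)
    \<comment> \<open>Both grid origins are at most \<open>-1\<close>, so the cell index is a
      natural number.\<close>
    have "0 \<le> (c - b) / s" using b c s by (intro divide_nonneg_pos) auto
    then have "0 \<le> j" by (simp add: j_def)
    then have "real (nat j) = of_int j" by simp
    then have "\<not> d \<le> b + (of_int j + 1) * s"
      using no b j' by (auto simp: s_def dest!: bspec[of _ _ b] spec[of _ "nat j"] simp: add_ac)
    then show ?thesis using j' by (intro exI[of _ "j + 1"]) auto
  qed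
  obtain i1 :: int where i1: "c < -1 + of_int i1 * s" "-1 + of_int i1 * s < d" using ex[of "-1"] by auto
  obtain i2 :: int where i2: "c < -7/3 + of_int i2 * s" "-7/3 + of_int i2 * s < d" using ex[of "-7/3"] by auto
  have "\<bar>4/3 + of_int (i1 - i2) * s\<bar> < d - c" using i1 i2 by (simp add: algebra_simps abs_less_iff)
  then have "3 * \<bar>4/3 + of_int (i1 - i2) * s\<bar> < s" using cd by (simp add: s_def)
  moreover have "of_int (2 ^ k + 3 * (i1 - i2)) * s = 3 * (4/3 + of_int (i1 - i2) * s)"
    by (simp add: s_def field_simps)
  then have "\<bar>of_int (2 ^ k + 3 * (i1 - i2))\<bar> * s = 3 * \<bar>4/3 + of_int (i1 - i2) * s\<bar>"
    using s by (metis abs_mult abs_numeral abs_of_pos)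
  ultimately have "\<bar>of_int (2 ^ k + 3 * (i1 - i2))\<bar> * s < 1 * s" by simp
  then have "\<bar>of_int (2 ^ k + 3 * (i1 - i2)) :: real\<bar> < 1" using s by (simp only: mult_less_cancel_right)
  then have "2 ^ k + 3 * (i1 - i2) = 0" by linarith
  then have "(3::int) dvd 2 ^ k" by presburger
  then have "(3::int) dvd 2" by (rule prime_dvd_power[rotated]) simp
  then show False by simp
qed

context
  fixes u :: "real \<Rightarrow> real"
  assumes cont: "continuous_on UNIV u" and nonneg: "\<And>x. 0 \<le> u x" and per: "\<And>x. u (x + 1) = u x"
begin

lemma u_integrable: "u integrable_on {s..t}"
  using cont by (intro integrable_continuous_real) (auto intro: continuous_on_subset)

lemma u_bounded: obtains K where "\<And>x. u x \<le> K"
proof -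
  have "compact (u ` {0..1})"
    by (intro compact_continuous_image) (auto intro: continuous_on_subset[OF cont])
  then obtain K where K: "\<And>x. x \<in> {0..1} \<Longrightarrow> u x \<le> K"
    using compact_imp_bounded bounded_has_Sup(1) by (metis (no_types) bdd_above.E bounded_imp_bdd_above imageI)
  have 1: "u (x + real n) = u x" for x n
  proof (induction n)
    case (Suc n)
    then show ?case using per[of "x + real n"] by (simp add: add_ac)
  qed simp
  have "u x \<le> K" for x
  proof (cases "0 \<le> x")
    case True
    then show ?thesis using K[of "frac x"] 1[of "frac x" "nat \<lfloor>x\<rfloor>"] frac_lt_1[of x]
      by (simp add: frac_def less_imp_le)
  next
    case False
    then show ?thesis using K[of "frac x"] 1[of x "nat (- \<lfloor>x\<rfloor>)"] frac_lt_1[of x]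
      by (simp add: frac_def less_imp_le)
  qed
  then show ?thesis by (rule that)
qed

lemma grid_max_incseq: "incseq (\<lambda>n. grid_max u n x)"
  unfolding grid_max_def by (intro incseq_SucI max.mono dyadic_max_mono)

lemma grid_max_bdd: "bdd_above (range (\<lambda>n. grid_max u n x))"
proof -
  obtain K where K: "\<And>x. u x \<le> K" by (rule u_bounded) blast
  moreover have "0 \<le> K" using K nonneg order_trans by blast
  ultimately have "grid_max u n x \<le> K" for n
    unfolding grid_max_def by (simp add: dyadic_max_le_bound[OF cont])
  then show ?thesis by (rule bdd_aboveI2)
qed

lemma grid_max_le: "grid_max u n x \<le> maximal_fun u x"
  unfolding maximal_fun_def by (rule cSUP_upper[OF UNIV_I grid_max_bdd])

lemma grid_max_tendsto: "(\<lambda>n. grid_max u n x) \<longlonglongrightarrow> maximal_fun u x"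
  unfolding maximal_fun_def by (rule LIMSEQ_incseq_SUP[OF grid_max_bdd grid_max_incseq])

lemma grid_max_nonneg: "0 \<le> grid_max u n x"
  unfolding grid_max_def using dyadic_max_ge[of 0] by (simp add: le_max_iff_disj)

lemma maximal_fun_nonneg: "0 \<le> maximal_fun u x"
  using grid_max_le grid_max_nonneg order_trans by blast

lemma borel_measurable_maximal_fun: "maximal_fun u \<in> borel_measurable borel"
  by (rule borel_measurable_LIMSEQ_real[OF grid_max_tendsto]) (unfold grid_max_def, measurable)

text \<open>The constant is 2 grids times Doob's 4 times the 4 periods in each root interval. The
  supremum over the depth is reached by Fatou's lemma.\<close>

lemma maximal_fun_nn_integral:
  "(\<integral>\<^sup>+x\<in>{0..<1}. ennreal ((maximal_fun u x)\<^sup>2) \<partial>lborel) \<le> ennreal (32 * integral {0..1} (\<lambda>x. (u x)\<^sup>2))"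
proof (rule nn_integral_tendsto_le)
  define I where "I = integral {0..1} (\<lambda>x. (u x)\<^sup>2)"
  have I: "0 \<le> I" unfolding I_def
    by (intro integral_nonneg integrable_continuous_real continuous_intros continuous_on_subset[OF cont]) auto
  show "(\<lambda>x. ennreal ((grid_max u n x)\<^sup>2) * indicator {0..<1} x) \<in> borel_measurable lborel" for n
    unfolding grid_max_def by measurable
  show "(\<lambda>n. ennreal ((grid_max u n x)\<^sup>2) * indicator {0..<1} x)
      \<longlonglongrightarrow> ennreal ((maximal_fun u x)\<^sup>2) * indicator {0..<1} x" for x
    by (cases "x \<in> {0..<1}") (auto intro!: tendsto_ennrealI tendsto_power grid_max_tendsto)
  fix n
  have one: "(\<integral>\<^sup>+x\<in>{b..b + 4}. ennreal ((dyadic_max u n b 4 0 x)\<^sup>2) \<partial>lborel) \<le> ennreal (16 * I)" for b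
    using dyadic_max_nn_integral[OF cont nonneg, of 4 n b] integral_periodic_4[of "\<lambda>x. (u x)\<^sup>2" b]
    by (simp add: per I_def continuous_on_power cont)
  have "(\<integral>\<^sup>+x\<in>{0..<1}. ennreal ((grid_max u n x)\<^sup>2) \<partial>lborel)
      \<le> (\<integral>\<^sup>+x. ennreal ((dyadic_max u n (-1) 4 0 x)\<^sup>2) * indicator {-1..-1 + 4} x
            + ennreal ((dyadic_max u n (-7/3) 4 0 x)\<^sup>2) * indicator {-7/3..-7/3 + 4} x \<partial>lborel)"
  proof (rule nn_integral_mono)
    fix x :: real
    have "ennreal ((max a b)\<^sup>2) \<le> ennreal (a\<^sup>2) + ennreal (b\<^sup>2)" for a b :: real
      by (simp add: max_def flip: ennreal_plus)
    then show "ennreal ((grid_max u n x)\<^sup>2) * indicator {0..<1} x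
      \<le> ennreal ((dyadic_max u n (-1) 4 0 x)\<^sup>2) * indicator {-1..-1 + 4} x
            + ennreal ((dyadic_max u n (-7/3) 4 0 x)\<^sup>2) * indicator {-7/3..-7/3 + 4} x"
      unfolding grid_max_def by (auto simp: indicator_def)
  qed
  also have "\<dots> = (\<integral>\<^sup>+x\<in>{-1..-1 + 4}. ennreal ((dyadic_max u n (-1) 4 0 x)\<^sup>2) \<partial>lborel)
      + (\<integral>\<^sup>+x\<in>{-7/3..-7/3 + 4}. ennreal ((dyadic_max u n (-7/3) 4 0 x)\<^sup>2) \<partial>lborel)"
    by (rule nn_integral_add) measurable
  also have "\<dots> \<le> ennreal (16 * I) + ennreal (16 * I)" by (intro add_mono one)
  also have "\<dots> = ennreal (32 * I)" using I by (simp flip: ennreal_plus)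
  finally show "(\<integral>\<^sup>+x\<in>{0..<1}. ennreal ((grid_max u n x)\<^sup>2) \<partial>lborel) \<le> ennreal (32 * I)" .
qed

lemma integral_le_maximal_fun:
  assumes x: "0 \<le> x" "x < 1" and h: "0 < h" "h \<le> 1/2"
  shows "integral {x - h..x + h} u \<le> 12 * h * maximal_fun u x"
proof -
  \<comment> \<open>The first mesh below \<open>12 * h\<close> is still at least
    \<open>6 * h\<close>, three times the length of the interval, as the offset of the grids
    requires; for generation 0 this follows from \<open>h \<le> 1/2\<close>.\<close>
  define k where "k = (LEAST k. 4 / 2 ^ k < 12 * h)"
  have "\<exists>k. (1 / 2) ^ k < 3 * h" using h by (intro real_arch_pow_inv) auto
  then have "\<exists>k. 4 / 2 ^ k < 12 * h" by (auto simp: power_divide field_simps)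
  then have k1: "4 / 2 ^ k < 12 * h" unfolding k_def by (rule LeastI_ex)
  have k2: "6 * h \<le> 4 / 2 ^ k"
  proof (cases k)
    case 0
    then show ?thesis using h by simp
  next
    case (Suc k')
    then have "\<not> 4 / 2 ^ k' < 12 * h" using not_less_Least[of k' "\<lambda>k. 4 / 2 ^ k < 12 * h"] by (simp add: k_def)
    then show ?thesis using Suc by (simp add: field_simps)
  qed
  obtain b and j :: nat where b: "b \<in> {-1, -7/3}" and j: "b + real j * (4 / 2 ^ k) \<le> x - h"
    "x + h \<le> b + real (Suc j) * (4 / 2 ^ k)"
  proof -
    have "\<exists>b\<in>{-1, -7/3}. \<exists>j::nat. b + real j * (4 / 2 ^ k) \<le> x - h \<and> x + h \<le> b + real (Suc j) * (4 / 2 ^ k)"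
      by (rule dyadic_grid_offset) (use h x k2 in auto)
    then show ?thesis using that by blast
  qed
  define s c where "s = (4 :: real) / 2 ^ k" and "c = b + real j * s"
  have s: "0 < s" by (simp add: s_def)
  have "real (Suc j) * s = s + real j * s" by (simp add: ring_distribs)
  then have c: "c \<le> x - h" "x + h \<le> c + s" using j unfolding c_def s_def[symmetric] by linarith+
  have "integral {x - h..x + h} u \<le> integral {c..c + s} u"
    using c by (intro integral_subset_le u_integrable) (auto simp: nonneg)
  also have "\<dots> = s * avg u c s" using s by (simp add: avg_def)
  also have "\<dots> \<le> s * maximal_fun u x"
  proof (rule mult_left_mono)
    have "avg u c s \<le> dyadic_max u k b 4 0 x"
      unfolding c_def s_def using b x h j by (intro avg_le_dyadic_max) auto
    also have "\<dots> \<le> grid_max u k x" using b by (auto simp: grid_max_def)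
    finally show "avg u c s \<le> maximal_fun u x" using grid_max_le order_trans by blast
  qed (use s in simp)
  also have "\<dots> \<le> 12 * h * maximal_fun u x"
    using k1 by (intro mult_right_mono maximal_fun_nonneg) (simp add: s_def)
  finally show ?thesis .
qed

end

section \<open>Poisson integrals in the approach regions\<close>

lemma sin_pi_ge:
  assumes "0 \<le> t" "t \<le> 1/2"
  shows "2 * t \<le> sin (pi * t)"
proof -
  have "concave_on {0..pi/2} sin"
    by (rule f''_le0_imp_concave[of _ _ cos "\<lambda>x. - sin x"]) (auto intro!: derivative_eq_intros sin_ge_zero)
  then have "convex_on {0..pi/2} (\<lambda>x. - sin x)" by (simp add: concave_on_def)
  then have "- sin ((1 - 2 * t) *\<^sub>R 0 + (2 * t) *\<^sub>R (pi / 2)) \<le> (1 - 2 * t) * (- sin 0) + 2 * t * (- sin (pi / 2))"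
    using assms by (intro convex_onD) auto
  then show ?thesis by (simp add: mult_ac)
qed

text \<open>The chord has length \<open>2 * sin (pi * \<bar>y - x\<bar>)\<close>, and Jordan's
  inequality applies.\<close>

lemma circle_exp_chord:
  assumes "\<bar>y - x\<bar> \<le> 1/2"
  shows "4 * \<bar>y - x\<bar> \<le> norm (circle_exp y - circle_exp x)"
proof -
  have "(norm (circle_exp y - circle_exp x))\<^sup>2
      = ((sin (2*pi*y))\<^sup>2 + (cos (2*pi*y))\<^sup>2) + ((sin (2*pi*x))\<^sup>2 + (cos (2*pi*x))\<^sup>2)
        - 2 * (cos (2*pi*y) * cos (2*pi*x) + sin (2*pi*y) * sin (2*pi*x))"
    unfolding cmod_power2 by (simp add: circle_exp_def power2_diff algebra_simps)
  also have "\<dots> = 2 - 2 * cos (2*pi*y - 2*pi*x)"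
    by (simp only: sin_cos_squared_add cos_diff)
  also have "2*pi*y - 2*pi*x = 2 * (pi * (y - x))" by (simp add: algebra_simps)
  also have "2 - 2 * cos (2 * (pi * (y - x))) = (2 * sin (pi * (y - x)))\<^sup>2"
    by (simp only: cos_double_sin) (simp add: power_mult_distrib)
  also have "\<dots> = (2 * sin (pi * \<bar>y - x\<bar>))\<^sup>2"
  proof (cases "x \<le> y")
    case False
    have "sin (pi * (y - x)) = - sin (pi * (x - y))" by (simp flip: sin_minus add: algebra_simps)
    then show ?thesis using False by simp
  qed simp
  finally have "norm (circle_exp y - circle_exp x) = \<bar>2 * sin (pi * \<bar>y - x\<bar>)\<bar>"
    by (metis norm_ge_zero real_sqrt_abs real_sqrt_unique)
  then show ?thesis using sin_pi_ge[of "\<bar>y - x\<bar>"] assms by linarith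
qed

lemma poisson_periodic: "poisson z (x + 1) = poisson z x"
  by (simp add: poisson_def circle_exp_periodic)

text \<open>The hypothesis \<open>near\<close> is a consequence of lying in the lens region at
  \<open>circle_exp x\<close>. It puts that vertex within \<open>2 * d\<close> of \<open>z\<close>;
  the chord bound then gives \<open>4 * \<bar>y - x\<bar> \<le> D + 2 * d \<le> 3 * D\<close>, so
  \<open>D\<close> dominates both \<open>d\<close> and \<open>\<bar>y - x\<bar>\<close>.\<close>

lemma poisson_near_bound:
  assumes z: "norm z < 1" and near: "(norm (circle_exp x - z))\<^sup>2 \<le> 5/4 * (1 - norm z)\<^sup>2"
    and y: "\<bar>y - x\<bar> \<le> 1/2"
  shows "poisson z y \<le> 4 * (1 - norm z) / ((1 - norm z)\<^sup>2 + (y - x)\<^sup>2)"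
proof -
  define d D where "d = 1 - norm z" and "D = norm (circle_exp y - z)"
  have d: "0 < d" using z by (simp add: d_def)
  have D: "d \<le> D" using norm_triangle_ineq2[of "circle_exp y" z] by (simp add: d_def D_def)
  have "(norm (circle_exp x - z))\<^sup>2 \<le> (2 * d)\<^sup>2"
  proof -
    have "(2 * d)\<^sup>2 = 4 * d\<^sup>2" by (simp add: power_mult_distrib)
    then show ?thesis using near zero_le_power2[of d] unfolding d_def[symmetric] by linarith
  qed
  then have "norm (circle_exp x - z) \<le> 2 * d" using d power2_le_imp_le[of _ "2 * d"] by simp
  moreover have "4 * \<bar>y - x\<bar> \<le> norm (circle_exp y - circle_exp x)" by (rule circle_exp_chord[OF y])
  moreover have "norm (circle_exp y - circle_exp x) \<le> D + norm (circle_exp x - z)"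
    unfolding D_def using norm_triangle_ineq4[of "circle_exp y - z" "circle_exp x - z"] by simp
  ultimately have "4 * \<bar>y - x\<bar> \<le> D + 2 * d" by (meson add_left_mono order_trans)
  then have "\<bar>y - x\<bar> \<le> D" using D d by argo
  then have "(y - x)\<^sup>2 \<le> D\<^sup>2" using abs_le_square_iff[of "y - x" D] by simp
  moreover have "d\<^sup>2 \<le> D\<^sup>2" using D d by (intro power_mono) auto
  ultimately have "(d\<^sup>2 + (y - x)\<^sup>2) / 2 \<le> D\<^sup>2" by simp
  moreover have pos: "0 < d\<^sup>2 + (y - x)\<^sup>2" using d by (simp add: add_pos_nonneg)
  ultimately have "poisson z y \<le> (1 - (norm z)\<^sup>2) / ((d\<^sup>2 + (y - x)\<^sup>2) / 2)"
    unfolding poisson_def D_def[symmetric] using z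
    by (intro divide_left_mono mult_pos_pos) (auto simp: abs_square_le_1)
  also have "1 - (norm z)\<^sup>2 = (1 + norm z) * d" by (simp add: d_def power2_eq_square algebra_simps)
  also have "(1 + norm z) * d / ((d\<^sup>2 + (y - x)\<^sup>2) / 2) \<le> 2 * d / ((d\<^sup>2 + (y - x)\<^sup>2) / 2)"
    using z d pos by (intro divide_right_mono mult_right_mono) auto
  finally show ?thesis by (simp add: d_def)
qed

text \<open>A decomposition of the kernel into boxes. Let \<open>d = 1 - norm z\<close>. For the
  least \<open>k\<close> with \<open>\<bar>y - x\<bar> \<le> 2 ^ k * d\<close>, if
  \<open>k > 0\<close>, the distance exceeds \<open>2 ^ (k - 1) * d\<close>, so the kernel is at
  most \<open>4 / (4 ^ (k - 1) * d) = 16 / (4 ^ k * d)\<close>. Cutting the radii at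
  \<open>1/2\<close> keeps every box inside one period.\<close>

lemma poisson_dyadic_bound:
  assumes z: "norm z < 1" and near: "(norm (circle_exp x - z))\<^sup>2 \<le> 5/4 * (1 - norm z)\<^sup>2"
    and y: "\<bar>y - x\<bar> \<le> 1/2" and K: "1/2 \<le> 2 ^ K * (1 - norm z)"
  shows "poisson z y \<le> (\<Sum>k\<le>K. 16 / (4 ^ k * (1 - norm z)) *
    (if y \<in> {x - min (2 ^ k * (1 - norm z)) (1/2)..x + min (2 ^ k * (1 - norm z)) (1/2)} then 1 else 0))"
    (is "_ \<le> sum ?g _")
proof -
  define d where "d = 1 - norm z"
  have d: "0 < d" using z by (simp add: d_def)
  define k where "k = (LEAST k. \<bar>y - x\<bar> \<le> 2 ^ k * d)"
  have "\<bar>y - x\<bar> \<le> 2 ^ K * d" using y K by (simp add: d_def)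
  then have k: "\<bar>y - x\<bar> \<le> 2 ^ k * d" "k \<le> K"
    unfolding k_def by (rule LeastI, rule Least_le)
  have "poisson z y \<le> 16 / (4 ^ k * d)"
  proof (cases k)
    case 0
    have "4 * d / (d\<^sup>2 + (y - x)\<^sup>2) \<le> 4 * d / d\<^sup>2"
      using d by (intro divide_left_mono mult_pos_pos) (auto simp: add_pos_nonneg)
    also have "\<dots> \<le> 16 / d" using d by (simp add: power2_eq_square divide_simps)
    finally show ?thesis using poisson_near_bound[OF z near y] 0 by (simp add: d_def)
  next
    case (Suc k')
    then have "\<not> \<bar>y - x\<bar> \<le> 2 ^ k' * d" using not_less_Least[of k' "\<lambda>k. \<bar>y - x\<bar> \<le> 2 ^ k * d"] by (simp add: k_def)
    then have "(2 ^ k' * d)\<^sup>2 \<le> \<bar>y - x\<bar>\<^sup>2" using d by (intro power_mono) auto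
    then have *: "(2 ^ k' * d)\<^sup>2 \<le> d\<^sup>2 + (y - x)\<^sup>2" by (simp add: add_increasing)
    have "4 * d / (d\<^sup>2 + (y - x)\<^sup>2) \<le> 4 * d / (2 ^ k' * d)\<^sup>2"
      using d * by (intro divide_left_mono mult_pos_pos) (auto simp: add_pos_nonneg)
    also have "(2 ^ k' * d)\<^sup>2 = 4 ^ k' * d * d"
      by (simp add: power2_eq_square flip: power_mult_distrib)
    also have "4 * d / (4 ^ k' * d * d) = 16 / (4 ^ k * d)" using d Suc by simp
    finally show ?thesis using poisson_near_bound[OF z near y] by (simp add: d_def)
  qed
  also have "\<dots> = ?g k" using k(1) y by (auto simp: d_def abs_le_iff)
  also have "\<dots> \<le> sum ?g {..K}" using k(2) d by (intro member_le_sum) (auto simp: d_def)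
  finally show ?thesis .
qed

text \<open>The constant is \<open>16 * 12 * 2\<close>: the height of the boxes, the bound for
  averages by the maximal function, and the geometric series of the ratios
  \<open>2 ^ k / 4 ^ k\<close>.\<close>

lemma poisson_int_le_maximal_fun:
  assumes u: "continuous_on UNIV u" "\<And>x. 0 \<le> u x" "\<And>x. u (x + 1) = u x"
    and z: "norm z < 1" and x: "0 \<le> x" "x < 1"
    and near: "(norm (circle_exp x - z))\<^sup>2 \<le> 5/4 * (1 - norm z)\<^sup>2"
  shows "poisson_int u z \<le> 384 * maximal_fun u x"
proof -
  define d where "d = 1 - norm z"
  have d: "0 < d" "d \<le> 1" using z by (auto simp: d_def)
  obtain K where "(1/2) ^ K < 2 * d" using real_arch_pow_inv[of "2 * d" "1/2"] d by auto
  then have K: "1/2 \<le> 2 ^ K * d" by (simp add: power_divide field_simps)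
  define h where "h k = min (2 ^ k * d) (1/2)" for k :: nat
  have h: "0 < h k" "h k \<le> 1/2" "h k \<le> 2 ^ k * d" for k using d by (auto simp: h_def)
  define I where "I = {x - 1/2..1/2 + x}"
  define G where "G = maximal_fun u x"
  have G: "0 \<le> G" unfolding G_def by (rule maximal_fun_nonneg[OF u])
  have cont: "continuous_on A u" for A using u(1) by (rule continuous_on_subset) simp
  \<comment> \<open>One period centred at \<open>x\<close>, where the kernel bound in terms of
    \<open>\<bar>y - x\<bar>\<close> holds.\<close>
  have "poisson_int u z = integral {x - 1/2..x - 1/2 + 1} (\<lambda>y. poisson z y * u y)"
    unfolding poisson_int_def
    by (rule integral_periodic[symmetric])
       (auto simp: poisson_periodic u(3) intro!: continuous_intros cont continuous_on_poisson z)
  then have "poisson_int u z = integral I (\<lambda>y. poisson z y * u y)" by (simp add: I_def add.commute)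
  moreover have "(\<lambda>y. poisson z y * u y) integrable_on I"
    unfolding I_def by (intro integrable_continuous_real continuous_intros cont continuous_on_poisson z)
  ultimately have 1: "((\<lambda>y. poisson z y * u y) has_integral poisson_int u z) I"
    by (simp add: integrable_integral)
  have 2: "((\<lambda>y. \<Sum>k\<le>K. 16 / (4 ^ k * d) * (if y \<in> {x - h k..x + h k} then u y else 0))
      has_integral (\<Sum>k\<le>K. 16 / (4 ^ k * d) * integral {x - h k..x + h k} u)) I"
  proof (intro has_integral_sum has_integral_mult_right finite_atMost)
    fix k
    have "(u has_integral integral {x - h k..x + h k} u) {x - h k..x + h k}"
      by (intro integrable_integral integrable_continuous_real cont)
    then show "((\<lambda>y. if y \<in> {x - h k..x + h k} then u y else 0) has_integral integral {x - h k..x + h k} u) I"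
      using h(2)[of k] by (subst has_integral_restrict) (auto simp: I_def)
  qed
  have "poisson_int u z \<le> (\<Sum>k\<le>K. 16 / (4 ^ k * d) * integral {x - h k..x + h k} u)"
  proof (rule has_integral_le[OF 1 2])
    fix y assume "y \<in> I"
    then have "y - x \<le> 1/2" "x - y \<le> 1/2" by (auto simp: I_def)
    then have "\<bar>y - x\<bar> \<le> 1/2" by linarith
    have "1/2 \<le> 2 ^ K * (1 - norm z)" using K by (simp add: d_def)
    from mult_right_mono[OF poisson_dyadic_bound[OF z near \<open>\<bar>y - x\<bar> \<le> 1/2\<close> this] u(2)[of y]]
    have "poisson z y * u y \<le> (\<Sum>k\<le>K. 16 / (4 ^ k * d) * (if y \<in> {x - h k..x + h k} then 1 else 0)) * u y"
      by (simp only: d_def h_def)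
    also have "\<dots> = (\<Sum>k\<le>K. 16 / (4 ^ k * d) * (if y \<in> {x - h k..x + h k} then u y else 0))"
      unfolding sum_distrib_right by (intro sum.cong) auto
    finally show "poisson z y * u y \<le> (\<Sum>k\<le>K. 16 / (4 ^ k * d) * (if y \<in> {x - h k..x + h k} then u y else 0))" .
  qed
  also have "\<dots> \<le> (\<Sum>k\<le>K. 16 / (4 ^ k * d) * (12 * (2 ^ k * d) * G))"
  proof (intro sum_mono mult_left_mono)
    fix k
    have "integral {x - h k..x + h k} u \<le> 12 * h k * G"
      unfolding G_def by (rule integral_le_maximal_fun[OF u x h(1,2)])
    also have "\<dots> \<le> 12 * (2 ^ k * d) * G" using h(3)[of k] G by (intro mult_right_mono) auto
    finally show "integral {x - h k..x + h k} u \<le> 12 * (2 ^ k * d) * G" .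
  qed (use d in auto)
  also have "\<dots> = 192 * G * (\<Sum>k\<le>K. (1/2) ^ k)"
    unfolding sum_distrib_left
  proof (intro sum.cong refl)
    fix k
    have "(4::real) ^ k = 2 ^ k * 2 ^ k" by (simp flip: power_mult_distrib)
    then show "16 / (4 ^ k * d) * (12 * (2 ^ k * d) * G) = 192 * G * (1/2) ^ k"
      using d by (simp add: power_divide field_simps)
  qed
  also have "\<dots> \<le> 192 * G * 2"
    using G by (intro mult_left_mono) (simp_all add: sum_gp0)
  finally show ?thesis by (simp add: G_def)
qed

section \<open>Hardy spaces\<close>

lemma integral_circle:
  fixes g :: "complex \<Rightarrow> real"
  assumes "continuous_on unit_circle g"
  shows "integral {0..2 * pi} (\<lambda>t. g (cis t)) = 2 * pi * integral {0..1} (\<lambda>x. g (circle_exp x))"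
proof -
  have "continuous_on {0..2 * pi} (\<lambda>t. g (cis t))"
    by (intro continuous_on_compose2[OF assms] continuous_intros) auto
  then have "((\<lambda>t. g (cis t)) has_integral integral {0..2 * pi} (\<lambda>t. g (cis t))) (cbox 0 (2 * pi))"
    by (simp add: integrable_integral integrable_continuous_real)
  from has_integral_affinity'[OF this, of "2 * pi" 0]
  have "((\<lambda>x. g (circle_exp x)) has_integral inverse (2 * pi) * integral {0..2 * pi} (\<lambda>t. g (cis t))) {0..1}"
    by (simp add: circle_exp_def)
  from integral_unique[OF this] show ?thesis by (simp add: field_simps)
qed

lemma hardy_mean_powr:
  assumes "f holomorphic_on unit_disc" "0 < r" "r < 1" "0 < p"
  shows "hardy_mean p f r powr p = integral {0..1} (\<lambda>x. norm (f (of_real r * circle_exp x)) powr p)"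
proof -
  have cont: "continuous_on unit_circle (\<lambda>w. norm (f (of_real r * w)) powr p)"
    using assms by (intro continuous_intros continuous_on_compose2[OF holomorphic_on_imp_continuous_on[OF assms(1)]])
      (auto simp: norm_mult)
  have "0 \<le> integral {0..1} (\<lambda>x. norm (f (of_real r * circle_exp x)) powr p)"
    by (intro integral_nonneg integrable_continuous_real continuous_on_compose2[OF cont] continuous_intros) auto
  then show ?thesis
    unfolding hardy_mean_def using integral_circle[OF cont] assms(4) by (simp add: powr_powr)
qed

lemma hardy_mean_nonneg: "0 \<le> hardy_mean p f r"
  by (simp add: hardy_mean_def)

lemma hardy_spaceD:
  assumes "f \<in> hardy_space p" "0 < r" "r < 1" "0 < p"
  shows "integral {0..1} (\<lambda>x. norm (f (of_real r * circle_exp x)) powr p) \<le> hardy_norm p f powr p"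
proof -
  have f: "f holomorphic_on unit_disc" "bdd_above (hardy_mean p f ` {0<..<1})"
    using assms(1) by (auto simp: hardy_space_def)
  have "hardy_mean p f r \<le> hardy_norm p f"
    unfolding hardy_norm_def by (rule cSUP_upper[OF _ f(2)]) (use assms in auto)
  then show ?thesis
    unfolding hardy_mean_powr[OF f(1) assms(2,3,4), symmetric]
    using assms(4) by (intro powr_mono2 hardy_mean_nonneg) auto
qed

lemma hardy_norm_nonneg:
  assumes "f \<in> hardy_space p"
  shows "0 \<le> hardy_norm p f"
proof -
  have "bdd_above (hardy_mean p f ` {0<..<1})"
    using assms(1) by (auto simp: hardy_space_def)
  then have "hardy_mean p f (1/2) \<le> hardy_norm p f"
    unfolding hardy_norm_def by (intro cSUP_upper) auto
  then show ?thesis using hardy_mean_nonneg order_trans by blast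
qed

lemma hardy_spaceI:
  assumes "f holomorphic_on unit_disc" "0 < p" "0 \<le> K"
    and "\<And>r. 0 < r \<Longrightarrow> r < 1 \<Longrightarrow> integral {0..1} (\<lambda>x. norm (f (of_real r * circle_exp x)) powr p) \<le> K powr p"
  shows "f \<in> hardy_space p" "hardy_norm p f \<le> K"
proof -
  have le: "hardy_mean p f r \<le> K" if "r \<in> {0<..<1}" for r
  proof (rule ccontr)
    assume "\<not> hardy_mean p f r \<le> K"
    then have "K powr p < hardy_mean p f r powr p" using assms(2,3) by (intro powr_less_mono2) auto
    then show False using assms(4)[of r] hardy_mean_powr[OF assms(1) _ _ assms(2), of r] that by auto
  qed
  show "f \<in> hardy_space p" using assms(1) le by (auto simp: hardy_space_def intro!: bdd_aboveI2[of _ _ K])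
  show "hardy_norm p f \<le> K" unfolding hardy_norm_def by (rule cSUP_least) (use le in auto)
qed

lemma holomorphic_dilate:
  assumes "f holomorphic_on unit_disc" "0 < r"
  shows "(\<lambda>z. f (of_real r * z)) holomorphic_on ball 0 (1 / r)"
proof -
  have "(\<lambda>z. of_real r * z) ` ball 0 (1 / r) \<subseteq> unit_disc"
    using assms(2) by (auto simp: norm_mult less_divide_eq mult.commute)
  moreover have "(\<lambda>z. of_real r * z) holomorphic_on ball 0 (1 / r)" by (intro holomorphic_intros)
  ultimately show ?thesis
    using holomorphic_on_compose_gen[of "\<lambda>z. of_real r * z" "ball 0 (1 / r)" f unit_disc] assms(1)
    by (simp add: o_def)
qed

text \<open>Subharmonicity for the dilates combined with the crude bound
  \<open>2 / (1 - norm z)\<close> for the Poisson kernel. This supplies the local boundedness for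
  Montel's theorem.\<close>

lemma hardy_growth:
  assumes f: "f \<in> hardy_space p" and p: "0 < p" and z: "norm z < 1"
  shows "norm (f z) powr p \<le> 2 / (1 - norm z) * hardy_norm p f powr p"
proof -
  have hol: "f holomorphic_on unit_disc" using f by (simp add: hardy_space_def)
  \<comment> \<open>The shift by 2 makes \<open>r 0 = 1/2\<close>, inside the open interval.\<close>
  define r where "r n = 1 - 1 / (real n + 2)" for n
  have r: "0 < r n" "r n < 1" for n by (auto simp: r_def field_simps)
  have r1: "r \<longlonglongrightarrow> 1" unfolding r_def by real_asymp
  have "(\<lambda>n. norm (f (of_real (r n) * z)) powr p) \<longlonglongrightarrow> norm (f (of_real 1 * z)) powr p"
  proof (intro tendsto_powr' tendsto_norm tendsto_const)
    have "isCont f z"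
      using holomorphic_on_imp_continuous_on[OF hol] z continuous_on_eq_continuous_at[OF open_ball]
      by (metis mem_ball_0)
    then show "(\<lambda>n. f (of_real (r n) * z)) \<longlonglongrightarrow> f (of_real 1 * z)"
      by (intro isCont_tendsto_compose[of _ f] tendsto_intros r1) auto
  qed (use p in auto)
  moreover have "norm (f (of_real (r n) * z)) powr p \<le> 2 / (1 - norm z) * hardy_norm p f powr p" for n
  proof -
    have cont: "continuous_on {0..1} (\<lambda>x. norm (f (of_real (r n) * circle_exp x)) powr p)"
      using r[of n] p by (intro continuous_intros continuous_on_compose2[OF holomorphic_on_imp_continuous_on[OF hol]])
        (auto simp: norm_mult)
    have "norm (f (of_real (r n) * z)) powr p \<le> poisson_int (\<lambda>x. norm (f (of_real (r n) * circle_exp x)) powr p) z"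
      by (rule norm_powr_le_poisson_int[OF holomorphic_dilate[OF hol r(1)] _ p z]) (use r[of n] in auto)
    also have "\<dots> \<le> integral {0..1} (\<lambda>x. 2 / (1 - norm z) * norm (f (of_real (r n) * circle_exp x)) powr p)"
      unfolding poisson_int_def
      by (intro integral_le poisson_int_integrable z cont mult_right_mono poisson_le
          integrable_continuous_real continuous_on_mult continuous_on_const) auto
    also have "\<dots> = 2 / (1 - norm z) * integral {0..1} (\<lambda>x. norm (f (of_real (r n) * circle_exp x)) powr p)"
      by (rule integral_mult_right)
    also have "\<dots> \<le> 2 / (1 - norm z) * hardy_norm p f powr p"
      using z by (intro mult_left_mono hardy_spaceD f r p) auto
    finally show ?thesis .
  qed
  ultimately show ?thesis by (intro LIMSEQ_le_const2) auto
qed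

text \<open>From \<open>a + b \<le> 2 * max a b\<close>; it replaces the triangle inequality, which
  the norms lose for exponents below 1.\<close>

lemma powr_add_le:
  fixes a b :: real
  assumes "0 \<le> a" "0 \<le> b" "0 < p"
  shows "(a + b) powr p \<le> 2 powr p * (a powr p + b powr p)"
proof -
  have "(a + b) powr p \<le> (2 * max a b) powr p" using assms by (intro powr_mono2) auto
  also have "\<dots> = 2 powr p * max a b powr p" using assms by (simp add: powr_mult)
  also have "max a b powr p \<le> a powr p + b powr p" by (simp add: max_def)
  finally show ?thesis by simp
qed

lemma hardy_diff:
  assumes f: "f \<in> hardy_space p" "g \<in> hardy_space p" and p: "0 < p"
    and K: "hardy_norm p f \<le> K" "hardy_norm p g \<le> K"
  shows "(\<lambda>z. f z - g z) \<in> hardy_space p" "hardy_norm p (\<lambda>z. f z - g z) \<le> (2 powr p * (2 * K powr p)) powr (1 / p)"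
proof -
  have hol: "f holomorphic_on unit_disc" "g holomorphic_on unit_disc" using f by (simp_all add: hardy_space_def)
  have K0: "0 \<le> K" using hardy_norm_nonneg[OF f(1)] K(1) by linarith
  have "integral {0..1} (\<lambda>x. norm (f (of_real r * circle_exp x) - g (of_real r * circle_exp x)) powr p)
      \<le> ((2 powr p * (2 * K powr p)) powr (1 / p)) powr p" if r: "0 < r" "r < 1" for r
  proof -
    have cont: "continuous_on {0..1} (\<lambda>x. h (of_real r * circle_exp x))" if "h holomorphic_on unit_disc" for h
      using r by (intro continuous_on_compose2[OF holomorphic_on_imp_continuous_on[OF that]] continuous_intros)
        (auto simp: norm_mult)
    note ci = continuous_intros integrable_continuous_real cont[OF hol(1)] cont[OF hol(2)]
    have "integral {0..1} (\<lambda>x. norm (f (of_real r * circle_exp x) - g (of_real r * circle_exp x)) powr p)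
      \<le> integral {0..1} (\<lambda>x. 2 powr p * (norm (f (of_real r * circle_exp x)) powr p + norm (g (of_real r * circle_exp x)) powr p))"
    proof (rule integral_le)
      fix x
      have "norm (f (of_real r * circle_exp x) - g (of_real r * circle_exp x)) powr p
        \<le> (norm (f (of_real r * circle_exp x)) + norm (g (of_real r * circle_exp x))) powr p"
        using p by (intro powr_mono2 norm_triangle_ineq4) auto
      also have "\<dots> \<le> 2 powr p * (norm (f (of_real r * circle_exp x)) powr p + norm (g (of_real r * circle_exp x)) powr p)"
        using p by (intro powr_add_le) auto
      finally show "norm (f (of_real r * circle_exp x) - g (of_real r * circle_exp x)) powr p
        \<le> 2 powr p * (norm (f (of_real r * circle_exp x)) powr p + norm (g (of_real r * circle_exp x)) powr p)" .
    qed (use p in \<open>auto intro!: ci\<close>)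
    also have "\<dots> = 2 powr p * (integral {0..1} (\<lambda>x. norm (f (of_real r * circle_exp x)) powr p)
        + integral {0..1} (\<lambda>x. norm (g (of_real r * circle_exp x)) powr p))"
      using p by (simp only: integral_mult_right, subst Henstock_Kurzweil_Integration.integral_add) (auto intro!: ci)
    also have "\<dots> \<le> 2 powr p * (K powr p + K powr p)"
      using p K hardy_norm_nonneg[OF f(1)] hardy_norm_nonneg[OF f(2)]
      by (intro mult_left_mono add_mono order_trans[OF hardy_spaceD] r f powr_mono2) auto
    finally show ?thesis using p by (simp add: powr_powr)
  qed
  then show "(\<lambda>z. f z - g z) \<in> hardy_space p" "hardy_norm p (\<lambda>z. f z - g z) \<le> (2 powr p * (2 * K powr p)) powr (1 / p)"
    by (auto intro!: hardy_spaceI[where K = "(2 powr p * (2 * K powr p)) powr (1 / p)"] holomorphic_intros hol p)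
qed

section \<open>Lens regions\<close>

text \<open>\<open>Re (\<zeta> * cnj z)\<close> is \<open>norm z\<close> times the cosine of the
  angle, and cosine is decreasing on the range in question. The inequality form removes the choice
  of arguments and makes membership jointly measurable.\<close>

lemma lens_region_iff:
  assumes \<zeta>: "norm \<zeta> = 1"
  shows "z \<in> lens_region \<zeta> \<longleftrightarrow>
    norm z < 1 \<and> (z = 0 \<or> norm z * cos ((1 - norm z) / 2) < Re (\<zeta> * cnj z))"
proof (cases "z = 0")
  case True
  obtain s where "is_Arg \<zeta> s" using is_Arg_Arg \<zeta> by (metis norm_zero zero_neq_one)
  moreover have "is_Arg 0 s" by (simp add: is_Arg_def)
  ultimately show ?thesis using True by (auto simp: lens_region_def intro!: exI[of _ s])
next
  case False
  have Re: "Re (\<zeta> * cnj z) = norm z * cos (s - t)" if "is_Arg \<zeta> s" "is_Arg z t" for s t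
  proof -
    define r where "r = norm z"
    have "\<zeta> = cis s" "z = of_real r * cis t"
      using that \<zeta> by (auto simp: is_Arg_def cis_conv_exp mult.commute r_def)
    then have "Re (\<zeta> * cnj z) = r * cos (s - t)" by (simp add: cos_diff algebra_simps)
    then show ?thesis by (simp add: r_def)
  qed
  have z: "0 < norm z" using False by simp
  show ?thesis
  proof
    assume "z \<in> lens_region \<zeta>"
    then obtain s t where st: "norm z < 1" "is_Arg \<zeta> s" "is_Arg z t" "\<bar>s - t\<bar> < (1 - norm z) / 2"
      by (auto simp: lens_region_def)
    have "cos ((1 - norm z) / 2) < cos \<bar>s - t\<bar>"
    proof (rule cos_monotone_0_pi)
      show "(1 - norm z) / 2 \<le> pi" using pi_gt3 norm_ge_zero[of z] by argo
    qed (use st in auto)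
    then show "norm z < 1 \<and> (z = 0 \<or> norm z * cos ((1 - norm z) / 2) < Re (\<zeta> * cnj z))"
      using z st(1) Re[OF st(2,3)] by (simp add: cos_abs_real)
  next
    assume *: "norm z < 1 \<and> (z = 0 \<or> norm z * cos ((1 - norm z) / 2) < Re (\<zeta> * cnj z))"
    obtain t where t: "is_Arg z t" using is_Arg_Arg False by blast
    define w where "w = \<zeta> * cnj z"
    have w: "w \<noteq> 0" using False \<zeta> by (auto simp: w_def)
    \<comment> \<open>The argument of \<open>\<zeta>\<close> nearest to \<open>t\<close>: the
      difference \<open>Arg w\<close> lies within \<open>pi\<close> of 0, where cosine determines
      its absolute value.\<close>
    define s where "s = t + Arg w"
    have "is_Arg \<zeta> s"
    proof -
      have nw: "norm w = norm z" by (simp add: w_def norm_mult \<zeta>)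
      have "of_real (norm z) * cis (Arg w) = \<zeta> * cnj z"
        using is_Arg_Arg[OF w] nw by (simp add: is_Arg_def cis_conv_exp w_def mult.commute)
      moreover have zt: "z = of_real (norm z) * cis t"
        using t by (simp add: is_Arg_def cis_conv_exp mult.commute)
      then have "cnj z = of_real (norm z) * cis (- t)"
        by (metis cis_cnj complex_cnj_complex_of_real complex_cnj_mult)
      ultimately have "of_real (norm z) * cis (Arg w) = of_real (norm z) * (\<zeta> * cis (- t))" by simp
      then have "cis (Arg w) = \<zeta> * cis (- t)" using False by simp
      then have "\<zeta> = cis (Arg w) * cis t" by (simp add: mult.assoc cis_mult)
      then have "\<zeta> = cis s" by (simp add: s_def cis_mult add.commute)
      then show ?thesis using \<zeta> unfolding is_Arg_def cis_conv_exp[symmetric] by simp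
    qed
    have "norm z * cos ((1 - norm z) / 2) < norm z * cos \<bar>s - t\<bar>"
      using * False Re[OF \<open>is_Arg \<zeta> s\<close> t] by (simp add: cos_abs_real)
    then have "cos ((1 - norm z) / 2) < cos \<bar>s - t\<bar>" using z by simp
    moreover have "\<bar>s - t\<bar> \<le> pi" unfolding s_def using Arg_bounded[of w] by auto
    moreover have "(1 - norm z) / 2 \<le> pi" using pi_gt3 norm_ge_zero[of z] by argo
    ultimately have "\<bar>s - t\<bar> < (1 - norm z) / 2"
      using cos_mono_less_eq[of "(1 - norm z) / 2" "\<bar>s - t\<bar>"] * by auto
    then show "z \<in> lens_region \<zeta>" using * \<open>is_Arg \<zeta> s\<close> t by (auto simp: lens_region_def)
  qed
qed

text \<open>With \<open>d = 1 - norm z\<close>, the law of cosines bounds the squared distance by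
  \<open>d^2 + 2 * norm z * (1 - cos (d / 2))\<close>, and
  \<open>1 - cos (d / 2) \<le> d^2 / 8\<close> accounts for the extra quarter.\<close>

lemma lens_region_near:
  assumes \<zeta>: "norm \<zeta> = 1" and z: "z \<in> lens_region \<zeta>"
  shows "(norm (\<zeta> - z))\<^sup>2 \<le> 5/4 * (1 - norm z)\<^sup>2"
proof (cases "z = 0")
  case False
  define d where "d = 1 - norm z"
  have z': "norm z < 1" "norm z * cos (d / 2) \<le> Re (\<zeta> * cnj z)"
    using z False unfolding lens_region_iff[OF \<zeta>] d_def by auto
  have "(norm (\<zeta> - z))\<^sup>2 = (norm \<zeta>)\<^sup>2 + (norm z)\<^sup>2 - 2 * Re (\<zeta> * cnj z)"
    unfolding cmod_power2 by (simp add: power2_diff algebra_simps)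
  also have "\<dots> \<le> 1 + (norm z)\<^sup>2 - 2 * (norm z * cos (d / 2))" using z' \<zeta> by simp
  also have "\<dots> = d\<^sup>2 + 2 * norm z * (1 - cos (d / 2))"
    by (simp add: d_def power2_eq_square algebra_simps)
  also have "\<dots> \<le> d\<^sup>2 + 2 * 1 * (d\<^sup>2 / 8)"
  proof -
    have "cos (d / 2) = 1 - 2 * (sin (d / 4))\<^sup>2" using cos_double_sin[of "d / 4"] by simp
    moreover have "(sin (d / 4))\<^sup>2 \<le> (d / 4)\<^sup>2"
      using abs_sin_x_le_abs_x[of "d / 4"] unfolding abs_le_square_iff .
    ultimately have "1 - cos (d / 2) \<le> d\<^sup>2 / 8" by (simp add: power_divide)
    then show ?thesis using z' cos_le_one[of "d / 2"] by (intro add_left_mono mult_mono) auto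
  qed
  finally show ?thesis by (simp add: d_def)
qed (use \<zeta> in simp)

text \<open>Membership in the region with vertex \<open>circle_exp x\<close>, as an inequality that
  is jointly measurable in \<open>x\<close> and \<open>z\<close>; the condition
  \<open>norm z < 1\<close> is left to the space of \<open>\<mu>\<close>.\<close>

definition lens :: "real \<Rightarrow> complex \<Rightarrow> bool" where
  "lens x z \<longleftrightarrow> z = 0 \<or> norm z * cos ((1 - norm z) / 2) < Re (circle_exp x * cnj z)"

lemma lens_iff: "norm z < 1 \<Longrightarrow> z \<in> lens_region (circle_exp x) \<longleftrightarrow> lens x z"
  using lens_region_iff[of "circle_exp x" z] by (auto simp: lens_def)

lemma lens_near:
  "norm z < 1 \<Longrightarrow> lens x z \<Longrightarrow> (norm (circle_exp x - z))\<^sup>2 \<le> 5/4 * (1 - norm z)\<^sup>2"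
  using lens_region_near[of "circle_exp x" z] by (simp add: lens_iff)

lemma measurable_lens [measurable (raw)]:
  assumes [measurable]: "f \<in> borel_measurable M" "g \<in> borel_measurable M"
  shows "Measurable.pred M (\<lambda>x. lens (f x) (g x))"
proof -
  have [measurable]: "cnj \<in> borel_measurable borel"
    by (intro borel_measurable_continuous_onI continuous_intros)
  have "(\<lambda>x. Re (circle_exp (f x) * cnj (g x))) \<in> borel_measurable M"
    by measurable
  then show ?thesis unfolding lens_def by measurable
qed

lemma lens_interval:
  assumes z: "norm z < 1"
  obtains a b where "0 \<le> a" "b \<le> 1" "a + (1 - norm z) / (4 * pi) \<le> b" "\<And>x. a < x \<Longrightarrow> x < b \<Longrightarrow> lens x z"
proof -
  define d where "d = (1 - norm z) / (4 * pi)"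
  have "1 - norm z \<le> 2 * pi" using pi_gt3 norm_ge_zero[of z] by argo
  then have d: "0 < d" "d \<le> 1/2" using z by (auto simp: d_def divide_simps)
  define t where "t = (if z = 0 then 0 else Arg2pi z / (2 * pi))"
  have t: "0 \<le> t" "t < 1" using Arg2pi_ge_0[of z] Arg2pi_lt_2pi[of z] by (auto simp: t_def)
  have arg: "is_Arg z (2 * pi * t)"
    using Arg2pi[of z] by (auto simp: t_def is_Arg_def)
  have lens: "lens x z" if "\<bar>x - t\<bar> < d" for x
  proof -
    have "is_Arg (circle_exp x) (2 * pi * x)" by (simp add: is_Arg_def circle_exp_def cis_conv_exp)
    moreover have "\<bar>2 * pi * x - 2 * pi * t\<bar> < (1 - norm z) / 2"
    proof -
      have "2 * pi * x - 2 * pi * t = 2 * pi * (x - t)" by (simp add: algebra_simps)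
      then have "\<bar>2 * pi * x - 2 * pi * t\<bar> = 2 * pi * \<bar>x - t\<bar>" by (simp add: abs_mult)
      also have "\<dots> < 2 * pi * d" using that by simp
      finally show ?thesis by (simp add: d_def)
    qed
    ultimately have "z \<in> lens_region (circle_exp x)" using arg z by (auto simp: lens_region_def)
    then show ?thesis using lens_iff[OF z] by simp
  qed
  \<comment> \<open>Of the interval of radius \<open>d\<close> around \<open>t\<close> only the half
    towards the middle of the unit interval is taken, so that no wrapping around occurs;
    \<open>d \<le> 1/2\<close> makes it fit.\<close>
  show ?thesis
  proof (cases "t < 1/2")
    case True
    show ?thesis by (rule that[of t "t + d"]) (use t d True in \<open>auto intro!: lens simp: d_def[symmetric]\<close>)
  next
    case False
    show ?thesis by (rule that[of "t - d" t]) (use t d False in \<open>auto intro!: lens simp: d_def[symmetric]\<close>)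
  qed
qed

lemma lens_measure_ge:
  assumes z: "norm z < 1"
  shows "ennreal ((1 - norm z) / (4 * pi)) \<le> (\<integral>\<^sup>+x\<in>{0..<1}. indicator {x. lens x z} x \<partial>lborel)"
proof -
  obtain a b where ab: "0 \<le> a" "b \<le> 1" "a + (1 - norm z) / (4 * pi) \<le> b" "\<And>x. a < x \<Longrightarrow> x < b \<Longrightarrow> lens x z"
    using lens_interval[OF z] by blast
  have "a \<le> b" using ab(3) z by (smt (verit) divide_nonneg_pos pi_gt_zero)
  have "ennreal ((1 - norm z) / (4 * pi)) \<le> ennreal (b - a)" using ab by (intro ennreal_leI) simp
  also have "\<dots> = (\<integral>\<^sup>+x. indicator {a<..<b} x \<partial>lborel)" using \<open>a \<le> b\<close> by simp
  also have "\<dots> \<le> (\<integral>\<^sup>+x\<in>{0..<1}. indicator {x. lens x z} x \<partial>lborel)"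
    using ab by (intro nn_integral_mono) (auto simp: indicator_def)
  finally show ?thesis .
qed

text \<open>Infinity is kept, so that a finite integral of the power entails finiteness almost
  everywhere.\<close>

definition ennpowr :: "ennreal \<Rightarrow> real \<Rightarrow> ennreal" where
  "ennpowr a s = (if a = \<infinity> then \<infinity> else ennreal (enn2real a powr s))"

lemma measurable_ennpowr [measurable]: "(\<lambda>a. ennpowr a s) \<in> borel_measurable borel"
  unfolding ennpowr_def by measurable

lemma ennpowr_ennreal: "0 \<le> a \<Longrightarrow> ennpowr (ennreal a) s = ennreal (a powr s)"
  by (simp add: ennpowr_def)

lemma ennpowr_mono: "0 \<le> s \<Longrightarrow> a \<le> b \<Longrightarrow> ennpowr a s \<le> ennpowr b s"
  by (cases a; cases b) (auto simp: ennpowr_def top_unique intro!: ennreal_leI powr_mono2)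

text \<open>Young's inequality with the factors divided by \<open>F'\<close> and \<open>K'\<close>.
  Taking these strictly above \<open>F\<close> and \<open>K\<close> makes them positive, and letting
  them decrease covers vanishing bounds; where \<open>g\<close> is infinite, the coefficient
  \<open>b > 0\<close> makes the right side infinite.\<close>

lemma nn_integral_Hoelder:
  assumes [measurable]: "f \<in> borel_measurable M" "g \<in> borel_measurable M"
    and f0: "\<And>x. 0 \<le> f x" and ts: "1 < t" "1 < s" "1 / t + 1 / s = 1"
    and F: "0 \<le> F" "(\<integral>\<^sup>+x. ennreal (f x powr t) \<partial>M) \<le> ennreal (F powr t)"
    and K: "0 \<le> K" "(\<integral>\<^sup>+x. ennpowr (g x) s \<partial>M) \<le> ennreal (K powr s)"
  shows "(\<integral>\<^sup>+x. ennreal (f x) * g x \<partial>M) \<le> ennreal (F * K)"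
proof -
  have pos: "(\<integral>\<^sup>+x. ennreal (f x) * g x \<partial>M) \<le> ennreal (F' * K')" if "F < F'" "K < K'" for F' K'
  proof -
    have p: "0 < F'" "0 < K'" using that F K by auto
    define a b where "a = F' * K' / (t * F' powr t)" and "b = F' * K' / (s * K' powr s)"
    have ab: "0 < a" "0 < b" using p ts by (auto simp: a_def b_def)
    have "ennreal (f x) * g x \<le> ennreal a * ennreal (f x powr t) + ennreal b * ennpowr (g x) s" for x
    proof (cases "g x")
      case (real r)
      have "(f x / F') * (r / K') \<le> (f x / F') powr t / t + (r / K') powr s / s"
        by (rule Youngs_inequality) (use ts p f0 real in auto)
      then have "F' * K' * ((f x / F') * (r / K')) \<le> F' * K' * ((f x / F') powr t / t + (r / K') powr s / s)"
        using p by (intro mult_left_mono) auto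
      also have "F' * K' * ((f x / F') * (r / K')) = f x * r" using p by simp
      also have "F' * K' * ((f x / F') powr t / t + (r / K') powr s / s) = a * f x powr t + b * r powr s"
        using p f0[of x] real by (simp add: a_def b_def powr_divide ring_distribs mult_ac)
      finally show ?thesis using real f0[of x] ab
        by (simp add: ennpowr_ennreal flip: ennreal_mult ennreal_plus) 
    next
      case top
      then show ?thesis using ab by (simp add: ennpowr_def ennreal_mult_top)
    qed
    then have "(\<integral>\<^sup>+x. ennreal (f x) * g x \<partial>M)
        \<le> (\<integral>\<^sup>+x. ennreal a * ennreal (f x powr t) + ennreal b * ennpowr (g x) s \<partial>M)"
      by (intro nn_integral_mono) auto
    also have "\<dots> = ennreal a * (\<integral>\<^sup>+x. ennreal (f x powr t) \<partial>M) + ennreal b * (\<integral>\<^sup>+x. ennpowr (g x) s \<partial>M)"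
      by (subst nn_integral_add) (auto simp: nn_integral_cmult)
    also have "\<dots> \<le> ennreal a * ennreal (F' powr t) + ennreal b * ennreal (K' powr s)"
      using that F K ts
      by (intro add_mono mult_left_mono order_trans[OF F(2)] order_trans[OF K(2)] ennreal_leI powr_mono2) auto
    also have "\<dots> = ennreal (a * F' powr t + b * K' powr s)" using ab by (simp add: ennreal_mult)
    also have "a * F' powr t + b * K' powr s = F' * K' * (1 / t + 1 / s)"
      using p ts by (simp add: a_def b_def field_simps)
    finally show ?thesis using ts by simp
  qed
  have "(\<lambda>n. ennreal ((F + 1 / real (Suc n)) * (K + 1 / real (Suc n)))) \<longlonglongrightarrow> ennreal ((F + 0) * (K + 0))"
    by (intro tendsto_ennrealI tendsto_intros LIMSEQ_Suc lim_1_over_n)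
  moreover have "(\<integral>\<^sup>+x. ennreal (f x) * g x \<partial>M) \<le> ennreal ((F + 1 / real (Suc n)) * (K + 1 / real (Suc n)))" for n
    by (rule pos) auto
  ultimately show ?thesis by (intro LIMSEQ_le_const) auto
qed

section \<open>Arclength integrals over the unit interval\<close>

lemma space_arclength: "space arclength = unit_circle"
  by (simp add: arclength_def space_restrict_space)

lemma sets_arclength: "sets arclength = sets (restrict_space borel unit_circle)"
  by (simp add: arclength_def)

lemma circle_exp_measurable_arclength:
  "circle_exp \<in> measurable borel arclength"
  unfolding measurable_cong_sets[OF refl sets_arclength]
  by (rule measurable_restrict_space2) auto

lemma nn_integral_arclength:
  assumes g: "g \<in> borel_measurable arclength"
  shows "integral\<^sup>N arclength g = ennreal (2 * pi) * (\<integral>\<^sup>+x\<in>{0..<1}. g (circle_exp x) \<partial>lborel)"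
proof -
  have cis: "cis \<in> measurable borel (restrict_space borel unit_circle)"
    by (rule measurable_restrict_space2) (auto intro!: borel_measurable_continuous_onI continuous_intros)
  have g': "g \<in> borel_measurable (restrict_space borel unit_circle)"
    using g by (simp add: measurable_cong_sets[OF sets_arclength refl])
  have [measurable]: "(\<lambda>t. g (cis t)) \<in> borel_measurable borel"
    using measurable_compose[OF cis g'] .
  have "integral\<^sup>N arclength g = (\<integral>\<^sup>+t. g (cis t) \<partial>restrict_space lborel {0..<2 * pi})"
    unfolding arclength_def
    by (rule nn_integral_distr[OF _ g[unfolded arclength_def]]) (auto intro!: measurable_restrict_space1 cis)
  also have "\<dots> = (\<integral>\<^sup>+t. g (cis t) * indicator {0..<2 * pi} t \<partial>lborel)"
    by (simp add: nn_integral_restrict_space)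
  also have "\<dots> = ennreal \<bar>2 * pi\<bar> * (\<integral>\<^sup>+x. g (cis (0 + 2 * pi * x)) * indicator {0..<2 * pi} (0 + 2 * pi * x) \<partial>lborel)"
    by (rule nn_integral_real_affine) auto
  also have "(\<lambda>x. indicator {0..<2 * pi} (0 + 2 * pi * x) :: ennreal) = indicator {0..<1}"
    using pi_gt_zero by (auto simp: indicator_def fun_eq_iff zero_le_mult_iff simp del: pi_gt_zero)
  finally show ?thesis by (simp add: circle_exp_def)
qed

lemma Lp_space_ennreal_arclength_iff:
  assumes g [measurable]: "g \<in> borel_measurable arclength"
  shows "g \<in> Lp_space_ennreal s arclength \<longleftrightarrow> (\<integral>\<^sup>+x\<in>{0..<1}. ennpowr (g (circle_exp x)) s \<partial>lborel) < \<infinity>"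
proof -
  have "(\<integral>\<^sup>+x\<in>{0..<1}. ennpowr (g (circle_exp x)) s \<partial>lborel) < \<infinity> \<longleftrightarrow> (\<integral>\<^sup>+\<zeta>. ennpowr (g \<zeta>) s \<partial>arclength) < \<infinity>"
    by (subst nn_integral_arclength) (auto simp: ennreal_mult_less_top)
  also have "\<dots> \<longleftrightarrow> (AE x in arclength. g x < \<infinity>) \<and> (\<integral>\<^sup>+\<zeta>. ennreal (enn2real (g \<zeta>) powr s) \<partial>arclength) < \<infinity>"
  proof safe
    assume fin: "(\<integral>\<^sup>+\<zeta>. ennpowr (g \<zeta>) s \<partial>arclength) < \<infinity>"
    then have "AE \<zeta> in arclength. ennpowr (g \<zeta>) s \<noteq> \<infinity>"
      by (intro nn_integral_PInf_AE) auto
    then show "AE x in arclength. g x < \<infinity>" by eventually_elim (auto simp: ennpowr_def less_top split: if_splits)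
    have "(\<integral>\<^sup>+\<zeta>. ennreal (enn2real (g \<zeta>) powr s) \<partial>arclength) \<le> (\<integral>\<^sup>+\<zeta>. ennpowr (g \<zeta>) s \<partial>arclength)"
      by (intro nn_integral_mono) (auto simp: ennpowr_def)
    then show "(\<integral>\<^sup>+\<zeta>. ennreal (enn2real (g \<zeta>) powr s) \<partial>arclength) < \<infinity>" using fin by (rule le_less_trans)
  next
    assume "AE x in arclength. g x < \<infinity>" and fin: "(\<integral>\<^sup>+\<zeta>. ennreal (enn2real (g \<zeta>) powr s) \<partial>arclength) < \<infinity>"
    then have "(\<integral>\<^sup>+\<zeta>. ennpowr (g \<zeta>) s \<partial>arclength) = (\<integral>\<^sup>+\<zeta>. ennreal (enn2real (g \<zeta>) powr s) \<partial>arclength)"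
      by (intro nn_integral_cong_AE) (auto simp: ennpowr_def)
    then show "(\<integral>\<^sup>+\<zeta>. ennpowr (g \<zeta>) s \<partial>arclength) < \<infinity>" using fin by simp
  qed
  finally show ?thesis
    using g by (simp add: Lp_space_ennreal_def Lp_space_def integrable_iff_bounded)
qed

section \<open>The embedding\<close>

locale disc_measure =
  fixes \<mu> :: "complex measure"
  assumes sets_mu: "sets \<mu> = sets (restrict_space borel unit_disc)"
begin

lemma space_mu: "space \<mu> = unit_disc"
  using sets_eq_imp_space_eq[OF sets_mu] by (simp add: space_restrict_space)

lemma ident_measurable [measurable]: "(\<lambda>z. z) \<in> measurable \<mu> borel"
  unfolding measurable_cong_sets[OF sets_mu refl] by (intro measurable_restrict_space1) simp

lemma continuous_measurable:
  fixes f :: "complex \<Rightarrow> 'b::topological_space"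
  shows "continuous_on unit_disc f \<Longrightarrow> f \<in> borel_measurable \<mu>"
  unfolding measurable_cong_sets[OF sets_mu refl] by (rule borel_measurable_continuous_on_restrict)

text \<open>\<open>weight UNIV x\<close> is \<open>B\<close> at \<open>circle_exp x\<close>; for
  compactness \<open>E\<close> is a thin annulus at the boundary.\<close>

definition weight :: "complex set \<Rightarrow> real \<Rightarrow> ennreal" where
  "weight E x = (\<integral>\<^sup>+z\<in>E. (ennreal (1 / (1 - norm z)) * indicator {z. lens x z} z) \<partial>\<mu>)"

lemma B_fun_eq_weight: "B_fun \<mu> (circle_exp x) = weight UNIV x"
  unfolding B_fun_def weight_def
  by (intro nn_integral_cong) (auto simp: space_mu lens_iff indicator_def)

lemma indicator_lens_measurable [measurable (raw)]:
  assumes [measurable]: "f \<in> borel_measurable M" "g \<in> borel_measurable M"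
  shows "(\<lambda>x. indicator {z. lens (f x) z} (g x) :: ennreal) \<in> borel_measurable M"
proof -
  have "(\<lambda>x. if lens (f x) (g x) then 1 else 0 :: ennreal) \<in> borel_measurable M" by measurable
  then show ?thesis by (rule measurable_cong[THEN iffD1, rotated]) (auto simp: indicator_def)
qed

lemma weight_measurable:
  assumes "sigma_finite_measure \<mu>" and [measurable]: "E \<in> sets borel"
  shows "weight E \<in> borel_measurable borel"
proof -
  interpret sigma_finite_measure \<mu> by fact
  have [measurable]: "(\<lambda>p. snd p) \<in> borel_measurable (borel \<Otimes>\<^sub>M \<mu>)"
    using measurable_compose[OF measurable_snd ident_measurable] by simp
  have "(\<lambda>p. ennreal (1 / (1 - norm (snd p))) * indicator {z. lens (fst p) z} (snd p) * indicator E (snd p))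
      \<in> borel_measurable (borel \<Otimes>\<^sub>M \<mu>)"
    by measurable
  then have "(\<lambda>(x, z). ennreal (1 / (1 - norm z)) * indicator {z. lens x z} z * indicator E z)
      \<in> borel_measurable (borel \<Otimes>\<^sub>M \<mu>)" by (simp add: split_beta')
  from borel_measurable_nn_integral[OF this] show ?thesis unfolding weight_def[abs_def] .
qed

text \<open>Finiteness of \<open>weight\<close> almost everywhere puts a parameter of finite weight
  into every rational subinterval. Its region has finite measure because
  \<open>1 / (1 - norm z) \<ge> 1\<close>, and these countably many regions cover the disc, as each
  \<open>z\<close> lies in the regions of a whole interval of parameters.\<close>

lemma weight_finite_imp_sigma_finite:
  assumes meas: "weight UNIV \<in> borel_measurable borel"
    and fin: "(\<integral>\<^sup>+x\<in>{0..<1}. ennpowr (weight UNIV x) s \<partial>lborel) < \<infinity>"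
  shows "sigma_finite_measure \<mu>"
proof
  note meas [measurable]
  have "AE x in lborel. ennpowr (weight UNIV x) s * indicator {0..<1} x \<noteq> \<infinity>"
    by (rule nn_integral_PInf_AE) (use fin in auto)
  then have ae: "AE x in lborel. x \<in> {0..<1} \<longrightarrow> weight UNIV x \<noteq> \<infinity>"
    by eventually_elim (auto simp: ennpowr_def)
  have "\<exists>x. a < x \<and> x < b \<and> weight UNIV x \<noteq> \<infinity>" if "0 \<le> a" "a < b" "b \<le> 1" for a b
  proof (rule ccontr)
    assume no: "\<not> ?thesis"
    have "ennreal (b - a) = (\<integral>\<^sup>+x. indicator {a<..<b} x \<partial>lborel)" using that by simp
    also have "\<dots> = (\<integral>\<^sup>+x. 0 \<partial>(lborel :: real measure))"
      by (rule nn_integral_cong_AE) (use ae in eventually_elim, use no that in \<open>auto simp: indicator_def\<close>)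
    finally show False using that by simp
  qed
  then obtain \<phi> where \<phi>: "\<And>a b. 0 \<le> a \<Longrightarrow> a < b \<Longrightarrow> b \<le> 1 \<Longrightarrow> a < \<phi> a b \<and> \<phi> a b < b \<and> weight UNIV (\<phi> a b) \<noteq> \<infinity>"
    by metis
  define A where "A = (\<lambda>(a, b). space \<mu> \<inter> {z. lens (\<phi> a b) z}) ` {(a, b). a \<in> \<rat> \<and> b \<in> \<rat> \<and> 0 \<le> a \<and> a < b \<and> b \<le> 1}"
  show "\<exists>A. countable A \<and> A \<subseteq> sets \<mu> \<and> \<Union> A = space \<mu> \<and> (\<forall>a\<in>A. emeasure \<mu> a \<noteq> \<infinity>)"
  proof (intro exI[of _ A] conjI ballI)
    have "countable (\<rat> \<times> \<rat> :: (real \<times> real) set)" by (intro countable_SIGMA countable_rat)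
    then show "countable A" unfolding A_def by (intro countable_image) (auto elim!: countable_subset[rotated])
    have meas_lens: "space \<mu> \<inter> {z. lens x z} \<in> sets \<mu>" for x
    proof -
      have "{z \<in> space \<mu>. lens x z} \<in> sets \<mu>" by measurable
      then show ?thesis by (simp add: Int_def)
    qed
    then show "A \<subseteq> sets \<mu>" unfolding A_def by auto
    show "\<Union> A = space \<mu>"
    proof
      show "space \<mu> \<subseteq> \<Union> A"
      proof
        fix z assume "z \<in> space \<mu>"
        then have z: "norm z < 1" by (simp add: space_mu)
        then obtain a b where ab: "0 \<le> a" "b \<le> 1" "a + (1 - norm z) / (4 * pi) \<le> b"
          "\<And>x. a < x \<Longrightarrow> x < b \<Longrightarrow> lens x z" using lens_interval by blast
        have "0 < (1 - norm z) / (4 * pi)" using z by simp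
        then have "a < b" using ab by linarith
        then obtain a' where a': "a' \<in> \<rat>" "a < a'" "a' < b" using Rats_dense_in_real by blast
        then obtain b' where b': "b' \<in> \<rat>" "a' < b'" "b' < b" using Rats_dense_in_real by blast
        have "a' < \<phi> a' b' \<and> \<phi> a' b' < b'" using \<phi>[of a' b'] a' b' ab by auto
        then have "z \<in> space \<mu> \<inter> {z. lens (\<phi> a' b') z}" using ab(4) a' b' z by (auto simp: space_mu)
        moreover have "(a', b') \<in> {(a, b). a \<in> \<rat> \<and> b \<in> \<rat> \<and> 0 \<le> a \<and> a < b \<and> b \<le> 1}" using a' b' ab by auto
        ultimately show "z \<in> \<Union> A" unfolding A_def by blast
      qed
    qed (auto simp: A_def)
    fix a assume "a \<in> A"
    then obtain x where x: "a = space \<mu> \<inter> {z. lens x z}" "weight UNIV x \<noteq> \<infinity>" using \<phi> by (auto simp: A_def)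
    have "emeasure \<mu> a = (\<integral>\<^sup>+z. indicator a z \<partial>\<mu>)" using meas_lens x by simp
    also have "\<dots> \<le> weight UNIV x" unfolding weight_def
    proof (rule nn_integral_mono)
      fix z assume z: "z \<in> space \<mu>"
      have "ennreal 1 \<le> ennreal (1 / (1 - norm z))" using z by (intro ennreal_leI) (auto simp: space_mu)
      then show "indicator a z \<le> ennreal (1 / (1 - norm z)) * indicator {z. lens x z} z * indicator UNIV z"
        using x by (auto simp: indicator_def)
    qed
    finally show "emeasure \<mu> a \<noteq> \<infinity>" using x(2) by (auto simp: top_unique)
  qed
qed

end

section \<open>Sufficiency of (iii): the embedding estimate\<close>

locale hardy_embedding = disc_measure +
  fixes p q s :: real
  assumes q: "0 < q" and qp: "q < p" and s: "s = p / (p - q)"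
begin

lemma p_pos: "0 < p" using q qp by simp

lemma s_gt_1: "1 < s" using q qp by (simp add: s field_simps)

text \<open>Here \<open>4 * pi\<close> comes from the length of the set of \<open>x\<close> with
  \<open>lens x z\<close>, \<open>384\<close> from the domination of Poisson integrals by the
  maximal function, and \<open>32\<close> from the L2 maximal inequality; \<open>q / p\<close> is
  the power left by Hoelder's inequality.\<close>

definition "embed_const = 4 * pi * (384\<^sup>2 * 32) powr (q / p)"

lemma embed_const_pos: "0 < embed_const"
  by (simp add: embed_const_def)

lemma embedding_estimate_smooth:
  assumes sf: "sigma_finite_measure \<mu>" and E [measurable]: "E \<in> sets borel"
    and K: "0 \<le> K" "(\<integral>\<^sup>+x\<in>{0..<1}. ennpowr (weight E x) s \<partial>lborel) \<le> ennreal (K powr s)"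
    and f: "f holomorphic_on ball 0 R" "1 < R"
    and N: "0 \<le> N" "integral {0..1} (\<lambda>x. norm (f (circle_exp x)) powr p) \<le> N powr p"
  shows "(\<integral>\<^sup>+z\<in>E. ennreal (norm (f z) powr q) \<partial>\<mu>) \<le> ennreal (embed_const * N powr q * K)"
proof -
  interpret sigma_finite_measure \<mu> by fact
  interpret pair_sigma_finite lborel \<mu> by unfold_locales
  \<comment> \<open>Halving the exponent turns the bound on the \<open>p\<close>-th power mean of
    \<open>f\<close> into one on the L2 norm of \<open>u\<close>, where the maximal inequality is
    available.\<close>
  define u where "u x = norm (f (circle_exp x)) powr (p / 2)" for x
  have contf: "continuous_on (ball 0 R) f" using f(1) by (rule holomorphic_on_imp_continuous_on)
  have u: "continuous_on UNIV u" "\<And>x. 0 \<le> u x" "\<And>x. u (x + 1) = u x"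
    unfolding u_def using p_pos f(2)
    by (auto simp: circle_exp_periodic intro!: continuous_intros continuous_on_compose2[OF contf])
  define G where "G = maximal_fun u"
  have G0: "0 \<le> G x" for x unfolding G_def by (rule maximal_fun_nonneg[OF u])
  have [measurable]: "G \<in> borel_measurable borel" unfolding G_def by (rule borel_measurable_maximal_fun[OF u])
  have G2: "(\<integral>\<^sup>+x\<in>{0..<1}. ennreal ((G x)\<^sup>2) \<partial>lborel) \<le> ennreal (32 * N powr p)"
  proof -
    have "(u x)\<^sup>2 = norm (f (circle_exp x)) powr p" for x
      by (simp add: u_def power2_eq_square flip: powr_add)
    then show ?thesis
      using maximal_fun_nn_integral[OF u] N(2) unfolding G_def
      by (elim order_trans) (auto intro!: ennreal_leI)
  qed
  \<comment> \<open>A majorant of \<open>norm (f z) powr q\<close> on the whole region at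
    \<open>x\<close>; its power \<open>p / q\<close> is \<open>(384 * G x)^2\<close>.\<close>
  define H where "H x = (384 * G x) powr (2 * q / p)" for x
  have [measurable]: "H \<in> borel_measurable borel" unfolding H_def by measurable
  have fH: "norm (f z) powr q \<le> H x" if "x \<in> {0..<1}" "norm z < 1" "lens x z" for x z
  proof -
    have "norm (f z) powr (p / 2) \<le> poisson_int u z"
      unfolding u_def using p_pos that by (intro norm_powr_le_poisson_int[OF f]) auto
    also have "\<dots> \<le> 384 * G x"
      unfolding G_def using that by (intro poisson_int_le_maximal_fun[OF u] lens_near) auto
    finally have "(norm (f z) powr (p / 2)) powr (2 * q / p) \<le> H x"
      unfolding H_def using q p_pos by (intro powr_mono2) auto
    then show ?thesis using p_pos by (simp add: powr_powr)
  qed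
  have [measurable]: "f \<in> borel_measurable \<mu>"
    by (intro continuous_measurable continuous_on_subset[OF contf]) (use f in auto)
  have msnd: "(\<lambda>p. g (snd p)) \<in> borel_measurable (lborel \<Otimes>\<^sub>M \<mu>)" if "g \<in> borel_measurable \<mu>" for g :: "complex \<Rightarrow> 'c::topological_space"
    using measurable_compose[OF measurable_snd that] .
  have [measurable]: "(\<lambda>p. snd p) \<in> borel_measurable (lborel \<Otimes>\<^sub>M \<mu>)" by (rule msnd[OF ident_measurable])
  \<comment> \<open>The factor \<open>4 * pi / (1 - norm z)\<close> is the reciprocal of the lower
    bound for the length of the set of parameters whose region contains \<open>z\<close>, so
    integrating over \<open>x\<close> returns at least \<open>norm (f z) powr q\<close> on
    \<open>E\<close>.\<close>
  define \<Psi> where "\<Psi> = (\<lambda>p. ennreal (norm (f (snd p)) powr q) * indicator E (snd p) * ennreal (4 * pi / (1 - norm (snd p)))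
      * (indicator {z. lens (fst p) z} (snd p) * indicator {0..<1} (fst p)))"
  have "(\<lambda>p. norm (f (snd p)) powr q) \<in> borel_measurable (lborel \<Otimes>\<^sub>M \<mu>)"
    by (rule msnd[of "\<lambda>z. norm (f z) powr q"]) measurable
  then have [measurable]: "\<Psi> \<in> borel_measurable (lborel \<Otimes>\<^sub>M \<mu>)" unfolding \<Psi>_def by measurable
  have "(\<integral>\<^sup>+z\<in>E. ennreal (norm (f z) powr q) \<partial>\<mu>) \<le> (\<integral>\<^sup>+z. (\<integral>\<^sup>+x. \<Psi> (x, z) \<partial>lborel) \<partial>\<mu>)"
  proof (rule nn_integral_mono)
    fix z assume "z \<in> space \<mu>"
    then have z: "norm z < 1" by (simp add: space_mu)
    have "(\<integral>\<^sup>+x. \<Psi> (x, z) \<partial>lborel) = ennreal (norm (f z) powr q) * indicator E z * ennreal (4 * pi / (1 - norm z))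
      * (\<integral>\<^sup>+x\<in>{0..<1}. indicator {x. lens x z} x \<partial>lborel)"
      unfolding \<Psi>_def fst_conv snd_conv
      by (subst nn_integral_cmult) (auto simp: indicator_def)
    also have "\<dots> \<ge> ennreal (norm (f z) powr q) * indicator E z * ennreal (4 * pi / (1 - norm z))
      * ennreal ((1 - norm z) / (4 * pi))"
      by (intro mult_left_mono lens_measure_ge z) auto
    also have "ennreal (norm (f z) powr q) * indicator E z * ennreal (4 * pi / (1 - norm z))
      * ennreal ((1 - norm z) / (4 * pi)) = ennreal (norm (f z) powr q) * indicator E z"
      using z by (simp add: mult.assoc flip: ennreal_mult)
    finally show "ennreal (norm (f z) powr q) * indicator E z \<le> (\<integral>\<^sup>+x. \<Psi> (x, z) \<partial>lborel)" .
  qed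
  also have "\<dots> = (\<integral>\<^sup>+x. (\<integral>\<^sup>+z. \<Psi> (x, z) \<partial>\<mu>) \<partial>lborel)" by (rule Fubini') simp
  also have "\<dots> \<le> (\<integral>\<^sup>+x\<in>{0..<1}. ennreal (4 * pi) * (ennreal (H x) * weight E x) \<partial>lborel)"
  proof (rule nn_integral_mono)
    fix x
    show "(\<integral>\<^sup>+z. \<Psi> (x, z) \<partial>\<mu>) \<le> ennreal (4 * pi) * (ennreal (H x) * weight E x) * indicator {0..<1} x"
    proof (cases "x \<in> {0..<1}")
      case True
      have "(\<integral>\<^sup>+z. \<Psi> (x, z) \<partial>\<mu>) \<le> (\<integral>\<^sup>+z. ennreal (4 * pi * H x) * (ennreal (1 / (1 - norm z)) * indicator {z. lens x z} z * indicator E z) \<partial>\<mu>)"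
      proof (rule nn_integral_mono)
        fix z assume "z \<in> space \<mu>"
        then have z: "norm z < 1" by (simp add: space_mu)
        show "\<Psi> (x, z) \<le> ennreal (4 * pi * H x) * (ennreal (1 / (1 - norm z)) * indicator {z. lens x z} z * indicator E z)"
        proof (cases "lens x z \<and> z \<in> E")
          case True
          have "norm (f z) powr q * (4 * pi / (1 - norm z)) \<le> 4 * pi * H x * (1 / (1 - norm z))"
            using mult_right_mono[OF fH[OF \<open>x \<in> _\<close> z], of "4 * pi / (1 - norm z)"] True z by (simp add: mult_ac)
          then show ?thesis using True \<open>x \<in> _\<close> z by (simp add: \<Psi>_def ennreal_leI flip: ennreal_mult'')
        qed (auto simp: \<Psi>_def)
      qed
      also have "\<dots> = ennreal (4 * pi * H x) * weight E x"
        unfolding weight_def by (rule nn_integral_cmult) measurable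
      finally show ?thesis using True by (simp add: ennreal_mult' mult.assoc)
    qed (simp add: \<Psi>_def)
  qed
  also have "\<dots> = ennreal (4 * pi) * (\<integral>\<^sup>+x. ennreal (H x) * weight E x \<partial>restrict_space lborel {0..<1})"
    using weight_measurable[OF sf E]
    by (simp add: mult.assoc nn_integral_restrict_space nn_integral_cmult)
  also have "(\<integral>\<^sup>+x. ennreal (H x) * weight E x \<partial>restrict_space lborel {0..<1})
      \<le> ennreal (((384\<^sup>2 * 32) powr (q / p) * N powr q) * K)"
  proof (rule nn_integral_Hoelder[of _ _ _ "p / q" s])
    have "(\<integral>\<^sup>+x. ennreal (H x powr (p / q)) \<partial>restrict_space lborel {0..<1})
      = (\<integral>\<^sup>+x\<in>{0..<1}. ennreal (384\<^sup>2) * ennreal ((G x)\<^sup>2) \<partial>lborel)"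
      using q p_pos G0
      by (simp add: nn_integral_restrict_space H_def powr_powr power_mult_distrib ennreal_mult)
    also have "\<dots> = ennreal (384\<^sup>2) * (\<integral>\<^sup>+x\<in>{0..<1}. ennreal ((G x)\<^sup>2) \<partial>lborel)"
      by (simp only: mult.assoc, rule nn_integral_cmult) measurable
    also have "\<dots> \<le> ennreal (384\<^sup>2) * ennreal (32 * N powr p)" by (intro mult_left_mono G2) auto
    also have "\<dots> = ennreal (((384\<^sup>2 * 32) powr (q / p) * N powr q) powr (p / q))"
      using q p_pos by (simp add: powr_mult powr_powr ennreal_mult)
    finally show "(\<integral>\<^sup>+x. ennreal (H x powr (p / q)) \<partial>restrict_space lborel {0..<1})
      \<le> ennreal (((384\<^sup>2 * 32) powr (q / p) * N powr q) powr (p / q))" .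
    show "(\<integral>\<^sup>+x. ennpowr (weight E x) s \<partial>restrict_space lborel {0..<1}) \<le> ennreal (K powr s)"
      using K by (simp add: nn_integral_restrict_space)
    show "1 / (p / q) + 1 / s = 1" using q qp by (simp add: s field_simps)
  qed (use q qp s_gt_1 K weight_measurable[OF sf E] in \<open>auto simp: H_def intro!: measurable_restrict_space1\<close>)
  finally have "(\<integral>\<^sup>+z\<in>E. ennreal (norm (f z) powr q) \<partial>\<mu>)
    \<le> ennreal (4 * pi) * ennreal (((384\<^sup>2 * 32) powr (q / p) * N powr q) * K)"
    by (simp add: mult_left_mono)
  then show ?thesis using K by (simp add: embed_const_def mult_ac flip: ennreal_mult)
qed

text \<open>Dilates satisfy the smooth estimate with \<open>hardy_norm p f\<close> as a common bound
  of their means; Fatou's lemma removes the dilation.\<close>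

lemma embedding_estimate:
  assumes sf: "sigma_finite_measure \<mu>" and E [measurable]: "E \<in> sets borel"
    and K: "0 \<le> K" "(\<integral>\<^sup>+x\<in>{0..<1}. ennpowr (weight E x) s \<partial>lborel) \<le> ennreal (K powr s)"
    and f: "f \<in> hardy_space p"
  shows "(\<integral>\<^sup>+z\<in>E. ennreal (norm (f z) powr q) \<partial>\<mu>) \<le> ennreal (embed_const * hardy_norm p f powr q * K)"
proof (rule nn_integral_tendsto_le)
  have hol: "f holomorphic_on unit_disc" using f by (simp add: hardy_space_def)
  note contf = holomorphic_on_imp_continuous_on[OF hol]
  define r where "r n = 1 - 1 / (real n + 2)" for n
  have r: "0 < r n" "r n < 1" for n by (auto simp: r_def field_simps)
  have r1: "r \<longlonglongrightarrow> 1" unfolding r_def by real_asymp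
  have in_disc: "norm (of_real (r n) * z) < 1" if "norm z < 1" for n and z :: complex
    using mult_strict_mono[of "r n" 1 "norm z" 1] r[of n] that by (auto simp: norm_mult)
  show "(\<lambda>z. ennreal (norm (f (of_real (r n) * z)) powr q) * indicator E z) \<in> borel_measurable \<mu>" for n
  proof -
    have [measurable]: "(\<lambda>z. f (of_real (r n) * z)) \<in> borel_measurable \<mu>"
      by (intro continuous_measurable continuous_on_compose2[OF contf] continuous_intros) (use in_disc in auto)
    show ?thesis by measurable
  qed
  show "(\<lambda>n. ennreal (norm (f (of_real (r n) * z)) powr q) * indicator E z)
      \<longlonglongrightarrow> ennreal (norm (f z) powr q) * indicator E z" if "z \<in> space \<mu>" for z
  proof -
    have z: "z \<in> unit_disc" using that by (simp add: space_mu)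
    have "isCont f z" using contf z continuous_on_eq_continuous_at[OF open_ball] by metis
    then have "(\<lambda>n. f (of_real (r n) * z)) \<longlonglongrightarrow> f (of_real 1 * z)"
      by (intro isCont_tendsto_compose[of _ f] tendsto_intros r1) auto
    then have "(\<lambda>n. ennreal (norm (f (of_real (r n) * z)) powr q)) \<longlonglongrightarrow> ennreal (norm (f (of_real 1 * z)) powr q)"
      using q by (intro tendsto_ennrealI tendsto_powr' tendsto_norm tendsto_const) auto
    then show ?thesis by (cases "z \<in> E") auto
  qed
  show "(\<integral>\<^sup>+z\<in>E. ennreal (norm (f (of_real (r n) * z)) powr q) \<partial>\<mu>) \<le> ennreal (embed_const * hardy_norm p f powr q * K)" for n
    using r[of n]
    by (intro embedding_estimate_smooth[OF sf E K holomorphic_dilate[OF hol r(1)]] hardy_norm_nonneg f hardy_spaceD p_pos) auto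
qed

lemma Lp_norm_eq:
  assumes "f \<in> borel_measurable \<mu>" "(\<integral>\<^sup>+z. ennreal (norm (f z) powr q) \<partial>\<mu>) \<le> ennreal c" "0 \<le> c"
  shows "f \<in> Lp_space q \<mu>" "Lp_norm q \<mu> f \<le> c powr (1 / q)"
proof -
  note assms(1) [measurable]
  have int: "integrable \<mu> (\<lambda>x. norm (f x) powr q)"
    using assms(2) by (intro integrableI_bounded) (auto intro: le_less_trans)
  then show "f \<in> Lp_space q \<mu>" using assms(1) by (simp add: Lp_space_def)
  have "ennreal (\<integral>x. norm (f x) powr q \<partial>\<mu>) \<le> ennreal c"
    using nn_integral_eq_integral[OF int] assms(2) by simp
  then have "(\<integral>x. norm (f x) powr q \<partial>\<mu>) \<le> c" using assms(3) by simp
  then show "Lp_norm q \<mu> f \<le> c powr (1 / q)"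
    unfolding Lp_norm_def using q by (intro powr_mono2 integral_nonneg_AE) auto
qed

lemma hardy_measurable: "f \<in> hardy_space p \<Longrightarrow> f \<in> borel_measurable \<mu>"
  by (intro continuous_measurable holomorphic_on_imp_continuous_on) (simp add: hardy_space_def)

lemma const_in_hardy_space: "(\<lambda>_. c) \<in> hardy_space p"
  by (rule hardy_spaceI(1)[of _ p "norm c"]) (use p_pos in auto)

lemma hardy_locally_bounded:
  assumes "f \<in> hardy_space p" "hardy_norm p f \<le> M" "norm z \<le> \<rho>" "\<rho> < 1"
  shows "norm (f z) \<le> (2 / (1 - \<rho>) * M powr p) powr (1 / p)"
proof -
  have "norm (f z) powr p \<le> 2 / (1 - norm z) * hardy_norm p f powr p"
    using assms by (intro hardy_growth p_pos) auto
  also have "\<dots> \<le> 2 / (1 - \<rho>) * M powr p"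
    using assms p_pos hardy_norm_nonneg[OF assms(1)] by (intro mult_mono divide_left_mono powr_mono2) auto
  finally have "(norm (f z) powr p) powr (1 / p) \<le> (2 / (1 - \<rho>) * M powr p) powr (1 / p)"
    using p_pos by (intro powr_mono2) auto
  then show ?thesis using p_pos by (simp add: powr_powr)
qed

text \<open>On each circle of radius \<open>r < 1\<close> the growth estimate gives one constant
  majorant for the whole sequence, so the means converge by dominated convergence.\<close>

lemma hardy_space_limit:
  assumes F: "\<And>n. F n \<in> hardy_space p" "\<And>n. hardy_norm p (F n) \<le> M" and M: "0 \<le> M"
    and g: "g holomorphic_on unit_disc" and lim: "\<And>z. z \<in> unit_disc \<Longrightarrow> (\<lambda>n. F n z) \<longlonglongrightarrow> g z"
  shows "g \<in> hardy_space p" "hardy_norm p g \<le> M"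
proof -
  have "integral {0..1} (\<lambda>x. norm (g (of_real r * circle_exp x)) powr p) \<le> M powr p" if r: "0 < r" "r < 1" for r
  proof -
    have hol: "F n holomorphic_on unit_disc" for n using F(1)[of n] by (simp add: hardy_space_def)
    have cont: "continuous_on {0..1} (\<lambda>x. norm (h (of_real r * circle_exp x)) powr p)" if "h holomorphic_on unit_disc" for h
      using r p_pos by (intro continuous_intros continuous_on_compose2[OF holomorphic_on_imp_continuous_on[OF that]])
        (auto simp: norm_mult)
    have "(\<lambda>n. integral {0..1} (\<lambda>x. norm (F n (of_real r * circle_exp x)) powr p))
      \<longlonglongrightarrow> integral {0..1} (\<lambda>x. norm (g (of_real r * circle_exp x)) powr p)"
    proof (rule dominated_convergence(2)[where h = "\<lambda>_. ((2 / (1 - r) * M powr p) powr (1 / p)) powr p"])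
      show "(\<lambda>x. norm (F n (of_real r * circle_exp x)) powr p) integrable_on {0..1}" for n
        by (intro integrable_continuous_real cont hol)
      fix x :: real
      show "norm (norm (F n (of_real r * circle_exp x)) powr p) \<le> ((2 / (1 - r) * M powr p) powr (1 / p)) powr p" for n
      proof -
        have "norm (F n (of_real r * circle_exp x)) \<le> (2 / (1 - r) * M powr p) powr (1 / p)"
          by (rule hardy_locally_bounded[OF F]) (use r in \<open>auto simp: norm_mult\<close>)
        then show ?thesis using p_pos by (simp add: powr_mono2)
      qed
      have "of_real r * circle_exp x \<in> unit_disc" using r by (simp add: norm_mult)
      from lim[OF this] show "(\<lambda>n. norm (F n (of_real r * circle_exp x)) powr p) \<longlonglongrightarrow> norm (g (of_real r * circle_exp x)) powr p"
        using p_pos by (intro tendsto_powr' tendsto_norm tendsto_const) auto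
    qed auto
    moreover have "integral {0..1} (\<lambda>x. norm (F n (of_real r * circle_exp x)) powr p) \<le> M powr p" for n
      using hardy_spaceD[OF F(1) r p_pos, of n] powr_mono2[OF _ hardy_norm_nonneg[OF F(1)] F(2), of p n] p_pos by simp
    ultimately show ?thesis by (intro LIMSEQ_le_const2) auto
  qed
  then show "g \<in> hardy_space p" "hardy_norm p g \<le> M"
    using hardy_spaceI[OF g p_pos M] by auto
qed

text \<open>Dominated convergence twice: against \<open>\<mu>\<close> for each \<open>x\<close> of
  finite weight, since every \<open>z\<close> in the open disc eventually leaves the annuli, and
  then in \<open>x\<close>.\<close>

lemma weight_annulus_tendsto:
  assumes sf: "sigma_finite_measure \<mu>"
    and fin: "(\<integral>\<^sup>+x\<in>{0..<1}. ennpowr (weight UNIV x) s \<partial>lborel) < \<infinity>"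
  shows "(\<lambda>n. \<integral>\<^sup>+x\<in>{0..<1}. ennpowr (weight {z. 1 - 1 / real (Suc n) \<le> norm z} x) s \<partial>lborel) \<longlonglongrightarrow> 0"
proof -
  define E where "E n = {z :: complex. 1 - 1 / real (Suc n) \<le> norm z}" for n
  have [measurable]: "E n \<in> sets borel" for n
    unfolding E_def by (intro borel_closed closed_Collect_le continuous_intros)
  have le: "weight (E n) x \<le> weight UNIV x" for n x
    unfolding weight_def by (intro nn_integral_mono) (auto simp: indicator_def)
  have tendsto: "(\<lambda>n. weight (E n) x) \<longlonglongrightarrow> 0" if "weight UNIV x < \<infinity>" for x
  proof -
    have "(\<lambda>n. weight (E n) x) \<longlonglongrightarrow> (\<integral>\<^sup>+z. 0 \<partial>\<mu>)"
      unfolding weight_def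
    proof (rule nn_integral_dominated_convergence[where w = "\<lambda>z. ennreal (1 / (1 - norm z)) * indicator {z. lens x z} z"])
      show "(\<integral>\<^sup>+z. ennreal (1 / (1 - norm z)) * indicator {z. lens x z} z \<partial>\<mu>) < \<infinity>"
        using that by (simp add: weight_def)
      show "AE z in \<mu>. (\<lambda>n. ennreal (1 / (1 - norm z)) * indicator {z. lens x z} z * indicator (E n) z) \<longlonglongrightarrow> 0"
      proof (rule AE_I2)
        fix z assume "z \<in> space \<mu>"
        then have z: "norm z < 1" by (simp add: space_mu)
        have "(\<lambda>n. 1 - 1 / real (Suc n)) \<longlonglongrightarrow> 1 - 0" by (intro tendsto_intros LIMSEQ_Suc lim_1_over_n)
        then have "eventually (\<lambda>n. norm z < 1 - 1 / real (Suc n)) sequentially" using z by (intro order_tendstoD) auto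
        then have "eventually (\<lambda>n. ennreal (1 / (1 - norm z)) * indicator {z. lens x z} z * indicator (E n) z = 0) sequentially"
          by eventually_elim (auto simp: E_def)
        then show "(\<lambda>n. ennreal (1 / (1 - norm z)) * indicator {z. lens x z} z * indicator (E n) z) \<longlonglongrightarrow> 0"
          by (rule tendsto_eventually)
      qed
    qed (auto simp: indicator_def)
    then show ?thesis by simp
  qed
  have [measurable]: "weight A \<in> borel_measurable borel" if "A \<in> sets borel" for A
    by (rule weight_measurable[OF sf that])
  have "(\<lambda>n. \<integral>\<^sup>+x\<in>{0..<1}. ennpowr (weight (E n) x) s \<partial>lborel) \<longlonglongrightarrow> (\<integral>\<^sup>+(x::real). 0 \<partial>lborel)"
  proof (rule nn_integral_dominated_convergence[where w = "\<lambda>x. ennpowr (weight UNIV x) s * indicator {0..<1} x"])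
    show "AE x in lborel. ennpowr (weight (E n) x) s * indicator {0..<1} x \<le> ennpowr (weight UNIV x) s * indicator {0..<1} x" for n
      using s_gt_1 by (intro AE_I2 mult_right_mono ennpowr_mono le) auto
    have "AE x in lborel. ennpowr (weight UNIV x) s * indicator {0..<1} x \<noteq> \<infinity>"
      by (rule nn_integral_PInf_AE) (use fin in \<open>auto\<close>)
    then show "AE x in lborel. (\<lambda>n. ennpowr (weight (E n) x) s * indicator {0..<1} x) \<longlonglongrightarrow> 0"
    proof eventually_elim
      case (elim x)
      show ?case
      proof (cases "x \<in> {0..<1}")
        case True
        then have fin: "weight UNIV x < \<infinity>" using elim by (auto simp: ennpowr_def less_top split: if_splits)
        have "(\<lambda>n. enn2real (weight (E n) x)) \<longlonglongrightarrow> 0"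
          using tendsto_enn2real[of _ 0] tendsto[OF fin] by simp
        then have "(\<lambda>n. ennreal (enn2real (weight (E n) x) powr s)) \<longlonglongrightarrow> ennreal (0 powr s)"
          using s_gt_1 by (intro tendsto_ennrealI tendsto_powr' tendsto_const) auto
        moreover have "ennpowr (weight (E n) x) s = ennreal (enn2real (weight (E n) x) powr s)" for n
          using le_less_trans[OF le fin, of n] by (auto simp: ennpowr_def)
        ultimately show ?thesis using True by simp
      qed simp
    qed
  qed (use fin in auto)
  then show ?thesis unfolding E_def by simp
qed

end

section \<open>Herglotz integrals\<close>

definition circle_measure :: "real measure" where
  "circle_measure = restrict_space lborel {0..<1}"

lemma space_circle_measure [simp]: "space circle_measure = {0..<1}"
  by (simp add: circle_measure_def space_restrict_space)

lemma borel_measurable_circle_measure [measurable (raw)]: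
  "f \<in> borel_measurable borel \<Longrightarrow> f \<in> borel_measurable circle_measure"
  unfolding circle_measure_def by (rule measurable_restrict_space1) simp

lemma nn_integral_circle_measure: "integral\<^sup>N circle_measure f = (\<integral>\<^sup>+x\<in>{0..<1}. f x \<partial>lborel)"
  by (simp add: circle_measure_def nn_integral_restrict_space)

lemma emeasure_circle_measure: "emeasure circle_measure (space circle_measure) = 1"
  by (simp add: circle_measure_def emeasure_restrict_space space_restrict_space)

interpretation circle: finite_measure circle_measure
  by (rule finite_measureI) (simp add: emeasure_circle_measure del: space_circle_measure)

lemma measure_circle_measure: "measure circle_measure {0..<1} = 1"
  using emeasure_circle_measure by (simp add: measure_def)

text \<open>Passes between gauge integrals over the closed interval and Lebesgue integrals over the
  half-open one.\<close>

lemma nn_integral_circle_continuous: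
  assumes "continuous_on {0..1} g" "\<And>x. 0 \<le> g x"
  shows "(\<integral>\<^sup>+x. ennreal (g x) \<partial>circle_measure) = ennreal (integral {0..1} g)"
proof -
  have "(g has_integral integral {0..1} g) {0..1}"
    using assms by (intro integrable_integral integrable_continuous_real)
  then have "(g has_integral integral {0..1} g) {0..<1}"
    by (rule has_integral_spike_set_eq[THEN iffD1, rotated -1])
       (rule negligible_subset[of "{1}"], simp, force)+
  from nn_integral_has_integral_lebesgue'[OF _ this] show ?thesis
    using assms by (simp add: nn_integral_circle_measure)
qed

lemma integrable_bounded_circle:
  fixes f :: "real \<Rightarrow> 'b::{banach, second_countable_topology}"
  assumes "f \<in> borel_measurable borel" "\<And>x. norm (f x) \<le> L"
  shows "integrable circle_measure f"
  by (rule circle.integrable_const_bound[of _ L]) (use assms in auto)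

lemma integral_poisson: "norm z < 1 \<Longrightarrow> integral\<^sup>L circle_measure (poisson z) = 1"
proof -
  assume z: "norm z < 1"
  have "(\<integral>\<^sup>+x. ennreal (poisson z x) \<partial>circle_measure) = ennreal 1"
    using nn_integral_circle_continuous[of "poisson z"] continuous_on_poisson[OF z, of "{0..1}" id] poisson_pos[OF z]
      integral_unique[OF has_integral_poisson_1[OF z]] by (simp add: less_imp_le)
  then show ?thesis
    by (subst integral_eq_nn_integral) (auto simp: poisson_pos[OF z] less_imp_le)
qed

text \<open>The tangent to the convex function \<open>a powr \<tau>\<close> at \<open>b\<close> lies
  below it; for \<open>\<tau> > 1\<close> this is Young's inequality for \<open>a\<close> and
  \<open>b powr (\<tau> - 1)\<close>. Integration against the Poisson kernel will give Jensen's
  inequality.\<close>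

lemma Young_tangent:
  fixes a b :: real
  assumes "0 \<le> a" "0 < b" "1 \<le> \<tau>"
  shows "b powr \<tau> + \<tau> * b powr (\<tau> - 1) * (a - b) \<le> a powr \<tau>"
proof (cases "\<tau> = 1")
  case False
  then have \<tau>: "1 < \<tau>" using assms by simp
  define \<sigma> where "\<sigma> = \<tau> / (\<tau> - 1)"
  have "a * b powr (\<tau> - 1) \<le> a powr \<tau> / \<tau> + (b powr (\<tau> - 1)) powr \<sigma> / \<sigma>"
    by (rule Youngs_inequality) (use \<tau> assms in \<open>auto simp: \<sigma>_def field_simps\<close>)
  also have "(b powr (\<tau> - 1)) powr \<sigma> = b powr \<tau>" using \<tau> by (simp add: powr_powr \<sigma>_def)
  finally have "\<tau> * (a * b powr (\<tau> - 1)) \<le> \<tau> * (a powr \<tau> / \<tau> + b powr \<tau> / \<sigma>)"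
    using \<tau> by (intro mult_left_mono) auto
  also have "\<dots> = a powr \<tau> + (\<tau> - 1) * b powr \<tau>" using \<tau> by (simp add: \<sigma>_def field_simps)
  finally have "\<tau> * (a * b powr (\<tau> - 1)) \<le> a powr \<tau> + (\<tau> - 1) * b powr \<tau>" .
  moreover have "b powr \<tau> = b powr (\<tau> - 1) * b" using assms(2) by (simp add: powr_diff)
  ultimately show ?thesis by (simp add: algebra_simps)
qed (use assms in simp)

text \<open>The Lebesgue counterpart of \<open>poisson_int\<close>: the functions of the duality
  argument are bounded and Borel, in general not continuous.\<close>

definition poisson_L :: "(real \<Rightarrow> real) \<Rightarrow> complex \<Rightarrow> real" where
  "poisson_L k z = (\<integral>x. poisson z x * k x \<partial>circle_measure)"

context
  fixes k :: "real \<Rightarrow> real" and L :: real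
  assumes k [measurable]: "k \<in> borel_measurable borel" and k1: "\<And>x. 1 \<le> k x" and kL: "\<And>x. k x \<le> L"
begin

lemma poisson_L_integrable:
  assumes z: "norm z < 1"
  shows "integrable circle_measure (\<lambda>x. poisson z x * k x)"
proof (rule integrable_bounded_circle)
  show "norm (poisson z x * k x) \<le> 2 / (1 - norm z) * L" for x
  proof -
    have "poisson z x * k x \<le> 2 / (1 - norm z) * L"
      using k1[of x] kL[of x] poisson_le[OF z, of x] z by (intro mult_mono) auto
    then show ?thesis using k1[of x] poisson_pos[OF z, of x] by (simp add: abs_mult)
  qed
qed measurable

lemma poisson_L_ge_1:
  assumes z: "norm z < 1"
  shows "1 \<le> poisson_L k z"
proof -
  have "1 = (\<integral>x. poisson z x \<partial>circle_measure)" using integral_poisson[OF z] by simp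
  also have "\<dots> \<le> poisson_L k z" unfolding poisson_L_def
  proof (rule integral_mono)
    show "integrable circle_measure (poisson z)"
      by (rule integrable_bounded_circle[of _ "2 / (1 - norm z)"])
         (use poisson_pos[OF z] poisson_le[OF z] in \<open>auto simp: less_imp_le abs_of_pos\<close>)
    show "poisson z x \<le> poisson z x * k x" for x
      using mult_left_mono[OF k1[of x], of "poisson z x"] poisson_pos[OF z, of x] by simp
  qed (rule poisson_L_integrable[OF z])
  finally show ?thesis .
qed

lemma nn_integral_poisson_L:
  assumes z: "norm z < 1"
  shows "ennreal (poisson_L k z) = (\<integral>\<^sup>+x. ennreal (poisson z x) * ennreal (k x) \<partial>circle_measure)"
proof -
  have "0 \<le> poisson z x * k x" for x
    using k1[of x] poisson_pos[OF z, of x] by simp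
  then have "(\<integral>\<^sup>+x. ennreal (poisson z x * k x) \<partial>circle_measure) = ennreal (poisson_L k z)"
    unfolding poisson_L_def by (intro nn_integral_eq_integral poisson_L_integrable[OF z] AE_I2)
  then show ?thesis using k1 poisson_pos[OF z]
    by (simp add: ennreal_mult less_imp_le order_trans[OF zero_le_one])
qed

end

lemma poisson_L_Jensen:
  assumes k: "k \<in> borel_measurable borel" "\<And>x. 1 \<le> k x" "\<And>x. k x \<le> L" and \<tau>: "1 \<le> \<tau>" and z: "norm z < 1"
  shows "poisson_L k z powr \<tau> \<le> poisson_L (\<lambda>x. k x powr \<tau>) z"
proof -
  note k(1) [measurable]
  have k\<tau>: "(\<lambda>x. k x powr \<tau>) \<in> borel_measurable borel" "\<And>x. 1 \<le> k x powr \<tau>" "\<And>x. k x powr \<tau> \<le> L powr \<tau>"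
    using k \<tau> by (auto intro!: ge_one_powr_ge_zero powr_mono2 intro: order_trans[OF zero_le_one])
  note i = poisson_L_integrable[OF k z] poisson_L_integrable[OF k\<tau> z]
  define b where "b = poisson_L k z"
  have b: "0 < b" using poisson_L_ge_1[OF k z] by (simp add: b_def)
  have ip: "integrable circle_measure (poisson z)"
    by (rule integrable_bounded_circle[of _ "2 / (1 - norm z)"])
       (use poisson_pos[OF z] poisson_le[OF z] in \<open>auto simp: less_imp_le abs_of_pos\<close>)
  define c where "c = \<tau> * b powr (\<tau> - 1)"
  \<comment> \<open>The tangent at the mean \<open>b\<close>, times the kernel: since the kernel has
    mass 1, the part linear in \<open>k x - b\<close> integrates to 0.\<close>
  have "b powr \<tau> = (\<integral>x. (b powr \<tau> - c * b) * poisson z x + c * (poisson z x * k x) \<partial>circle_measure)"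
    using i ip integral_poisson[OF z] by (simp add: b_def poisson_L_def)
  also have "\<dots> \<le> poisson_L (\<lambda>x. k x powr \<tau>) z"
    unfolding poisson_L_def
  proof (rule integral_mono)
    fix x
    have "poisson z x * (b powr \<tau> + c * (k x - b)) \<le> poisson z x * k x powr \<tau>"
      unfolding c_def using poisson_pos[OF z, of x] k(2)[of x] b \<tau> by (intro mult_left_mono Young_tangent) auto
    then show "(b powr \<tau> - c * b) * poisson z x + c * (poisson z x * k x) \<le> poisson z x * k x powr \<tau>"
      by (simp add: algebra_simps)
  qed (use i ip in auto)
  finally show ?thesis by (simp add: b_def)
qed

text \<open>In polar form the claim is \<open>1 \<le> A * cos \<theta> powr \<tau> - B * cos (\<tau>
  * \<theta>)\<close> for \<open>0 \<le> \<theta> < pi / 2\<close>. Near \<open>pi / 2\<close> the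
  second cosine is negative and bounded away from 0; elsewhere \<open>cos \<theta>\<close> is
  bounded below. The condition \<open>\<tau> \<le> 2\<close> keeps \<open>\<tau> * \<theta>\<close>
  at most \<open>pi\<close>, where cosine decreases.\<close>

lemma half_plane_powr_bound:
  fixes \<tau> :: real
  assumes \<tau>: "1 < \<tau>" "\<tau> \<le> 2"
  obtains A B where "0 < A" "0 < B"
    "\<And>w. 0 < Re w \<Longrightarrow> norm w powr \<tau> \<le> A * Re w powr \<tau> - B * Re (w powr of_real \<tau>)"
proof -
  \<comment> \<open>The midpoint of \<open>pi / (2 * \<tau>)\<close>, where
    \<open>cos (\<tau> * \<theta>)\<close> changes sign, and \<open>pi / 2\<close>.\<close>
  define \<phi> where "\<phi> = pi / 4 * (1 + 1 / \<tau>)"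
  have \<phi>: "0 < \<phi>" "\<phi> < pi / 2" "\<tau> * \<phi> = pi / 4 * (\<tau> + 1)" using \<tau> by (auto simp: \<phi>_def field_simps intro!: add_pos_pos)
  define \<kappa> where "\<kappa> = - cos (pi / 4 * (\<tau> + 1))"
  have "cos (pi / 4 * (\<tau> + 1)) < cos (pi / 2)"
    using mult_strict_left_mono[of 2 "\<tau> + 1" "pi / 4"] mult_left_mono[of "\<tau> + 1" 4 "pi / 4"] \<tau>
    by (intro cos_monotone_0_pi) auto
  then have \<kappa>: "0 < \<kappa>" by (simp add: \<kappa>_def)
  have cos\<phi>: "0 < cos \<phi>" using \<phi> by (intro cos_gt_zero) auto
  define B where "B = 1 / \<kappa>"
  define A where "A = (1 + B) / cos \<phi> powr \<tau>"
  have B: "0 < B" using \<kappa> by (simp add: B_def)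
  have A: "0 < A" using B cos\<phi> by (simp add: A_def)
  have angle: "1 \<le> A * cos \<theta> powr \<tau> - B * cos (\<tau> * \<theta>)" if \<theta>: "0 \<le> \<theta>" "\<theta> < pi / 2" for \<theta>
  proof (cases "\<theta> \<le> \<phi>")
    case True
    have "cos \<phi> \<le> cos \<theta>" using True \<theta> \<phi> by (intro cos_monotone_0_pi_le) auto
    then have "cos \<phi> powr \<tau> \<le> cos \<theta> powr \<tau>" using cos\<phi> \<tau> by (intro powr_mono2) auto
    then have "A * cos \<phi> powr \<tau> \<le> A * cos \<theta> powr \<tau>" using A by (intro mult_left_mono) auto
    moreover have "A * cos \<phi> powr \<tau> = 1 + B" using cos\<phi> by (simp add: A_def)
    moreover have "B * cos (\<tau> * \<theta>) \<le> B * 1" using B by (intro mult_left_mono) auto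
    ultimately show ?thesis by simp
  next
    case False
    have "cos (\<tau> * \<theta>) \<le> cos (\<tau> * \<phi>)"
    proof (rule cos_monotone_0_pi_le)
      show "\<tau> * \<phi> \<le> \<tau> * \<theta>" using False \<tau> by simp
      have "\<tau> * \<theta> \<le> 2 * (pi / 2)" using \<tau> \<theta> by (intro mult_mono) auto
      then show "\<tau> * \<theta> \<le> pi" by simp
    qed (use \<phi> \<tau> in simp)
    then have "B * cos (\<tau> * \<theta>) \<le> B * (- \<kappa>)" using B \<phi>(3) by (intro mult_left_mono) (auto simp: \<kappa>_def)
    then have "B * cos (\<tau> * \<theta>) \<le> -1" using \<kappa> by (simp add: B_def)
    moreover have "0 \<le> A * cos \<theta> powr \<tau>" using A by simp
    ultimately show ?thesis by linarith
  qed
  have "norm w powr \<tau> \<le> A * Re w powr \<tau> - B * Re (w powr of_real \<tau>)" if w: "0 < Re w" for w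
  proof -
    have w0: "w \<noteq> 0" using w by auto
    define \<theta> where "\<theta> = \<bar>Arg w\<bar>"
    have \<theta>: "0 \<le> \<theta>" "\<theta> < pi / 2" unfolding \<theta>_def using w Arg_Re_pos[of w] by (simp, blast)
    have Rew: "Re w = norm w * cos \<theta>"
      using Arg_eq[OF w0] by (metis Re_complex_of_real \<theta>_def cos_Arg cos_abs_real nonzero_eq_divide_eq mult.commute w0 norm_eq_zero)
    have powr: "Re (w powr of_real \<tau>) = norm w powr \<tau> * cos (\<tau> * \<theta>)"
    proof -
      have "w powr of_real \<tau> = exp (of_real \<tau> * Ln w)" using w0 by (simp add: powr_def)
      also have "Re \<dots> = exp (\<tau> * ln (norm w)) * cos (\<tau> * Arg w)"
        using w0 by (simp add: Re_exp Arg_def)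
      also have "cos (\<tau> * Arg w) = cos (\<tau> * \<theta>)"
        unfolding \<theta>_def by (cases "0 \<le> Arg w") (auto simp: abs_if)
      finally show ?thesis using w0 by (simp add: powr_def)
    qed
    have "norm w powr \<tau> * 1 \<le> norm w powr \<tau> * (A * cos \<theta> powr \<tau> - B * cos (\<tau> * \<theta>))"
      by (intro mult_left_mono angle \<theta>) auto
    also have "\<dots> = A * Re w powr \<tau> - B * Re (w powr of_real \<tau>)"
      unfolding Rew powr using \<theta> by (simp add: powr_mult cos_ge_zero algebra_simps)
    finally show ?thesis by simp
  qed
  then show ?thesis using A B by (intro that)
qed

definition herglotz :: "(real \<Rightarrow> real) \<Rightarrow> complex \<Rightarrow> complex" where
  "herglotz k z = (\<integral>x. of_real (k x) * ((circle_exp x + z) / (circle_exp x - z)) \<partial>circle_measure)"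

context
  fixes k :: "real \<Rightarrow> real" and L :: real
  assumes k [measurable]: "k \<in> borel_measurable borel" and k1: "\<And>x. 1 \<le> k x" and kL: "\<And>x. k x \<le> L"
begin

lemma herglotz_integrable:
  assumes z: "norm z < 1"
  shows "integrable circle_measure (\<lambda>x. of_real (k x) * ((circle_exp x + z) / (circle_exp x - z)))"
proof (rule integrable_bounded_circle)
  show "norm (of_real (k x) * ((circle_exp x + z) / (circle_exp x - z))) \<le> L * (2 / (1 - norm z))" for x
  proof -
    have "norm (circle_exp x + z) \<le> 2" using norm_triangle_ineq[of "circle_exp x" z] z by simp
    moreover have "1 - norm z \<le> norm (circle_exp x - z)" using norm_triangle_ineq2[of "circle_exp x" z] by simp
    ultimately have "norm (circle_exp x + z) / norm (circle_exp x - z) \<le> 2 / (1 - norm z)"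
      using z by (intro frac_le) auto
    then have "k x * (norm (circle_exp x + z) / norm (circle_exp x - z)) \<le> L * (2 / (1 - norm z))"
      using k1[of x] kL[of x] by (intro mult_mono) auto
    then show ?thesis using k1[of x] by (simp add: norm_mult norm_divide)
  qed
qed measurable

lemma Re_herglotz:
  assumes z: "norm z < 1"
  shows "Re (herglotz k z) = poisson_L k z"
proof -
  have "Re (of_real (k x) * ((circle_exp x + z) / (circle_exp x - z))) = poisson z x * k x" for x
  proof -
    have "(a + c) * (a - c) + (b + d) * (b - d) = 1 - (c\<^sup>2 + d\<^sup>2)" if "a\<^sup>2 + b\<^sup>2 = 1" for a b c d :: real
      using that by (simp add: power2_eq_square algebra_simps)
    moreover have "(Re (circle_exp x))\<^sup>2 + (Im (circle_exp x))\<^sup>2 = 1"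
      using cmod_power2[of "circle_exp x"] by simp
    ultimately have "Re ((circle_exp x + z) / (circle_exp x - z)) = poisson z x"
      unfolding Re_divide poisson_def cmod_power2 by simp
    moreover have "Re (of_real c * w) = Re w * c" for c w by simp
    ultimately show ?thesis by (simp only:)
  qed
  then show ?thesis
    unfolding herglotz_def poisson_L_def using integral_Re[OF herglotz_integrable[OF z]] by simp
qed

text \<open>For \<open>\<zeta>\<close> on the circle the kernel
  \<open>(\<zeta> + z) / (\<zeta> - z)\<close> is 1 plus twice the sum of
  \<open>(z / \<zeta>) ^ n\<close> over \<open>n \<ge> 1\<close>; the geometric majorant permits
  termwise integration, which gives a power series in \<open>z\<close>.\<close>

lemma holomorphic_herglotz: "herglotz k holomorphic_on unit_disc"
proof (rule power_series_holomorphic)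
  fix z assume "z \<in> unit_disc"
  then have z: "norm z < 1" by simp
  define g where "g n x = (if n = 0 then 1 else 2) * of_real (k x) * (z / circle_exp x) ^ n" for n x
  have L: "0 \<le> L" using k1[of 0] kL[of 0] by simp
  have gb: "norm (g n x) \<le> 2 * L * norm z ^ n" for n x
    using k1[of x] kL[of x] by (auto simp: g_def norm_mult norm_power norm_divide intro!: mult_mono)
  have gi: "integrable circle_measure (g n)" for n
    by (rule integrable_bounded_circle[OF _ gb]) (simp add: g_def)
  have summ: "summable (\<lambda>n. 2 * L * norm z ^ n)" using z by (intro summable_mult summable_geometric) auto
  have sums: "(\<lambda>n. g n x) sums (of_real (k x) * ((circle_exp x + z) / (circle_exp x - z)))" for x
  proof -
    define w where "w = z / circle_exp x"
    have w: "norm w < 1" using z by (simp add: w_def norm_divide)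
    then have "(\<lambda>n. 2 * of_real (k x) * w ^ n) sums (2 * of_real (k x) * (1 / (1 - w)))"
      by (intro sums_mult geometric_sums)
    from sums_diff[OF this sums_single[of 0 "\<lambda>_. of_real (k x)"]]
    have "(\<lambda>n. 2 * of_real (k x) * w ^ n - (if n = 0 then of_real (k x) else 0)) sums
      (2 * of_real (k x) * (1 / (1 - w)) - of_real (k x))" .
    moreover have "2 * of_real (k x) * w ^ n - (if n = 0 then of_real (k x) else 0) = g n x" for n
      by (simp add: g_def w_def)
    moreover have "2 * of_real (k x) * (1 / (1 - w)) - of_real (k x)
      = of_real (k x) * ((circle_exp x + z) / (circle_exp x - z))"
      using w circle_exp_neq[OF z, of x] by (auto simp: w_def field_simps)
    ultimately show ?thesis by simp
  qed
  have "(\<lambda>n. integral\<^sup>L circle_measure (g n)) sums (\<integral>x. (\<Sum>n. g n x) \<partial>circle_measure)"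
  proof (rule sums_integral[OF gi])
    show "AE x in circle_measure. summable (\<lambda>n. norm (g n x))"
      by (intro AE_I2 summable_comparison_test[OF _ summ]) (auto intro: gb)
    have "(\<integral>x. norm (g n x) \<partial>circle_measure) \<le> 2 * L * norm z ^ n" for n
    proof -
      have "(\<integral>x. norm (g n x) \<partial>circle_measure) \<le> (\<integral>x. 2 * L * norm z ^ n \<partial>circle_measure)"
        by (intro integral_mono integrable_norm gi gb) simp
      then show ?thesis by (simp add: measure_circle_measure)
    qed
    then show "summable (\<lambda>n. \<integral>x. norm (g n x) \<partial>circle_measure)"
      by (intro summable_comparison_test[OF _ summ]) auto
  qed
  also have "(\<integral>x. (\<Sum>n. g n x) \<partial>circle_measure) = herglotz k z"
    unfolding herglotz_def by (intro Bochner_Integration.integral_cong refl sums_unique[OF sums, symmetric])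
  also have "(\<lambda>n. integral\<^sup>L circle_measure (g n))
    = (\<lambda>n. (\<integral>x. (if n = 0 then 1 else 2) * of_real (k x) / circle_exp x ^ n \<partial>circle_measure) * (z - 0) ^ n)"
  proof
    fix n
    have "g n = (\<lambda>x. (if n = 0 then 1 else 2) * of_real (k x) / circle_exp x ^ n * (z - 0) ^ n)"
      by (auto simp: g_def fun_eq_iff power_divide)
    then show "integral\<^sup>L circle_measure (g n)
      = (\<integral>x. (if n = 0 then 1 else 2) * of_real (k x) / circle_exp x ^ n \<partial>circle_measure) * (z - 0) ^ n"
      by (simp only: integral_mult_left_zero)
  qed
  finally show "(\<lambda>n. (\<integral>x. (if n = 0 then 1 else 2) * of_real (k x) / circle_exp x ^ n \<partial>circle_measure) * (z - 0) ^ n) sums herglotz k z" .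
qed

end

section \<open>Boundedness and compactness from (iii)\<close>

context hardy_embedding
begin

text \<open>Montel's theorem gives local uniform convergence; the rest of the mass lies in a thin annulus, where
  the embedding has small norm.\<close>

lemma weight_imp_bounded_compact:
  assumes meas: "weight UNIV \<in> borel_measurable borel"
    and fin: "(\<integral>\<^sup>+x\<in>{0..<1}. ennpowr (weight UNIV x) s \<partial>lborel) < \<infinity>"
  shows "bounded_hardy_Lp p q \<mu> (\<lambda>f. f)" "compact_hardy_Lp p q \<mu> (\<lambda>f. f)"
proof -
  have sf: "sigma_finite_measure \<mu>" by (rule weight_finite_imp_sigma_finite[OF meas fin])
  define J where "J E = (\<integral>\<^sup>+x\<in>{0..<1}. ennpowr (weight E x) s \<partial>lborel)" for E
  have J_le: "J E \<le> J UNIV" for E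
    unfolding J_def weight_def using s_gt_1
    by (intro nn_integral_mono mult_right_mono ennpowr_mono) (auto simp: indicator_def)
  have J_fin: "J E < \<infinity>" for E using J_le[of E] fin by (simp add: J_def order.strict_trans1)
  define K where "K E = enn2real (J E) powr (1 / s)" for E
  have K: "0 \<le> K E" "J E \<le> ennreal (K E powr s)" for E
    using s_gt_1 J_fin[of E] by (auto simp: K_def powr_powr)
  define c where "c = embed_const"
  have est: "(\<integral>\<^sup>+z\<in>E. ennreal (norm (f z) powr q) \<partial>\<mu>) \<le> ennreal (c * hardy_norm p f powr q * K E)"
    if "f \<in> hardy_space p" "E \<in> sets borel" for f E
    using embedding_estimate[OF sf that(2) K[unfolded J_def] that(1)] by (simp add: c_def)
  have c: "0 < c" using embed_const_pos by (simp add: c_def)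
  have Lp: "f \<in> Lp_space q \<mu>" "Lp_norm q \<mu> f \<le> (c * K UNIV) powr (1 / q) * hardy_norm p f" if f: "f \<in> hardy_space p" for f
  proof -
    have "(\<integral>\<^sup>+z. ennreal (norm (f z) powr q) \<partial>\<mu>) \<le> ennreal (c * hardy_norm p f powr q * K UNIV)"
      using est[OF f, of UNIV] by simp
    note * = Lp_norm_eq[OF hardy_measurable[OF f] this]
    then show "f \<in> Lp_space q \<mu>" using c K by auto
    have "(c * hardy_norm p f powr q * K UNIV) powr (1 / q) = (c * K UNIV) powr (1 / q) * hardy_norm p f"
      using c K[of UNIV] hardy_norm_nonneg[OF f] q by (simp add: powr_mult powr_powr mult_ac)
    then show "Lp_norm q \<mu> f \<le> (c * K UNIV) powr (1 / q) * hardy_norm p f" using * c K by auto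
  qed
  then show "bounded_hardy_Lp p q \<mu> (\<lambda>f. f)" unfolding bounded_hardy_Lp_def by blast
  \<comment> \<open>The constant 1 lies in the Hardy space, so the embedding estimate makes the
    total mass finite; this turns uniform convergence on the inner disc into convergence of the
    integral there.\<close>
  have mu_fin: "emeasure \<mu> (space \<mu>) < \<infinity>"
  proof -
    have "emeasure \<mu> (space \<mu>) = (\<integral>\<^sup>+z. ennreal (norm (1::complex) powr q) \<partial>\<mu>)" by simp
    also have "\<dots> < \<infinity>"
      using est[OF const_in_hardy_space, of UNIV 1] by (simp add: order.strict_trans1)
    finally show ?thesis .
  qed
  show "compact_hardy_Lp p q \<mu> (\<lambda>f. f)"
    unfolding compact_hardy_Lp_def
  proof (intro conjI ballI allI impI)
    fix F :: "nat \<Rightarrow> complex \<Rightarrow> complex"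
    assume "(\<forall>n. F n \<in> hardy_space p) \<and> bdd_above (range (\<lambda>n. hardy_norm p (F n)))"
    then obtain M where F: "\<And>n. F n \<in> hardy_space p" and M: "\<And>n. hardy_norm p (F n) \<le> M"
      by (auto simp: bdd_above_def)
    have M0: "0 \<le> M" using hardy_norm_nonneg[OF F, of 0] M[of 0] by simp
    define \<H> where "\<H> = {f \<in> hardy_space p. hardy_norm p f \<le> M}"
    obtain g r where g: "g holomorphic_on unit_disc" and r: "strict_mono (r :: nat \<Rightarrow> nat)"
      and lim: "\<And>z. z \<in> unit_disc \<Longrightarrow> (\<lambda>n. F (r n) z) \<longlonglongrightarrow> g z"
      and unif: "\<And>K. compact K \<Longrightarrow> K \<subseteq> unit_disc \<Longrightarrow> uniform_limit K (F \<circ> r) g sequentially"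
    proof (rule Montel[of unit_disc \<H> F])
      show "\<exists>B. \<forall>h\<in>\<H>. \<forall>z\<in>K. norm (h z) \<le> B" if K: "compact K" "K \<subseteq> unit_disc" for K
      proof -
        obtain \<rho> where "\<rho> < 1" "\<And>z. z \<in> K \<Longrightarrow> norm z \<le> \<rho>"
        proof (cases "K = {}")
          case False
          then obtain w where "w \<in> K" "\<And>z. z \<in> K \<Longrightarrow> norm z \<le> norm w"
            using continuous_attains_sup[OF K(1) False, of norm] by (auto intro: continuous_intros)
          then show ?thesis using K(2) that[of "norm w"] by auto
        qed (use that[of 0] in auto)
        then show ?thesis
        proof (intro exI[of _ "(2 / (1 - \<rho>) * M powr p) powr (1 / p)"] ballI)
          fix h z assume "h \<in> \<H>" "z \<in> K"
          then show "norm (h z) \<le> (2 / (1 - \<rho>) * M powr p) powr (1 / p)"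
            using \<open>\<rho> < 1\<close> \<open>\<And>z. z \<in> K \<Longrightarrow> norm z \<le> \<rho>\<close> by (intro hardy_locally_bounded) (auto simp: \<H>_def)
        qed
      qed
    qed (use F M in \<open>auto simp: \<H>_def hardy_space_def\<close>)
    have gH: "g \<in> hardy_space p" "hardy_norm p g \<le> M"
      using hardy_space_limit[of "\<lambda>n. F (r n)" M g] F M M0 g lim by auto
    define D where "D n = (\<lambda>z. F (r n) z - g z)" for n
    define M' where "M' = (2 powr p * (2 * M powr p)) powr (1 / p)"
    have D: "D n \<in> hardy_space p" "hardy_norm p (D n) \<le> M'" for n
      unfolding D_def M'_def using hardy_diff[OF F gH(1) p_pos M gH(2), of "r n"] by auto
    define E where "E n = {z :: complex. 1 - 1 / real (Suc n) \<le> norm z}" for n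
    have E [measurable]: "E n \<in> sets borel" for n
      unfolding E_def by (intro borel_closed closed_Collect_le continuous_intros)
    have K_lim: "(\<lambda>n. K (E n)) \<longlonglongrightarrow> 0"
    proof -
      have "(\<lambda>n. J (E n)) \<longlonglongrightarrow> 0"
        using weight_annulus_tendsto[OF sf fin] by (simp add: J_def E_def)
      then have "(\<lambda>n. enn2real (J (E n))) \<longlonglongrightarrow> 0" using tendsto_enn2real[of _ 0] by simp
      then have "(\<lambda>n. K (E n)) \<longlonglongrightarrow> 0 powr (1 / s)"
        unfolding K_def using s_gt_1 by (intro tendsto_powr' tendsto_const) auto
      then show ?thesis by simp
    qed
    define I where "I n = (\<integral>\<^sup>+z. ennreal (norm (D n z) powr q) \<partial>\<mu>)" for n
    have Dm [measurable]: "D n \<in> borel_measurable \<mu>" for n using hardy_measurable[OF D(1)] .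
    have I_lim: "I \<longlonglongrightarrow> 0"
    proof (rule order_tendstoI)
      fix a :: ennreal assume "0 < a"
      then obtain b where b: "0 < b" "b < a" using dense by blast
      then obtain e where e: "b = ennreal e" "0 < e" by (cases b) auto
      have "(\<lambda>n. c * M' powr q * K (E n)) \<longlonglongrightarrow> c * M' powr q * 0" by (intro tendsto_mult tendsto_const K_lim)
      then have "eventually (\<lambda>n. c * M' powr q * K (E n) < e / 2) sequentially"
        using e by (intro order_tendstoD) auto
      then obtain m where m: "c * M' powr q * K (E m) < e / 2" by (auto simp: eventually_sequentially)
      define V where "V = measure \<mu> (space \<mu>)"
      have V: "emeasure \<mu> (space \<mu>) = ennreal V" "0 \<le> V"
        using mu_fin by (auto simp: V_def emeasure_eq_ennreal_measure less_top)
      \<comment> \<open>Chosen so that the inner disc contributes at most \<open>e / 2\<close>, the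
        annulus \<open>E m\<close> taking the other half; \<open>V + 1\<close> avoids division by
        0.\<close>
      define \<eta> where "\<eta> = (e / (2 * (V + 1))) powr (1 / q)"
      have \<eta>: "0 < \<eta>" "\<eta> powr q * V \<le> e / 2"
        using e V(2) q by (auto simp: \<eta>_def powr_powr field_simps)
      have "uniform_limit (cball 0 (1 - 1 / real (Suc m))) (F \<circ> r) g sequentially"
        by (rule unif) (use order.strict_trans1[of _ "1 - 1 / real (Suc m)" 1] in auto)
      then have "\<forall>\<^sub>F n in sequentially. \<forall>z\<in>cball 0 (1 - 1 / real (Suc m)). dist ((F \<circ> r) n z) (g z) < \<eta>"
        using \<eta>(1) by (rule uniform_limitD)
      then show "\<forall>\<^sub>F n in sequentially. I n < a"
      proof eventually_elim
        case (elim n)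
        have "I n \<le> (\<integral>\<^sup>+z. ennreal (norm (D n z) powr q) * indicator (E m) z + ennreal (\<eta> powr q) \<partial>\<mu>)"
          unfolding I_def
        proof (rule nn_integral_mono)
          fix z
          show "ennreal (norm (D n z) powr q) \<le> ennreal (norm (D n z) powr q) * indicator (E m) z + ennreal (\<eta> powr q)"
          proof (cases "z \<in> E m")
            case False
            then have "norm (D n z) < \<eta>" using elim by (auto simp: E_def D_def dist_norm)
            then have "norm (D n z) powr q \<le> \<eta> powr q" using q by (intro powr_mono2) auto
            then show ?thesis using False by (simp add: ennreal_leI)
          qed simp
        qed
        also have "\<dots> = (\<integral>\<^sup>+z\<in>E m. ennreal (norm (D n z) powr q) \<partial>\<mu>) + ennreal (\<eta> powr q) * ennreal V"
          by (subst nn_integral_add) (auto simp: V)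
        also have "\<dots> \<le> ennreal (c * hardy_norm p (D n) powr q * K (E m)) + ennreal (\<eta> powr q) * ennreal V"
          by (intro add_right_mono est D E)
        also have "\<dots> = ennreal (c * hardy_norm p (D n) powr q * K (E m) + \<eta> powr q * V)"
          using c K V by (simp add: ennreal_mult ennreal_plus)
        also have "\<dots> \<le> ennreal (c * M' powr q * K (E m) + \<eta> powr q * V)"
          using c K(1) q hardy_norm_nonneg[OF D(1)] D(2)
          by (intro ennreal_leI add_right_mono mult_right_mono mult_left_mono powr_mono2) auto
        also have "\<dots> \<le> ennreal e" using m \<eta>(2) by (intro ennreal_leI) linarith
        finally show "I n < a" using b e by (simp add: order.strict_trans1)
      qed
    qed simp
    have "(\<lambda>n. Lp_norm q \<mu> (D n)) \<longlonglongrightarrow> 0"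
    proof -
      have "(\<lambda>n. enn2real (I n)) \<longlonglongrightarrow> 0" using tendsto_enn2real[of _ 0] I_lim by simp
      moreover have "enn2real (I n) = (\<integral>z. norm (D n z) powr q \<partial>\<mu>)" for n
        unfolding I_def by (rule integral_eq_nn_integral[symmetric]) auto
      ultimately have "(\<lambda>n. Lp_norm q \<mu> (D n)) \<longlonglongrightarrow> 0 powr (1 / q)"
        unfolding Lp_norm_def using q by (intro tendsto_powr' tendsto_const) auto
      then show ?thesis by simp
    qed
    then show "\<exists>r g. strict_mono r \<and> g \<in> Lp_space q \<mu> \<and> (\<lambda>n. Lp_norm q \<mu> (\<lambda>z. F (r n) z - g z)) \<longlonglongrightarrow> 0"
      using r Lp(1)[OF gH(1)] unfolding D_def by blast
  qed (rule Lp(1))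
qed

end

text \<open>With \<open>d = 1 - norm z\<close>, the squared distance to the vertex is at most
  \<open>5/4 * d^2\<close>, while \<open>1 - (norm z)^2 \<ge> d\<close>. This compares kernels
  pointwise, and hence \<open>B\<close> tested against \<open>h\<close> with the Poisson integral of
  \<open>h\<close>.\<close>

lemma poisson_lens_ge:
  assumes "norm z < 1" "lens x z"
  shows "1 / (1 - norm z) \<le> 5/4 * poisson z x"
proof -
  define d where "d = 1 - norm z"
  have d: "0 < d" using assms by (simp add: d_def)
  have "(norm (circle_exp x - z))\<^sup>2 \<le> 5/4 * d\<^sup>2" using lens_near[OF assms] by (simp add: d_def)
  then have "(1 - (norm z)\<^sup>2) / (5/4 * d\<^sup>2) \<le> poisson z x"
    unfolding poisson_def using assms(1) circle_exp_neq[OF assms(1), of x] d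
    by (intro divide_left_mono mult_pos_pos) (auto simp: abs_square_le_1)
  moreover have "1 * d \<le> 1 - (norm z)\<^sup>2"
    using mult_right_mono[of 1 "1 + norm z" d] d by (simp add: d_def power2_eq_square algebra_simps)
  then have "d / (5/4 * d\<^sup>2) \<le> (1 - (norm z)\<^sup>2) / (5/4 * d\<^sup>2)" by (intro divide_right_mono) auto
  ultimately have "d / (5/4 * d\<^sup>2) \<le> poisson z x" by linarith
  then show ?thesis using d by (simp add: d_def[symmetric] power2_eq_square field_simps)
qed

section \<open>M. Riesz's theorem for Herglotz integrals\<close>

lemma circle_measure_sigma_finite: "sigma_finite_measure circle_measure"
  by (rule circle.sigma_finite_measure_axioms)

lemma nn_integral_poisson: "norm z < 1 \<Longrightarrow> (\<integral>\<^sup>+x. ennreal (poisson z x) \<partial>circle_measure) = 1"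
  using nn_integral_circle_continuous[of "poisson z"] continuous_on_poisson[of z "{0..1}" "\<lambda>x. x"] poisson_pos[of z]
    integral_unique[OF has_integral_poisson_1[of z]] by (simp add: less_imp_le)

text \<open>M. Riesz's theorem for exponents in \<open>(1, 2]\<close>: the mean of \<open>Re (H powr \<tau>)\<close> is the
  nonnegative number \<open>H 0 powr \<tau>\<close>, which leaves only the integral of \<open>(Re H) powr \<tau>\<close>.\<close>

lemma herglotz_mean_le:
  assumes AB: "0 < A" "0 < B"
    "\<And>w. 0 < Re w \<Longrightarrow> norm w powr \<tau> \<le> A * Re w powr \<tau> - B * Re (w powr of_real \<tau>)"
    and \<tau>: "1 \<le> \<tau>" and k: "k \<in> borel_measurable borel" "\<And>x. 1 \<le> k x" "\<And>x. k x \<le> L"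
    and r: "0 < r" "r < 1"
  shows "integral {0..1} (\<lambda>y. norm (herglotz k (of_real r * circle_exp y)) powr \<tau>)
    \<le> A * (\<integral>x. k x powr \<tau> \<partial>circle_measure)"
proof -
  note k(1) [measurable]
  have hol: "herglotz k holomorphic_on unit_disc" by (rule holomorphic_herglotz[OF k])
  have nr: "norm (of_real r * w) < 1" if "norm w \<le> 1" for w :: complex
    using le_less_trans[OF mult_left_mono[OF that, of r], of 1] r by (simp add: norm_mult)
  have cont: "continuous_on {0..1} (\<lambda>y. herglotz k (of_real r * circle_exp y))"
    by (intro continuous_on_compose2[OF holomorphic_on_imp_continuous_on[OF hol]] continuous_intros)
       (use nr in auto)
  have Re: "Re (herglotz k z) = poisson_L k z" "1 \<le> poisson_L k z" if "norm z < 1" for z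
    using Re_herglotz[OF k that] poisson_L_ge_1[OF k that] by auto
  define G where "G w = herglotz k (of_real r * w) powr of_real \<tau>" for w
  \<comment> \<open>A real part of at least 1 keeps the Herglotz integral off the branch
    cut.\<close>
  have nonpos: "herglotz k z \<notin> \<real>\<^sub>\<le>\<^sub>0" if "norm z < 1" for z
    using Re[OF that] by (auto simp: complex_nonpos_Reals_iff)
  have holG: "G holomorphic_on cball 0 1"
    unfolding G_def
    by (intro holomorphic_intros holomorphic_on_compose_gen[OF _ hol, unfolded o_def])
       (use nr nonpos in auto)
  have "((\<lambda>y. G (circle_exp y)) has_integral G 0) {0..1}"
    by (rule has_integral_mean_value[OF holomorphic_on_imp_continuous_on[OF holG] holomorphic_on_subset[OF holG]]) auto
  from has_integral_linear[OF this bounded_linear_Re]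
  have G_int: "((\<lambda>y. Re (G (circle_exp y))) has_integral Re (G 0)) {0..1}" by (simp add: o_def)
  have G0: "0 \<le> Re (G 0)"
  proof -
    have "herglotz k 0 = of_real (poisson_L k 0)"
      unfolding herglotz_def poisson_L_def by (simp add: poisson_def)
    moreover have "0 \<le> poisson_L k 0" using Re(2)[of 0] by simp
    ultimately show ?thesis by (simp add: G_def powr_of_real)
  qed
  define P where "P y = poisson_L k (of_real r * circle_exp y)" for y
  have P: "P y = Re (herglotz k (of_real r * circle_exp y))" "1 \<le> P y" for y
    unfolding P_def using Re nr[of "circle_exp y"] by auto
  have contP: "continuous_on {0..1} (\<lambda>y. P y powr \<tau>)"
    unfolding P(1) using cont P \<tau> by (intro continuous_intros) (auto intro: order_trans[OF zero_le_one] simp flip: P(1))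
  have "integral {0..1} (\<lambda>y. norm (herglotz k (of_real r * circle_exp y)) powr \<tau>)
    \<le> integral {0..1} (\<lambda>y. A * P y powr \<tau> - B * Re (G (circle_exp y)))"
  proof (rule integral_le)
    show "(\<lambda>y. norm (herglotz k (of_real r * circle_exp y)) powr \<tau>) integrable_on {0..1}"
      using \<tau> by (intro integrable_continuous_real continuous_intros cont) auto
    show "(\<lambda>y. A * P y powr \<tau> - B * Re (G (circle_exp y))) integrable_on {0..1}"
      by (intro integrable_diff integrable_on_mult_right has_integral_integrable[OF G_int]
          integrable_continuous_real[OF contP])
    show "norm (herglotz k (of_real r * circle_exp y)) powr \<tau> \<le> A * P y powr \<tau> - B * Re (G (circle_exp y))" for y
      unfolding G_def using AB(3)[of "herglotz k (of_real r * circle_exp y)"] P[of y] by simp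
  qed
  also have "\<dots> = A * integral {0..1} (\<lambda>y. P y powr \<tau>) - B * Re (G 0)"
  proof (rule integral_unique, intro has_integral_diff has_integral_mult_right G_int)
    show "((\<lambda>y. P y powr \<tau>) has_integral integral {0..1} (\<lambda>y. P y powr \<tau>)) {0..1}"
      by (intro integrable_integral integrable_continuous_real contP)
  qed
  also have "\<dots> \<le> A * integral {0..1} (\<lambda>y. P y powr \<tau>)" using AB(2) G0 by simp
  \<comment> \<open>Poisson integration does not increase the means of exponent
    \<open>\<tau>\<close>: Jensen's inequality at each point, then Tonelli, the kernel having mass 1
    in \<open>y\<close> by symmetry.\<close>
  also have "\<dots> \<le> A * (\<integral>x. k x powr \<tau> \<partial>circle_measure)"
  proof (rule mult_left_mono)
    have k\<tau>: "(\<lambda>x. k x powr \<tau>) \<in> borel_measurable borel" "\<And>x. 1 \<le> k x powr \<tau>" "\<And>x. k x powr \<tau> \<le> L powr \<tau>"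
      using k \<tau> by (auto intro!: ge_one_powr_ge_zero powr_mono2 intro: order_trans[OF zero_le_one])
    interpret pair_sigma_finite circle_measure circle_measure
      by (simp add: pair_sigma_finite_def circle_measure_sigma_finite)
    have "ennreal (integral {0..1} (\<lambda>y. P y powr \<tau>)) = (\<integral>\<^sup>+y. ennreal (P y powr \<tau>) \<partial>circle_measure)"
      by (rule nn_integral_circle_continuous[OF contP, symmetric]) simp
    also have "\<dots> \<le> (\<integral>\<^sup>+y. (\<integral>\<^sup>+x. ennreal (poisson (of_real r * circle_exp y) x) * ennreal (k x powr \<tau>) \<partial>circle_measure) \<partial>circle_measure)"
    proof (rule nn_integral_mono)
      fix y
      have z: "norm (of_real r * circle_exp y) < 1" using nr by simp
      have "ennreal (P y powr \<tau>) \<le> ennreal (poisson_L (\<lambda>x. k x powr \<tau>) (of_real r * circle_exp y))"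
        unfolding P_def by (intro ennreal_leI poisson_L_Jensen[OF k \<tau> z])
      also have "\<dots> = (\<integral>\<^sup>+x. ennreal (poisson (of_real r * circle_exp y) x) * ennreal (k x powr \<tau>) \<partial>circle_measure)"
        by (rule nn_integral_poisson_L[OF k\<tau> z])
      finally show "ennreal (P y powr \<tau>) \<le> (\<integral>\<^sup>+x. ennreal (poisson (of_real r * circle_exp y) x) * ennreal (k x powr \<tau>) \<partial>circle_measure)" .
    qed
    also have "\<dots> = (\<integral>\<^sup>+x. (\<integral>\<^sup>+y. ennreal (poisson (of_real r * circle_exp y) x) * ennreal (k x powr \<tau>) \<partial>circle_measure) \<partial>circle_measure)"
    proof -
      have [measurable]: "fst \<in> borel_measurable (circle_measure \<Otimes>\<^sub>M circle_measure)" "snd \<in> borel_measurable (circle_measure \<Otimes>\<^sub>M circle_measure)"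
        using measurable_compose[OF measurable_fst borel_measurable_circle_measure[of "\<lambda>x. x"]]
          measurable_compose[OF measurable_snd borel_measurable_circle_measure[of "\<lambda>x. x"]] by auto
      have "(\<lambda>p. ennreal (poisson (of_real r * circle_exp (snd p)) (fst p)) * ennreal (k (fst p) powr \<tau>))
          \<in> borel_measurable (circle_measure \<Otimes>\<^sub>M circle_measure)" by measurable
      then show ?thesis by (intro Fubini') (simp add: split_beta')
    qed
    also have "\<dots> = (\<integral>\<^sup>+x. ennreal (k x powr \<tau>) \<partial>circle_measure)"
    proof (rule nn_integral_cong)
      fix x
      have "(\<integral>\<^sup>+y. ennreal (poisson (of_real r * circle_exp y) x) * ennreal (k x powr \<tau>) \<partial>circle_measure)
        = (\<integral>\<^sup>+y. ennreal (poisson (of_real r * circle_exp x) y) \<partial>circle_measure) * ennreal (k x powr \<tau>)"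
        unfolding poisson_sym[of r _ x] by (rule nn_integral_multc) measurable
      then show "(\<integral>\<^sup>+y. ennreal (poisson (of_real r * circle_exp y) x) * ennreal (k x powr \<tau>) \<partial>circle_measure) = ennreal (k x powr \<tau>)"
        using nr[of "circle_exp x"] by (simp add: nn_integral_poisson)
    qed
    also have "\<dots> = ennreal (\<integral>x. k x powr \<tau> \<partial>circle_measure)"
      by (rule nn_integral_eq_integral[OF integrable_bounded_circle[of _ "L powr \<tau>"]]) (use k\<tau>(3) in auto)
    finally show "integral {0..1} (\<lambda>y. P y powr \<tau>) \<le> (\<integral>x. k x powr \<tau> \<partial>circle_measure)"
      by (simp add: integral_nonneg_AE)
  qed (use AB in simp)
  finally show ?thesis .
qed

section \<open>Necessity of (iii): test functions and duality\<close>

context hardy_embedding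
begin

text \<open>Test functions \<open>H powr (1 / (\<gamma> * q))\<close>, where \<open>H\<close> is the Herglotz integral of \<open>h powr \<gamma>\<close> and
  \<open>\<gamma> \<ge> 1\<close> brings the exponent \<open>p / q\<close> into the range \<open>(1, 2]\<close>.\<close>

lemma weight_test:
  assumes mu: "finite_measure \<mu>"
    and bnd: "\<And>f. f \<in> hardy_space p \<Longrightarrow> f \<in> Lp_space q \<mu>"
      "\<And>f. f \<in> hardy_space p \<Longrightarrow> Lp_norm q \<mu> f \<le> C * hardy_norm p f"
  obtains C' where "0 \<le> C'" "\<And>h L. h \<in> borel_measurable borel \<Longrightarrow> (\<And>x. 1 \<le> h x) \<Longrightarrow> (\<And>x. h x \<le> L) \<Longrightarrow>
    (\<integral>\<^sup>+x. ennreal (h x) * weight UNIV x \<partial>circle_measure)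
      \<le> ennreal (C' * (\<integral>x. h x powr (p / q) \<partial>circle_measure) powr (q / p))"
proof -
  define t where "t = p / q"
  have t: "1 < t" using q qp by (simp add: t_def)
  \<comment> \<open>Thus \<open>\<tau>\<close> is the minimum of \<open>t\<close> and 2.\<close>
  define \<gamma> where "\<gamma> = max 1 (t / 2)"
  define \<tau> where "\<tau> = t / \<gamma>"
  have \<gamma>: "1 \<le> \<gamma>" by (simp add: \<gamma>_def)
  have \<tau>: "1 < \<tau>" "\<tau> \<le> 2" "\<gamma> * \<tau> = t" using t by (auto simp: \<tau>_def \<gamma>_def max_def)
  obtain A B where AB: "0 < A" "0 < B"
    "\<And>w. 0 < Re w \<Longrightarrow> norm w powr \<tau> \<le> A * Re w powr \<tau> - B * Re (w powr of_real \<tau>)"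
    using half_plane_powr_bound[OF \<tau>(1,2)] by metis
  \<comment> \<open>The constant of boundedness carries no sign, and powers of it are taken
    below.\<close>
  define C0 where "C0 = max C 0"
  define C' where "C' = 5/4 * (C0 powr q * A powr (q / p))"
  interpret finite_measure \<mu> by fact
  interpret pair_sigma_finite circle_measure \<mu>
    by (simp add: pair_sigma_finite_def circle_measure_sigma_finite sigma_finite_measure_axioms)
  have [measurable]: "fst \<in> borel_measurable (circle_measure \<Otimes>\<^sub>M \<mu>)" "snd \<in> borel_measurable (circle_measure \<Otimes>\<^sub>M \<mu>)"
    using measurable_compose[OF measurable_fst borel_measurable_circle_measure[of "\<lambda>x. x"]]
      measurable_compose[OF measurable_snd ident_measurable] by auto
  show ?thesis
  proof (rule that[of C'])
    show "0 \<le> C'" using AB by (simp add: C'_def)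
    fix h :: "real \<Rightarrow> real" and L
    assume h: "h \<in> borel_measurable borel" "\<And>x. 1 \<le> h x" "\<And>x. h x \<le> L"
    note h(1) [measurable]
    define k where "k x = h x powr \<gamma>" for x
    have k: "k \<in> borel_measurable borel" "\<And>x. 1 \<le> k x" "\<And>x. k x \<le> L powr \<gamma>"
      unfolding k_def using h \<gamma> by (auto intro!: ge_one_powr_ge_zero powr_mono2 intro: order_trans[OF zero_le_one])
    define S where "S = (\<integral>x. h x powr t \<partial>circle_measure)"
    have S: "(\<integral>x. k x powr \<tau> \<partial>circle_measure) = S" "0 \<le> S"
      by (simp_all add: S_def k_def powr_powr \<tau>(3))
    have Re: "Re (herglotz k z) = poisson_L k z" "1 \<le> poisson_L k z" if "norm z < 1" for z
      using Re_herglotz[OF k that] poisson_L_ge_1[OF k that] by auto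
    define f where "f z = herglotz k z powr of_real (1 / (\<gamma> * q))" for z
    have nf: "norm (f z) = norm (herglotz k z) powr (1 / (\<gamma> * q))" for z
      unfolding f_def by (subst norm_powr_real_powr') auto
    have holf: "f holomorphic_on unit_disc"
      unfolding f_def using Re
      by (intro holomorphic_intros holomorphic_herglotz[OF k]) (force simp: complex_nonpos_Reals_iff)
    have "p / (\<gamma> * q) = \<tau>" using \<gamma> q by (simp add: \<tau>_def t_def)
    then have nfp: "norm (f z) powr p = norm (herglotz k z) powr \<tau>" for z
      unfolding nf by (simp add: powr_powr)
    have fH: "f \<in> hardy_space p" "hardy_norm p f \<le> (A * S) powr (1 / p)"
    proof -
      have "integral {0..1} (\<lambda>x. norm (f (of_real r * circle_exp x)) powr p) \<le> ((A * S) powr (1 / p)) powr p"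
        if r: "0 < r" "r < 1" for r
        using herglotz_mean_le[OF AB _ k r] \<tau>(1) p_pos AB S unfolding nfp by (simp add: powr_powr)
      then show "f \<in> hardy_space p" "hardy_norm p f \<le> (A * S) powr (1 / p)"
        using hardy_spaceI[OF holf p_pos, of "(A * S) powr (1 / p)"] by auto
    qed
    have int: "integrable \<mu> (\<lambda>z. norm (f z) powr q)" using bnd(1)[OF fH(1)] by (simp add: Lp_space_def)
    have "Lp_norm q \<mu> f \<le> C0 * (A * S) powr (1 / p)"
    proof -
      have "Lp_norm q \<mu> f \<le> C * hardy_norm p f" by (rule bnd(2)[OF fH(1)])
      also have "\<dots> \<le> C0 * hardy_norm p f" using hardy_norm_nonneg[OF fH(1)] by (intro mult_right_mono) (auto simp: C0_def)
      also have "\<dots> \<le> C0 * (A * S) powr (1 / p)" using fH(2) by (intro mult_left_mono) (auto simp: C0_def)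
      finally show ?thesis .
    qed
    then have "Lp_norm q \<mu> f powr q \<le> (C0 * (A * S) powr (1 / p)) powr q"
      using q by (intro powr_mono2) (auto simp: Lp_norm_def)
    moreover have "Lp_norm q \<mu> f powr q = (\<integral>z. norm (f z) powr q \<partial>\<mu>)"
      using q by (simp add: Lp_norm_def powr_powr)
    moreover have "(C0 * (A * S) powr (1 / p)) powr q = C0 powr q * A powr (q / p) * S powr (q / p)"
      using AB S by (simp add: powr_mult powr_powr C0_def)
    ultimately have fq: "(\<integral>z. norm (f z) powr q \<partial>\<mu>) \<le> C0 powr q * A powr (q / p) * S powr (q / p)" by simp
    \<comment> \<open>Jensen's inequality bounds \<open>poisson_L h z powr \<gamma>\<close> by
      \<open>poisson_L k z\<close>, the real part of the Herglotz integral; the root of order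
      \<open>\<gamma>\<close> undoes the power in \<open>k\<close>.\<close>
    have fP: "poisson_L h z \<le> norm (f z) powr q" if z: "norm z < 1" for z
    proof -
      have "poisson_L h z powr \<gamma> \<le> poisson_L k z"
        using poisson_L_Jensen[OF h \<gamma> z] by (simp add: k_def[abs_def])
      also have "\<dots> \<le> norm (herglotz k z)" using Re(1)[OF z] complex_Re_le_cmod by metis
      finally have "(poisson_L h z powr \<gamma>) powr (1 / \<gamma>) \<le> norm (herglotz k z) powr (1 / \<gamma>)"
        using \<gamma> by (intro powr_mono2) auto
      then show ?thesis using \<gamma> q poisson_L_ge_1[OF h z] by (simp add: nf powr_powr)
    qed
    have "(\<integral>\<^sup>+x. ennreal (h x) * weight UNIV x \<partial>circle_measure)
      = (\<integral>\<^sup>+x. (\<integral>\<^sup>+z. ennreal (h x) * (ennreal (1 / (1 - norm z)) * indicator {z. lens x z} z) \<partial>\<mu>) \<partial>circle_measure)"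
      by (intro nn_integral_cong) (simp add: weight_def nn_integral_cmult)
    also have "\<dots> \<le> (\<integral>\<^sup>+x. (\<integral>\<^sup>+z. ennreal (5/4) * (ennreal (poisson z x) * ennreal (h x)) \<partial>\<mu>) \<partial>circle_measure)"
    proof (intro nn_integral_mono)
      fix x z assume "z \<in> space \<mu>"
      then have z: "norm z < 1" by (simp add: space_mu)
      show "ennreal (h x) * (ennreal (1 / (1 - norm z)) * indicator {z. lens x z} z)
        \<le> ennreal (5/4) * (ennreal (poisson z x) * ennreal (h x))"
      proof (cases "lens x z")
        case True
        have "h x * (1 / (1 - norm z)) \<le> h x * (5/4 * poisson z x)"
          using poisson_lens_ge[OF z True] h(2)[of x] by (intro mult_left_mono) auto
        then have "ennreal (h x * (1 / (1 - norm z))) \<le> ennreal (5/4 * (poisson z x * h x))"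
          by (intro ennreal_leI) (simp add: mult_ac)
        moreover have "ennreal (h x * (1 / (1 - norm z))) = ennreal (h x) * ennreal (1 / (1 - norm z))"
          using h(2)[of x] z by (intro ennreal_mult) auto
        moreover have "ennreal (5/4 * (poisson z x * h x)) = ennreal (5/4) * (ennreal (poisson z x) * ennreal (h x))"
          using h(2)[of x] poisson_pos[OF z, of x] by (subst ennreal_mult, simp, simp) (subst ennreal_mult, simp_all)
        ultimately show ?thesis using True by simp
      qed simp
    qed
    also have "\<dots> = (\<integral>\<^sup>+z. (\<integral>\<^sup>+x. ennreal (5/4) * (ennreal (poisson z x) * ennreal (h x)) \<partial>circle_measure) \<partial>\<mu>)"
    proof -
      have "(\<lambda>p. ennreal (5/4) * (ennreal (poisson (snd p) (fst p)) * ennreal (h (fst p))))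
        \<in> borel_measurable (circle_measure \<Otimes>\<^sub>M \<mu>)" by measurable
      then show ?thesis by (intro Fubini'[symmetric]) (simp add: split_beta')
    qed
    also have "\<dots> \<le> (\<integral>\<^sup>+z. ennreal (5/4) * ennreal (norm (f z) powr q) \<partial>\<mu>)"
    proof (rule nn_integral_mono)
      fix z assume "z \<in> space \<mu>"
      then have z: "norm z < 1" by (simp add: space_mu)
      have "(\<integral>\<^sup>+x. ennreal (5/4) * (ennreal (poisson z x) * ennreal (h x)) \<partial>circle_measure) = ennreal (5/4) * ennreal (poisson_L h z)"
        unfolding nn_integral_poisson_L[OF h z] by (rule nn_integral_cmult) measurable
      also have "\<dots> \<le> ennreal (5/4) * ennreal (norm (f z) powr q)"
        by (intro mult_left_mono ennreal_leI fP z) auto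
      finally show "(\<integral>\<^sup>+x. ennreal (5/4) * (ennreal (poisson z x) * ennreal (h x)) \<partial>circle_measure)
        \<le> ennreal (5/4) * ennreal (norm (f z) powr q)" .
    qed
    also have "\<dots> = ennreal (5/4) * ennreal (\<integral>z. norm (f z) powr q \<partial>\<mu>)"
      using int by (subst nn_integral_cmult) (auto simp: nn_integral_eq_integral)
    also have "\<dots> \<le> ennreal (5/4) * ennreal (C0 powr q * A powr (q / p) * S powr (q / p))"
      by (intro mult_left_mono ennreal_leI fq) auto
    also have "\<dots> = ennreal (C' * S powr (q / p))"
      using AB by (simp add: C'_def mult_ac flip: ennreal_mult)
    finally show "(\<integral>\<^sup>+x. ennreal (h x) * weight UNIV x \<partial>circle_measure)
      \<le> ennreal (C' * (\<integral>x. h x powr (p / q) \<partial>circle_measure) powr (q / p))"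
      by (simp add: S_def t_def)
  qed
qed

text \<open>Testing with \<open>h = v powr (s - 1)\<close>, for \<open>v\<close> a truncation of
  \<open>B\<close> from above and below, gives \<open>X \<le> (C' + 1) * X powr (1 / t)\<close> for
  the integral \<open>X\<close> of \<open>v powr s\<close>. As \<open>X\<close> is finite and at
  least 1, the power cancels and leaves a bound uniform in the truncation; monotone convergence
  removes the truncation.\<close>

lemma bounded_imp_weight:
  assumes "bounded_hardy_Lp p q \<mu> (\<lambda>f. f)"
  shows "sigma_finite_measure \<mu>" "(\<integral>\<^sup>+x\<in>{0..<1}. ennpowr (weight UNIV x) s \<partial>lborel) < \<infinity>"
proof -
  obtain C where C: "\<And>f. f \<in> hardy_space p \<Longrightarrow> f \<in> Lp_space q \<mu>"
      "\<And>f. f \<in> hardy_space p \<Longrightarrow> Lp_norm q \<mu> f \<le> C * hardy_norm p f"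
    using assms by (auto simp: bounded_hardy_Lp_def)
  have "integrable \<mu> (\<lambda>_. norm (1::complex) powr q)"
    using C(1)[OF const_in_hardy_space[of 1]] by (simp add: Lp_space_def)
  then have "emeasure \<mu> (space \<mu>) < \<infinity>" by (simp add: integrable_iff_bounded)
  then have mu: "finite_measure \<mu>" by (intro finite_measureI) auto
  then show sf: "sigma_finite_measure \<mu>" by (rule finite_measure.axioms(1))
  obtain C' where C': "0 \<le> C'" "\<And>h L. h \<in> borel_measurable borel \<Longrightarrow> (\<And>x. 1 \<le> h x) \<Longrightarrow> (\<And>x. h x \<le> L) \<Longrightarrow>
    (\<integral>\<^sup>+x. ennreal (h x) * weight UNIV x \<partial>circle_measure)
      \<le> ennreal (C' * (\<integral>x. h x powr (p / q) \<partial>circle_measure) powr (q / p))"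
    using weight_test[OF mu C] by blast
  have [measurable]: "weight UNIV \<in> borel_measurable borel" by (rule weight_measurable[OF sf]) simp
  define t where "t = p / q"
  have t: "1 < t" "(s - 1) * t = s" "1 - 1 / t = 1 / s" using q qp by (auto simp: t_def s field_simps)
  \<comment> \<open>The floor 1 makes powers of \<open>v\<close> admissible as test functions, at
    the price of the summand 1 in \<open>v \<le> B + 1\<close>; the cap \<open>n\<close> makes the
    integrals finite.\<close>
  define v where "v n x = max 1 (enn2real (min (weight UNIV x) (of_nat n)))" for n :: nat and x
  have v1: "1 \<le> v n x" for n x by (simp add: v_def)
  have vn: "v n x \<le> max 1 (real n)" for n x
  proof -
    have "enn2real (min (weight UNIV x) (of_nat n)) \<le> enn2real (of_nat n)"
      by (intro enn2real_mono) (auto simp: of_nat_less_top)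
    then show ?thesis unfolding v_def by (intro max.mono) auto
  qed
  have vw: "ennreal (v n x) \<le> weight UNIV x + 1" for n x
  proof -
    have "min (weight UNIV x) (of_nat n) < top" by (simp add: min_less_iff_disj of_nat_less_top)
    then have "ennreal (enn2real (min (weight UNIV x) (of_nat n))) = min (weight UNIV x) (of_nat n)"
      by (simp add: ennreal_enn2real_if)
    then have "ennreal (enn2real (min (weight UNIV x) (of_nat n))) \<le> weight UNIV x" by simp
    then show ?thesis
      unfolding v_def max_def by (auto intro: add_increasing2 add_increasing)
  qed
  have [measurable]: "v n \<in> borel_measurable borel" for n unfolding v_def by measurable
  have bound: "(\<integral>\<^sup>+x. ennreal (v n x powr s) \<partial>circle_measure) \<le> ennreal ((C' + 1) powr s)" for n
  proof -
    \<comment> \<open>The equality case of Hoelder's inequality: as \<open>(s - 1) * t = s\<close>,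
      both \<open>h powr t\<close> and \<open>h * v\<close> are \<open>v powr s\<close>.\<close>
    define h where "h x = v n x powr (s - 1)" for x
    define L where "L = max 1 (real n) powr (s - 1)"
    have h: "h \<in> borel_measurable borel" "\<And>x. 1 \<le> h x" "\<And>x. h x \<le> L"
      unfolding h_def L_def using v1 vn s_gt_1
      by (auto intro!: ge_one_powr_ge_zero powr_mono2 intro: order_trans[OF zero_le_one])
    note h(1) [measurable]
    define X where "X = (\<integral>x. h x powr t \<partial>circle_measure)"
    have ht: "h x powr t = v n x powr s" for x by (simp add: h_def powr_powr t(2))
    have hti: "integrable circle_measure (\<lambda>x. h x powr t)"
      by (rule integrable_bounded_circle[of _ "L powr t"])
         (use h t in \<open>auto intro!: powr_mono2 intro: order_trans[OF zero_le_one]\<close>)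
    have X: "(\<integral>\<^sup>+x. ennreal (v n x powr s) \<partial>circle_measure) = ennreal X"
      unfolding X_def ht[symmetric] by (rule nn_integral_eq_integral[OF hti]) simp
    have hi: "integrable circle_measure h"
      by (rule integrable_bounded_circle[of _ L]) (use h order_trans[OF zero_le_one h(2)] in auto)
    have P0: "poisson_L g 0 = (\<integral>x. g x \<partial>circle_measure)" for g
      by (simp add: poisson_L_def poisson_def)
    \<comment> \<open>The summand 1 in \<open>v \<le> B + 1\<close> contributes the integral of
      \<open>h\<close>, which Jensen's inequality bounds at the centre, where the Poisson kernel is
      1.\<close>
    have h_le: "(\<integral>x. h x \<partial>circle_measure) \<le> X powr (1 / t)"
    proof -
      have "(\<integral>x. h x \<partial>circle_measure) powr t \<le> X"
        using poisson_L_Jensen[OF h, of t 0] t by (simp add: P0 X_def)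
      then have "((\<integral>x. h x \<partial>circle_measure) powr t) powr (1 / t) \<le> X powr (1 / t)"
        using t by (intro powr_mono2) auto
      moreover have "0 \<le> (\<integral>x. h x \<partial>circle_measure)" using poisson_L_ge_1[OF h, of 0] by (simp add: P0)
      ultimately show ?thesis using t by (simp add: powr_powr)
    qed
    have X1: "1 \<le> X"
    proof -
      have "(\<integral>x. 1 \<partial>circle_measure) \<le> X" unfolding X_def
        using h t by (intro integral_mono hti) (auto intro: ge_one_powr_ge_zero)
      then show ?thesis by (simp add: measure_circle_measure)
    qed
    have "ennreal X = (\<integral>\<^sup>+x. ennreal (h x) * ennreal (v n x) \<partial>circle_measure)"
      unfolding X[symmetric] h_def
    proof (rule nn_integral_cong)
      fix x
      have "v n x powr s = v n x powr (s - 1) * v n x" using v1[of n x] by (simp add: powr_diff)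
      then show "ennreal (v n x powr s) = ennreal (v n x powr (s - 1)) * ennreal (v n x)"
        using v1[of n x] by (simp add: ennreal_mult)
    qed
    also have "\<dots> \<le> (\<integral>\<^sup>+x. ennreal (h x) * weight UNIV x + ennreal (h x) \<partial>circle_measure)"
    proof (rule nn_integral_mono)
      fix x
      show "ennreal (h x) * ennreal (v n x) \<le> ennreal (h x) * weight UNIV x + ennreal (h x)"
        using mult_left_mono[OF vw[of n x], of "ennreal (h x)"] by (simp add: distrib_left)
    qed
    also have "\<dots> = (\<integral>\<^sup>+x. ennreal (h x) * weight UNIV x \<partial>circle_measure) + (\<integral>\<^sup>+x. ennreal (h x) \<partial>circle_measure)"
      by (rule nn_integral_add) measurable
    also have "\<dots> \<le> ennreal (C' * X powr (1 / t)) + ennreal (X powr (1 / t))"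
    proof (rule add_mono)
      show "(\<integral>\<^sup>+x. ennreal (h x) * weight UNIV x \<partial>circle_measure) \<le> ennreal (C' * X powr (1 / t))"
        using C'(2)[OF h] by (simp add: X_def t_def)
      have "(\<integral>\<^sup>+x. ennreal (h x) \<partial>circle_measure) = ennreal (\<integral>x. h x \<partial>circle_measure)"
        by (rule nn_integral_eq_integral[OF hi]) (use h in \<open>auto intro: order_trans[OF zero_le_one]\<close>)
      then show "(\<integral>\<^sup>+x. ennreal (h x) \<partial>circle_measure) \<le> ennreal (X powr (1 / t))"
        using h_le by (simp add: ennreal_leI)
    qed
    also have "\<dots> = ennreal ((C' + 1) * X powr (1 / t))"
      using C'(1) by (simp add: distrib_right flip: ennreal_plus)
    finally have "X \<le> (C' + 1) * X powr (1 / t)" using C'(1) by (simp add: ennreal_le_iff)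
    moreover have "X = X powr (1 / s) * X powr (1 / t)"
      using X1 t(3) by (simp flip: powr_add add: algebra_simps)
    ultimately have "X powr (1 / s) * X powr (1 / t) \<le> (C' + 1) * X powr (1 / t)" by simp
    then have "X powr (1 / s) \<le> C' + 1" using X1 by (simp add: mult_le_cancel_right)
    then have "(X powr (1 / s)) powr s \<le> (C' + 1) powr s" using s_gt_1 by (intro powr_mono2) auto
    then show ?thesis unfolding X using X1 s_gt_1 by (simp add: powr_powr ennreal_leI)
  qed
  have incs: "incseq (\<lambda>n x. ennreal (v n x powr s))"
  proof (intro incseq_SucI le_funI ennreal_leI powr_mono2)
    fix n x
    show "v n x \<le> v (Suc n) x"
      unfolding v_def by (intro max.mono order_refl enn2real_mono min.mono) (auto simp: min_less_iff_disj of_nat_less_top)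
  qed (use s_gt_1 v1 in \<open>auto intro: order_trans[OF zero_le_one]\<close>)
  have "ennpowr (weight UNIV x) s \<le> (SUP n. ennreal (v n x powr s))" for x
  proof (cases "weight UNIV x")
    case (real w)
    obtain n where n: "w \<le> real n" using real_arch_simple by blast
    have "min (weight UNIV x) (of_nat n) = ennreal w"
      using real n by (simp add: min_def ennreal_of_nat_eq_real_of_nat)
    then have "w \<le> v n x" using real by (simp add: v_def)
    then have "ennpowr (weight UNIV x) s \<le> ennreal (v n x powr s)"
      using real s_gt_1 by (simp add: ennpowr_ennreal ennreal_leI powr_mono2)
    then show ?thesis by (rule order_trans) (rule SUP_upper, simp)
  next
    case top
    have "(of_nat n :: ennreal) \<le> (SUP n. ennreal (v n x powr s))" for n
    proof -
      have "real n \<le> v n x" using top by (simp add: v_def)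
      also have "\<dots> \<le> v n x powr s" using powr_mono[of 1 s "v n x"] v1[of n x] s_gt_1 by simp
      finally have "(of_nat n :: ennreal) \<le> ennreal (v n x powr s)"
        by (simp add: ennreal_of_nat_eq_real_of_nat ennreal_leI)
      then show ?thesis by (rule order_trans) (rule SUP_upper, simp)
    qed
    then have "(SUP n. ennreal (v n x powr s)) = top"
      by (metis ennreal_SUP_of_nat_eq_top SUP_least top_unique)
    then show ?thesis by (simp only: top_greatest)
  qed
  then have "(\<integral>\<^sup>+x. ennpowr (weight UNIV x) s \<partial>circle_measure) \<le> (\<integral>\<^sup>+x. (SUP n. ennreal (v n x powr s)) \<partial>circle_measure)"
    by (intro nn_integral_mono)
  also have "\<dots> = (SUP n. \<integral>\<^sup>+x. ennreal (v n x powr s) \<partial>circle_measure)"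
    by (rule nn_integral_monotone_convergence_SUP[OF incs]) measurable
  also have "\<dots> \<le> ennreal ((C' + 1) powr s)" by (intro SUP_least bound)
  finally show "(\<integral>\<^sup>+x\<in>{0..<1}. ennpowr (weight UNIV x) s \<partial>lborel) < \<infinity>"
    unfolding nn_integral_circle_measure by (simp add: order.strict_trans1)
qed

section \<open>Compactness implies boundedness\<close>

lemma hardy_scale:
  assumes f: "f \<in> hardy_space p" and c: "0 \<le> c"
  shows "(\<lambda>z. of_real c * f z) \<in> hardy_space p" "hardy_norm p (\<lambda>z. of_real c * f z) \<le> c * hardy_norm p f"
proof -
  have hol: "f holomorphic_on unit_disc" using f by (simp add: hardy_space_def)
  have "integral {0..1} (\<lambda>x. norm (of_real c * f (of_real r * circle_exp x)) powr p) \<le> (c * hardy_norm p f) powr p"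
    if r: "0 < r" "r < 1" for r
    using c mult_left_mono[OF hardy_spaceD[OF f r p_pos], of "c powr p"] hardy_norm_nonneg[OF f]
    by (simp add: norm_mult powr_mult)
  moreover have "(\<lambda>z. of_real c * f z) holomorphic_on unit_disc" by (intro holomorphic_intros hol)
  ultimately show "(\<lambda>z. of_real c * f z) \<in> hardy_space p" "hardy_norm p (\<lambda>z. of_real c * f z) \<le> c * hardy_norm p f"
    using hardy_spaceI[of "\<lambda>z. of_real c * f z" p "c * hardy_norm p f"] c hardy_norm_nonneg[OF f] p_pos
    by auto
qed

lemma Lp_norm_scale:
  assumes c: "0 \<le> c"
  shows "Lp_norm q \<mu> (\<lambda>z. of_real c * f z) = c * Lp_norm q \<mu> (f :: complex \<Rightarrow> complex)"
  using c q by (simp add: Lp_norm_def norm_mult powr_mult powr_powr)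

lemma Lp_norm_le_diff:
  fixes f g :: "complex \<Rightarrow> complex"
  assumes f: "f \<in> Lp_space q \<mu>" and g: "g \<in> Lp_space q \<mu>"
  shows "Lp_norm q \<mu> f powr q \<le> 2 powr q * (Lp_norm q \<mu> (\<lambda>z. f z - g z) powr q + Lp_norm q \<mu> g powr q)"
proof -
  have m [measurable]: "f \<in> borel_measurable \<mu>" "g \<in> borel_measurable \<mu>"
    and i: "integrable \<mu> (\<lambda>z. norm (f z) powr q)" "integrable \<mu> (\<lambda>z. norm (g z) powr q)"
    using f g by (auto simp: Lp_space_def)
  have tri: "norm (a + b) powr q \<le> 2 powr q * (norm a powr q + norm b powr q)" for a b :: complex
  proof -
    have "norm (a + b) powr q \<le> (norm a + norm b) powr q" using q by (intro powr_mono2 norm_triangle_ineq) auto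
    also have "\<dots> \<le> 2 powr q * (norm a powr q + norm b powr q)" using q by (intro powr_add_le) auto
    finally show ?thesis .
  qed
  have id: "integrable \<mu> (\<lambda>z. norm (f z - g z) powr q)"
  proof (rule Bochner_Integration.integrable_bound)
    show "integrable \<mu> (\<lambda>z. 2 powr q * (norm (f z) powr q + norm (g z) powr q))" using i by simp
    show "AE z in \<mu>. norm (norm (f z - g z) powr q) \<le> norm (2 powr q * (norm (f z) powr q + norm (g z) powr q))"
      using tri[of "f _" "- g _"] by (intro AE_I2) simp
  qed measurable
  have "(\<integral>z. norm (f z) powr q \<partial>\<mu>) \<le> (\<integral>z. 2 powr q * (norm (f z - g z) powr q + norm (g z) powr q) \<partial>\<mu>)"
  proof (rule integral_mono)
    show "norm (f z) powr q \<le> 2 powr q * (norm (f z - g z) powr q + norm (g z) powr q)" for z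
      using tri[of "f z - g z" "g z"] by simp
  qed (use i id in auto)
  also have "\<dots> = 2 powr q * ((\<integral>z. norm (f z - g z) powr q \<partial>\<mu>) + (\<integral>z. norm (g z) powr q \<partial>\<mu>))"
    using i id by simp
  finally show ?thesis using q by (simp add: Lp_norm_def powr_powr)
qed

text \<open>The growth estimate forces \<open>f\<close> to vanish on the disc; this is what allows
  functions violating boundedness to be normalised.\<close>

lemma hardy_norm_0_imp_Lp_norm_0:
  assumes f: "f \<in> hardy_space p" and "hardy_norm p f \<le> 0"
  shows "Lp_norm q \<mu> f = 0"
proof -
  have "hardy_norm p f = 0" using hardy_norm_nonneg[OF f] assms(2) by simp
  then have "norm (f z) powr p \<le> 0" if "norm z < 1" for z
    using hardy_growth[OF f p_pos that] p_pos by simp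
  then have "f z = 0" if "z \<in> space \<mu>" for z
    using that by (simp add: space_mu)
  then have "(\<integral>z. norm (f z) powr q \<partial>\<mu>) = (\<integral>z. 0 \<partial>\<mu>)" by (intro Bochner_Integration.integral_cong) auto
  then show ?thesis by (simp add: Lp_norm_def)
qed

text \<open>An unbounded embedding yields functions of Hardy norm at most 1 whose L^q norm exceeds
  \<open>n\<close>; along a convergent subsequence these norms would stay bounded, by the inequality
  with factor \<open>2 powr q\<close> that stands in for the triangle inequality.\<close>

lemma compact_imp_bounded_hardy:
  assumes "compact_hardy_Lp p q \<mu> (\<lambda>f. f)"
  shows "bounded_hardy_Lp p q \<mu> (\<lambda>f. f)"
proof (rule ccontr)
  assume nb: "\<not> ?thesis"
  have Lp: "\<And>f. f \<in> hardy_space p \<Longrightarrow> f \<in> Lp_space q \<mu>"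
    and compact: "\<And>F. (\<And>n::nat. F n \<in> hardy_space p) \<Longrightarrow> bdd_above (range (\<lambda>n. hardy_norm p (F n))) \<Longrightarrow>
        (\<exists>r g. strict_mono r \<and> g \<in> Lp_space q \<mu> \<and> (\<lambda>n. Lp_norm q \<mu> (\<lambda>z. F (r n) z - g z)) \<longlonglongrightarrow> 0)"
    using assms unfolding compact_hardy_Lp_def by blast+
  have "\<exists>f\<in>hardy_space p. real n * hardy_norm p f < Lp_norm q \<mu> f" for n :: nat
    using nb Lp unfolding bounded_hardy_Lp_def by (meson not_le)
  then obtain f where f: "\<And>n. f n \<in> hardy_space p" "\<And>n::nat. real n * hardy_norm p (f n) < Lp_norm q \<mu> (f n)"
    by metis
  have pos: "0 < hardy_norm p (f n)" for n
  proof (rule ccontr)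
    assume "\<not> 0 < hardy_norm p (f n)"
    then have "hardy_norm p (f n) = 0" using hardy_norm_nonneg[OF f(1)[of n]] by simp
    then show False using hardy_norm_0_imp_Lp_norm_0[OF f(1)[of n]] f(2)[of n] by simp
  qed
  define c where "c n = 1 / hardy_norm p (f n)" for n
  have c: "0 < c n" for n using pos by (simp add: c_def)
  define F where "F n = (\<lambda>z. of_real (c n) * f n z)" for n
  have F: "F n \<in> hardy_space p" "hardy_norm p (F n) \<le> 1" for n
    using hardy_scale[OF f(1)[of n] less_imp_le[OF c[of n]]] pos[of n] by (auto simp: F_def c_def)
  have FL: "real n < Lp_norm q \<mu> (F n)" for n
  proof -
    have "c n * (real n * hardy_norm p (f n)) < c n * Lp_norm q \<mu> (f n)" using c f(2) by (intro mult_strict_left_mono) auto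
    then show ?thesis unfolding F_def using Lp_norm_scale[of "c n" "f n"] c[of n] pos[of n] by (simp add: c_def)
  qed
  obtain r g where r: "strict_mono (r :: nat \<Rightarrow> nat)" "g \<in> Lp_space q \<mu>" "(\<lambda>n. Lp_norm q \<mu> (\<lambda>z. F (r n) z - g z)) \<longlonglongrightarrow> 0"
  proof -
    have "bdd_above (range (\<lambda>n. hardy_norm p (F n)))" by (rule bdd_aboveI2[of _ _ 1]) (use F in auto)
    from compact[OF F(1) this] show ?thesis by (elim exE conjE) (rule that)
  qed
  define b where "b n = 2 powr q * (Lp_norm q \<mu> (\<lambda>z. F (r n) z - g z) powr q + Lp_norm q \<mu> g powr q)" for n
  have "b \<longlonglongrightarrow> 2 powr q * (0 powr q + Lp_norm q \<mu> g powr q)"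
    unfolding b_def using q r(3) by (intro tendsto_intros tendsto_powr') (auto simp: Lp_norm_def)
  then have "Bseq b" by (intro convergent_imp_Bseq) (auto simp: convergent_def)
  then obtain M where M: "0 < M" "\<And>n. norm (b n) \<le> M" by (auto simp: Bseq_def)
  obtain n where n: "M powr (1 / q) \<le> real n" using real_arch_simple by blast
  have "M = (M powr (1 / q)) powr q" using M q by (simp add: powr_powr)
  also have "\<dots> \<le> real (r n) powr q"
    using n seq_suble[OF r(1), of n] q by (intro powr_mono2) auto
  also have "\<dots> < Lp_norm q \<mu> (F (r n)) powr q"
    using FL q by (intro powr_less_mono2) auto
  also have "\<dots> \<le> b n" unfolding b_def by (rule Lp_norm_le_diff[OF Lp[OF F(1)] r(2)])
  also have "\<dots> \<le> M" using M(2)[of n] by simp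
  finally show False by simp
qed

text \<open>The inequality form of the region makes the integrand jointly measurable, and
  sigma-finiteness carries this over to the parameter integral.\<close>

lemma B_fun_measurable:
  assumes "sigma_finite_measure \<mu>"
  shows "B_fun \<mu> \<in> borel_measurable arclength"
proof -
  interpret sigma_finite_measure \<mu> by fact
  have [measurable]: "cnj \<in> borel_measurable borel"
    by (intro borel_measurable_continuous_onI continuous_intros)
  have [measurable]: "snd \<in> borel_measurable (borel \<Otimes>\<^sub>M \<mu>)"
    using measurable_compose[OF measurable_snd ident_measurable] by simp
  have [measurable]: "Measurable.pred (borel \<Otimes>\<^sub>M \<mu>) (\<lambda>p. snd p = 0 \<or>
      norm (snd p) * cos ((1 - norm (snd p)) / 2) < Re (fst p * cnj (snd p)))"
    by measurable
  have "(\<lambda>p. ennreal (1 / (1 - norm (snd p))) * (if snd p = 0 \<or>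
      norm (snd p) * cos ((1 - norm (snd p)) / 2) < Re (fst p * cnj (snd p)) then 1 else 0))
      \<in> borel_measurable (borel \<Otimes>\<^sub>M \<mu>)" by measurable
  then have "(\<lambda>(\<zeta>, z). ennreal (1 / (1 - norm z)) * (if z = 0 \<or>
      norm z * cos ((1 - norm z) / 2) < Re (\<zeta> * cnj z) then 1 else 0))
      \<in> borel_measurable (borel \<Otimes>\<^sub>M \<mu>)" by (simp add: split_beta')
  from borel_measurable_nn_integral[OF this]
  have "(\<lambda>\<zeta>. \<integral>\<^sup>+z. ennreal (1 / (1 - norm z)) * (if z = 0 \<or>
      norm z * cos ((1 - norm z) / 2) < Re (\<zeta> * cnj z) then 1 else 0) \<partial>\<mu>) \<in> borel_measurable arclength"
    unfolding measurable_cong_sets[OF sets_arclength refl] by (rule measurable_restrict_space1)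
  then show ?thesis
  proof (rule measurable_cong[THEN iffD1, rotated])
    fix \<zeta> assume "\<zeta> \<in> space arclength"
    then have \<zeta>: "norm \<zeta> = 1" by (simp add: space_arclength)
    show "(\<integral>\<^sup>+z. ennreal (1 / (1 - norm z)) * (if z = 0 \<or>
      norm z * cos ((1 - norm z) / 2) < Re (\<zeta> * cnj z) then 1 else 0) \<partial>\<mu>) = B_fun \<mu> \<zeta>"
      unfolding B_fun_def
      by (intro nn_integral_cong) (auto simp: space_mu lens_region_iff[OF \<zeta>] indicator_def)
  qed
qed

lemma B_fun_Lp_iff:
  "B_fun \<mu> \<in> Lp_space_ennreal s arclength \<longleftrightarrow>
    B_fun \<mu> \<in> borel_measurable arclength \<and> (\<integral>\<^sup>+x\<in>{0..<1}. ennpowr (weight UNIV x) s \<partial>lborel) < \<infinity>"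
  using Lp_space_ennreal_arclength_iff[of "B_fun \<mu>" s]
  by (auto simp: B_fun_eq_weight Lp_space_ennreal_def)

text \<open>Measurability of \<open>B\<close> enters differently on the two sides: from (ii) the
  measure is finite and measurability follows, while (iii) contains it as part of membership, and
  sigma-finiteness is derived with its help.\<close>

lemma embedding_equivalence:
  "(compact_hardy_Lp p q \<mu> (\<lambda>f. f) \<longleftrightarrow> bounded_hardy_Lp p q \<mu> (\<lambda>f. f)) \<and>
   (bounded_hardy_Lp p q \<mu> (\<lambda>f. f) \<longleftrightarrow> B_fun \<mu> \<in> Lp_space_ennreal s arclength)"
proof -
  have "B_fun \<mu> \<in> Lp_space_ennreal s arclength" if "bounded_hardy_Lp p q \<mu> (\<lambda>f. f)"
    using bounded_imp_weight[OF that] B_fun_measurable B_fun_Lp_iff by blast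
  moreover have "bounded_hardy_Lp p q \<mu> (\<lambda>f. f) \<and> compact_hardy_Lp p q \<mu> (\<lambda>f. f)"
    if B: "B_fun \<mu> \<in> Lp_space_ennreal s arclength"
  proof -
    have "(\<lambda>x. B_fun \<mu> (circle_exp x)) \<in> borel_measurable borel"
      using measurable_compose[OF circle_exp_measurable_arclength] B B_fun_Lp_iff by blast
    then have "weight UNIV \<in> borel_measurable borel" unfolding B_fun_eq_weight .
    then show ?thesis using weight_imp_bounded_compact B B_fun_Lp_iff by blast
  qed
  ultimately show ?thesis using compact_imp_bounded_hardy by blast
qed

end

theorem theorem2:
  fixes p q :: real and \<mu> :: "complex measure"
  assumes "0 < q" and "q < p"
    and "sets \<mu> = sets (restrict_space borel unit_disc)"
  shows "(compact_hardy_Lp p q \<mu> (\<lambda>f. f) \<longleftrightarrow> bounded_hardy_Lp p q \<mu> (\<lambda>f. f)) \<and>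
         (bounded_hardy_Lp p q \<mu> (\<lambda>f. f) \<longleftrightarrow> B_fun \<mu> \<in> Lp_space_ennreal (p / (p - q)) arclength)"
proof -
  interpret hardy_embedding \<mu> p q "p / (p - q)"
    using assms by unfold_locales auto
  show ?thesis by (rule embedding_equivalence)
qed

end
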